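(* Let $\mathcal{C}$ be a $d$-uniform clutter. (i) If $\mathcal{C}$ is an oriented (orientable) pseudo-manifold, then $\mathcal{C}$ is minimal to $d$-linearity. (ii) If $\mathcal{C}$ is a non-oriented (non-orientable) pseudo-manifold, then $\mathcal{C}$ is minimal to $d$-linearity if and only if $\operatorname{char}(K)=2$.
   Context: $K$ is a fixed field. A $d$-uniform clutter $\mathcal{C}$ on $[n]$ is a set of $d$-element subsets (circuits) of $[n]$; $\overline{\mathcal{C}}$ is the set of all $d$-element subsets of $[n]$ not in $\mathcal{C}$, and the circuit ideal of $\mathcal{C}$ is $I(\overline{\mathcal{C}})=(\prod_{k\in T}x_k : T\in\overline{\mathcal{C}})\subset K[x_1,\dots,x_n]$ (with $I(\varnothing)=0$). A clique in $\mathcal{C}$ is a subset of $[n]$ all of whose $d$-element subsets belong to $\mathcal{C}$ (sets with fewer than $d$ elements are cliques); the clique complex $\Delta(\mathcal{C})$ is the simplicial complex of all cliques. ${\rm SC}(\mathcal{C})$ is the set of $(d-1)$-element subsets contained in some circuit, and $\deg_{\mathcal{C}}(e)$ is the number of circuits containing $e\in{\rm SC}(\mathcal{C})$. $\mathcal{C}$ is strongly connected if for any two circuits $F,G\in\mathcal{C}$ there is a chain of circuits $F=F_0,\dots,F_s=G$ in $\mathcal{C}$ with $|F_i\cap F_{i+1}|=d-1$ for $i=0,\dots,s-1$. A pseudo-manifold is a (nonempty) strongly connected $d$-uniform clutter with $\deg_{\mathcal{C}}(e)=2$ for all $e\in{\rm SC}(\mathcal{C})$. It is orientable if its circuits, viewed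 as $(d-1)$-simplices, can be oriented so that for each $e\in{\rm SC}(\mathcal{C})$ the two circuits containing $e$ induce opposite orientations on $e$; otherwise it is non-orientable. A finitely generated graded module $M\ne0$ has a $d$-linear resolution if $\operatorname{reg}(M)=d=\operatorname{indeg}(M)$, where $\operatorname{indeg}(M)=\inf\{i:M_i\ne0\}$ and $\operatorname{reg}(M)=\sup\{j-i:\beta_{i,j}(M)\neq0\}$, with $\beta_{i,j}(M)=\dim_K\operatorname{Tor}_i(K,M)_j$ the graded Betti numbers over the polynomial ring; the zero ideal is regarded as having a $d$-linear resolution. A $d$-uniform clutter $\mathcal{C}$ is minimal to $d$-linearity (over $K$) if $I(\overline{\mathcal{C}})$ does not have a $d$-linear resolution, for every proper subclutter $\mathcal{C}'\subsetneq\mathcal{C}$ the ideal $I(\overline{\mathcal{C}'})$ (complement taken in $[n]$) has a $d$-linear resolution, and $\dim\Delta(\mathcal{C})=d-1$.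
   Formalization: Part (i) additionally assumes that C is not the set of all d-subsets of some (d+1)-subset of [n]; such a C is an orientable pseudo-manifold (e.g. the triangle, d=2) but has dim Δ(C) = d, so it is never minimal to d-linearity. *)

theory Defs
  imports
    Complex_Main
    "HOL-Library.Poly_Mapping"
    "HOL-Library.Function_Algebras"
    "HOL-Library.Extended_Real"
    "HOL-Library.Ramsey"
begin

section \<open>Clutters and pseudo-manifolds\<close>

text \<open>
  The vertex set $[n]$ is \<open>{1..n}\<close>, and \<open>nsets A d\<close> is the set of all \<open>d\<close>-element subsets of
  \<open>A\<close>.  The uniformity \<open>d\<close> is a parameter of the notions below because it cannot be recovered
  from the empty clutter.
\<close>

definition uniform_clutter :: "nat \<Rightarrow> nat \<Rightarrow> nat set set \<Rightarrow> bool" where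
  "uniform_clutter n d C \<longleftrightarrow> C \<subseteq> nsets {1..n} d"

definition complement_clutter :: "nat \<Rightarrow> nat \<Rightarrow> nat set set \<Rightarrow> nat set set" where
  "complement_clutter n d C = nsets {1..n} d - C"

definition clique_complex :: "nat \<Rightarrow> nat \<Rightarrow> nat set set \<Rightarrow> nat set set" where
  "clique_complex n d C = {V. V \<subseteq> {1..n} \<and> nsets V d \<subseteq> C}"

definition complex_dim :: "nat set set \<Rightarrow> int" where
  "complex_dim \<Delta> = int (Max (card ` \<Delta>)) - 1"

definition SC :: "nat \<Rightarrow> nat set set \<Rightarrow> nat set set" where
  "SC d C = {e. card e = d - 1 \<and> (\<exists>F\<in>C. e \<subseteq> F)}"

definition clutter_deg :: "nat set set \<Rightarrow> nat set \<Rightarrow> nat" where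
  "clutter_deg C e = card {F \<in> C. e \<subseteq> F}"

definition strongly_connected :: "nat \<Rightarrow> nat set set \<Rightarrow> bool" where
  "strongly_connected d C \<longleftrightarrow>
     (\<forall>F\<in>C. \<forall>G\<in>C. \<exists>s (H :: nat \<Rightarrow> nat set).
        H 0 = F \<and> H s = G \<and> (\<forall>i\<le>s. H i \<in> C) \<and>
        (\<forall>i<s. card (H i \<inter> H (Suc i)) = d - 1))"

definition pseudo_manifold :: "nat \<Rightarrow> nat set set \<Rightarrow> bool" where
  "pseudo_manifold d C \<longleftrightarrow>
     C \<noteq> {} \<and> strongly_connected d C \<and> (\<forall>e\<in>SC d C. clutter_deg C e = 2)"

text \<open>
  An orientation of a simplex is recorded as a sign relative to the increasing order of its
  vertices: \<open>o F = 1\<close> stands for \<open>[v\<^sub>0, \<dots>, v\<^sub>m]\<close> and \<open>o F = -1\<close> for \<open>-[v\<^sub>0, \<dots>, v\<^sub>m]\<close>, where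
  \<open>v\<^sub>0 < \<dots> < v\<^sub>m\<close> are the vertices of \<open>F\<close>.  The orientation which \<open>[v\<^sub>0, \<dots>, v\<^sub>m]\<close> induces on the
  facet omitting \<open>v\<^sub>i\<close> is \<open>(-1)\<^sup>i\<close> times the increasing one, and \<open>i\<close> is the number of vertices
  below the omitted one.
\<close>

definition induced_orientation :: "(nat set \<Rightarrow> int) \<Rightarrow> nat set \<Rightarrow> nat set \<Rightarrow> int" where
  "induced_orientation ori F e = ori F * (-1) ^ card {u \<in> F. u < the_elem (F - e)}"

definition orientable :: "nat \<Rightarrow> nat set set \<Rightarrow> bool" where
  "orientable d C \<longleftrightarrow>
     (\<exists>ori :: nat set \<Rightarrow> int.
        (\<forall>F\<in>C. ori F = 1 \<or> ori F = -1) \<and>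
        (\<forall>e\<in>SC d C. \<forall>F\<in>C. \<forall>G\<in>C. F \<noteq> G \<and> e \<subseteq> F \<and> e \<subseteq> G \<longrightarrow>
           induced_orientation ori F e = - induced_orientation ori G e))"


section \<open>The polynomial ring and its ideals\<close>

text \<open>
  A monomial is a finitely supported exponent function and a polynomial a finitely supported
  coefficient function on monomials; the multiplication of \<open>\<Rightarrow>\<^sub>0\<close> is convolution.  The type
  has variables \<open>x\<^sub>k\<close> for all natural numbers \<open>k\<close>, and \<open>poly_ring n\<close> is the subring
  $K[x_1,\dots,x_n]$.
\<close>

type_synonym 'k mpoly = "(nat \<Rightarrow>\<^sub>0 nat) \<Rightarrow>\<^sub>0 'k"

definition poly_ring :: "nat \<Rightarrow> 'k::field mpoly set" where
  "poly_ring n = {p. \<forall>t\<in>Poly_Mapping.keys p. Poly_Mapping.keys t \<subseteq> {1..n}}"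

definition const :: "'k::field \<Rightarrow> 'k mpoly" where
  "const c = Poly_Mapping.single 0 c"

definition var :: "nat \<Rightarrow> 'k::field mpoly" where
  "var k = Poly_Mapping.single (Poly_Mapping.single k 1) 1"

definition mon_deg :: "(nat \<Rightarrow>\<^sub>0 nat) \<Rightarrow> nat" where
  "mon_deg t = (\<Sum>k\<in>Poly_Mapping.keys t. Poly_Mapping.lookup t k)"

text \<open>The zero polynomial is homogeneous of every degree, also of negative ones.\<close>

definition homogeneous :: "int \<Rightarrow> 'k::field mpoly \<Rightarrow> bool" where
  "homogeneous m p \<longleftrightarrow> (\<forall>t\<in>Poly_Mapping.keys p. int (mon_deg t) = m)"

text \<open>The ideal of \<open>poly_ring n\<close> generated by a finite set.\<close>

definition ideal_generated :: "nat \<Rightarrow> 'k::field mpoly set \<Rightarrow> 'k mpoly set" where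
  "ideal_generated n G = {\<Sum>g\<in>G. q g * g | q. \<forall>g\<in>G. q g \<in> poly_ring n}"

definition circuit_ideal :: "nat \<Rightarrow> nat set set \<Rightarrow> 'k::field mpoly set" where
  "circuit_ideal n T = ideal_generated n ((\<lambda>A. \<Prod>k\<in>A. var k) ` T)"


section \<open>Tor and graded Betti numbers\<close>

text \<open>
  Write \<open>S\<close> for \<open>poly_ring n\<close>.  A complex of finitely generated graded free \<open>S\<close>-modules
  \<open>F\<^sub>i = \<Oplus>\<^bsub>k < fc_rank i\<^esub> S(- fc_shift i k)\<close>, with an augmentation \<open>F\<^sub>0 \<rightarrow> K\<close>, is given by
  its ranks, the degrees of the basis elements, the matrices of \<open>F\<^sub>i \<rightarrow> F\<^bsub>i-1\<^esub>\<close> for \<open>i \<ge> 1\<close>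
  (row \<open>k\<close> of \<open>fc_mat i\<close> is the image of the \<open>k\<close>-th basis element of \<open>F\<^sub>i\<close>) and the images in
  \<open>K\<close> of the basis elements of \<open>F\<^sub>0\<close>.
\<close>

record (overloaded) 'k free_complex =
  fc_rank :: "nat \<Rightarrow> nat"
  fc_shift :: "nat \<Rightarrow> nat \<Rightarrow> int"
  fc_mat :: "nat \<Rightarrow> nat \<Rightarrow> nat \<Rightarrow> 'k mpoly"
  fc_aug :: "nat \<Rightarrow> 'k"

text \<open>
  \<open>M\<^sup>r\<close> as functions vanishing from \<open>r\<close> on.  For an \<open>S\<close>-module \<open>M\<close> this is the tensor product
  over \<open>S\<close> of a free module of rank \<open>r\<close> with \<open>M\<close>; for \<open>M = S\<close> it is the free module itself.
\<close>

definition direct_power :: "'k::field mpoly set \<Rightarrow> nat \<Rightarrow> (nat \<Rightarrow> 'k mpoly) set" where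
  "direct_power M r = {v. (\<forall>k<r. v k \<in> M) \<and> (\<forall>k\<ge>r. v k = 0)}"

text \<open>
  The differential \<open>F\<^sub>i \<otimes> M \<rightarrow> F\<^bsub>i-1\<^esub> \<otimes> M\<close>, which is zero on \<open>F\<^sub>0 \<otimes> M\<close>.
\<close>

definition fc_diff ::
    "'k::field free_complex \<Rightarrow> nat \<Rightarrow> (nat \<Rightarrow> 'k mpoly) \<Rightarrow> (nat \<Rightarrow> 'k mpoly)" where
  "fc_diff F i v =
     (\<lambda>l. if i \<ge> 1 \<and> l < fc_rank F (i - 1) then \<Sum>k<fc_rank F i. v k * fc_mat F i k l else 0)"

text \<open>
  \<open>K = S / (x\<^sub>1, \<dots>, x\<^sub>n)\<close>, so an element of \<open>S\<close> acts on \<open>K\<close> through its constant coefficient.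
\<close>

definition fc_augment :: "'k::field free_complex \<Rightarrow> (nat \<Rightarrow> 'k mpoly) \<Rightarrow> 'k" where
  "fc_augment F v = (\<Sum>k<fc_rank F 0. Poly_Mapping.lookup (v k) 0 * fc_aug F k)"

definition graded_free_resolution :: "nat \<Rightarrow> 'k::field free_complex \<Rightarrow> bool" where
  "graded_free_resolution n F \<longleftrightarrow>
     (\<forall>i\<ge>1. \<forall>k<fc_rank F i. \<forall>l<fc_rank F (i - 1).
        fc_mat F i k l \<in> poly_ring n \<and>
        homogeneous (fc_shift F i k - fc_shift F (i - 1) l) (fc_mat F i k l)) \<and>
     (\<forall>k<fc_rank F 0. fc_aug F k \<noteq> 0 \<longrightarrow> fc_shift F 0 k = 0) \<and>
     fc_augment F ` direct_power (poly_ring n) (fc_rank F 0) = UNIV \<and>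
     {v \<in> direct_power (poly_ring n) (fc_rank F 0). fc_augment F v = 0} =
       fc_diff F 1 ` direct_power (poly_ring n) (fc_rank F 1) \<and>
     (\<forall>i\<ge>1. {v \<in> direct_power (poly_ring n) (fc_rank F i). fc_diff F i v = 0} =
       fc_diff F (i + 1) ` direct_power (poly_ring n) (fc_rank F (i + 1)))"

text \<open>The degree \<open>j\<close> component of \<open>F\<^sub>i \<otimes> M\<close>.\<close>

definition tensor_comp ::
    "'k::field free_complex \<Rightarrow> 'k mpoly set \<Rightarrow> nat \<Rightarrow> int \<Rightarrow> (nat \<Rightarrow> 'k mpoly) set" where
  "tensor_comp F M i j =
     {v \<in> direct_power M (fc_rank F i). \<forall>k<fc_rank F i. homogeneous (j - fc_shift F i k) (v k)}"

definition tensor_cycles ::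
    "'k::field free_complex \<Rightarrow> 'k mpoly set \<Rightarrow> nat \<Rightarrow> int \<Rightarrow> (nat \<Rightarrow> 'k mpoly) set" where
  "tensor_cycles F M i j = {v \<in> tensor_comp F M i j. fc_diff F i v = 0}"

definition tensor_boundaries ::
    "'k::field free_complex \<Rightarrow> 'k mpoly set \<Rightarrow> nat \<Rightarrow> int \<Rightarrow> (nat \<Rightarrow> 'k mpoly) set" where
  "tensor_boundaries F M i j = fc_diff F (i + 1) ` tensor_comp F M (i + 1) j"

definition vec_scale :: "'k::field \<Rightarrow> (nat \<Rightarrow> 'k mpoly) \<Rightarrow> (nat \<Rightarrow> 'k mpoly)" where
  "vec_scale c v = (\<lambda>k. const c * v k)"

lemma vector_space_vec_scale:
  "vector_space (vec_scale :: 'k::field \<Rightarrow> (nat \<Rightarrow> 'k mpoly) \<Rightarrow> (nat \<Rightarrow> 'k mpoly))"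
proof
  fix a b :: 'k and x y :: "nat \<Rightarrow> 'k mpoly"
  show "vec_scale a (x + y) = vec_scale a x + vec_scale a y"
    by (simp add: vec_scale_def fun_eq_iff distrib_left)
  show "vec_scale (a + b) x = vec_scale a x + vec_scale b x"
    by (simp add: vec_scale_def fun_eq_iff const_def single_add distrib_right)
  show "vec_scale a (vec_scale b x) = vec_scale (a * b) x"
    by (simp add: vec_scale_def fun_eq_iff const_def mult_single mult.assoc[symmetric])
  show "vec_scale 1 x = x"
    by (simp add: vec_scale_def fun_eq_iff const_def flip: single_one)
qed

text \<open>
  \<open>\<beta>\<^bsub>i,j\<^esub>(M) = dim\<^sub>K Tor\<^sub>i(K, M)\<^sub>j\<close>, where \<open>M\<close> is a homogeneous ideal of \<open>S\<close> and
  \<open>Tor\<^sub>i(K, M) = H\<^sub>i(F \<otimes> M)\<close> for any graded free resolution \<open>F\<close> of \<open>K\<close> over \<open>S\<close>.  The choice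
  of \<open>F\<close> does not affect the value.  The components involved are finite-dimensional, so the
  dimension of the quotient is the difference of the dimensions.
\<close>

definition betti :: "nat \<Rightarrow> 'k::field mpoly set \<Rightarrow> nat \<Rightarrow> int \<Rightarrow> nat" where
  "betti n M i j =
     (let F = (SOME F. graded_free_resolution n F) in
        vector_space.dim vec_scale (tensor_cycles F M i j) -
        vector_space.dim vec_scale (tensor_boundaries F M i j))"

definition reg :: "nat \<Rightarrow> 'k::field mpoly set \<Rightarrow> ereal" where
  "reg n M = Sup {ereal (real_of_int (j - int i)) | i j. betti n M i j \<noteq> 0}"

definition indeg :: "'k::field mpoly set \<Rightarrow> ereal" where
  "indeg M = Inf {ereal (real_of_int i) | i. \<exists>p\<in>M. p \<noteq> 0 \<and> homogeneous i p}"

definition has_linear_resolution :: "nat \<Rightarrow> nat \<Rightarrow> 'k::field mpoly set \<Rightarrow> bool" where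
  "has_linear_resolution n d M \<longleftrightarrow>
     M = {0} \<or> (reg n M = ereal (real d) \<and> indeg M = ereal (real d))"


section \<open>Minimality\<close>

definition minimal_to_linearity :: "'k::field itself \<Rightarrow> nat \<Rightarrow> nat \<Rightarrow> nat set set \<Rightarrow> bool" where
  "minimal_to_linearity K n d C \<longleftrightarrow>
     \<not> has_linear_resolution n d (circuit_ideal n (complement_clutter n d C) :: 'k mpoly set) \<and>
     (\<forall>C'. C' \<subset> C \<longrightarrow>
        has_linear_resolution n d (circuit_ideal n (complement_clutter n d C') :: 'k mpoly set)) \<and>
     complex_dim (clique_complex n d C) = int d - 1"

text \<open>
  All \<open>d\<close>-subsets of a \<open>(d + 1)\<close>-set, i.e. the boundary of a \<open>d\<close>-simplex, form an orientable
  pseudo-manifold.  It is never minimal to \<open>d\<close>-linearity: the \<open>(d + 1)\<close>-set is a clique.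
\<close>

definition simplex_boundary :: "nat \<Rightarrow> nat \<Rightarrow> nat set set \<Rightarrow> bool" where
  "simplex_boundary n d C \<longleftrightarrow> (\<exists>V \<in> nsets {1..n} (d + 1). C = nsets V d)"

lemma simplex_boundary_not_minimal:
  assumes "simplex_boundary n d C"
  shows "\<not> minimal_to_linearity TYPE('k::field) n d C"
proof -
  from assms obtain V where V: "V \<subseteq> {1..n}" "card V = d + 1" "C = nsets V d"
    by (auto simp: simplex_boundary_def nsets_def)
  have "finite (clique_complex n d C)"
    by (rule finite_subset[of _ "Pow {1..n}"]) (auto simp: clique_complex_def)
  moreover have "V \<in> clique_complex n d C"
    using V by (simp add: clique_complex_def)
  ultimately have "card V \<le> Max (card ` clique_complex n d C)"
    by simp
  then show ?thesis
    using V by (simp add: minimal_to_linearity_def complex_dim_def)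
qed

end

theory Submission
  imports Defs
begin

text \<open>
  Write \<open>I\<close> for the circuit ideal of the complement of \<open>C\<close>.  It is the Stanley--Reisner ideal of
  the clique complex, and by Hochster's formula its Betti numbers are the dimensions of reduced
  homology groups of induced subcomplexes.  The clique complex contains all sets of fewer than
  \<open>d\<close> vertices.  If it contains no set of more than \<open>d\<close> vertices, then the only homology that can
  obstruct a \<open>d\<close>-linear resolution is the top one, which consists of the simplicial cycles
  supported on circuits.  Hence \<open>I\<close> has a \<open>d\<close>-linear resolution over \<open>K\<close> if and only if zero is the
  only such cycle with coefficients in \<open>K\<close> (\<open>linear_resolution_iff_acyclic\<close>).

  For a pseudo-manifold the clique condition fails only if \<open>C\<close> is the boundary of a simplex
  (\<open>pseudo_manifold_no_large_clique\<close>), and it passes to subclutters.  At a ridge the cycle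
  condition relates just two circuits and makes the two coefficients equal up to sign, so by
  strong connectedness a cycle is constant up to sign (\<open>clutter_cycle_constant_up_to_sign\<close>).  A
  cycle on a proper subclutter vanishes on some circuit of \<open>C\<close>, hence everywhere.  So \<open>C\<close> is
  minimal if and only if it carries a nonzero cycle.  An orientation is such a cycle; conversely,
  a nonzero cycle divided by one of its values is an orientation if \<open>1 \<noteq> -1\<close> in \<open>K\<close>; and in
  characteristic 2 the constant 1 is a cycle on every pseudo-manifold.

  The part of Hochster's formula used here is proved from scratch.  Comparison of resolutions
  allows \<open>Tor\<close> to be computed with the Koszul complex (\<open>acyclicity_independent\<close>), which splits over
  the fine degrees, i.e. the exponent vectors (\<open>koszul_exact_finely_graded\<close>).  A fine degree with
  an exponent at least 2 is contracted by a cone over that variable.  In the fine degree of a set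
  \<open>W\<close>, complementation in \<open>W\<close> turns Koszul chains with coefficients in \<open>I\<close> into simplicial cochains
  of the full simplex on \<open>W\<close> that vanish on the clique complex.  A cone contracts these as well,
  as long as it does not produce coefficients supported on circuits.  This happens only in the
  strand \<open>j - i = d + 1\<close>, where the remaining obstruction is the cokernel of the coboundary map into the
  functions on circuits.  Its dual is the space of cycles (\<open>koszul_pairing\<close>, \<open>bd_onto_clutter\<close>).
\<close>

abbreviation (input) "lookup \<equiv> Poly_Mapping.lookup"
abbreviation (input) "keys \<equiv> Poly_Mapping.keys"
abbreviation (input) "single \<equiv> Poly_Mapping.single"

section \<open>Monomials, homogeneous polynomials and homogeneous parts\<close>

lemma mon_deg_superset:
  assumes "finite A" "keys t \<subseteq> A"
  shows "mon_deg t = (\<Sum>k\<in>A. lookup t k)"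
  unfolding mon_deg_def
  by (rule sum.mono_neutral_left) (use assms in \<open>auto simp: in_keys_iff\<close>)

lemma mon_deg_add: "mon_deg (s + t) = mon_deg s + mon_deg t"
proof -
  let ?A = "keys s \<union> keys t"
  have "mon_deg (s + t) = (\<Sum>k\<in>?A. lookup (s + t) k)"
    by (rule mon_deg_superset) (use keys_add[of s t] in auto)
  moreover have "mon_deg s = (\<Sum>k\<in>?A. lookup s k)" "mon_deg t = (\<Sum>k\<in>?A. lookup t k)"
    by (rule mon_deg_superset; simp)+
  ultimately show ?thesis by (simp add: lookup_add sum.distrib)
qed

lemma homogeneous_0 [simp]: "homogeneous m 0"
  by (simp add: homogeneous_def)

lemma homogeneous_add: "homogeneous m p \<Longrightarrow> homogeneous m q \<Longrightarrow> homogeneous m (p + q)"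
  using keys_add[of p q] by (auto simp: homogeneous_def)

lemma homogeneous_uminus: "homogeneous m p \<Longrightarrow> homogeneous m (- p)"
  by (auto simp: homogeneous_def in_keys_iff)

lemma homogeneous_diff:
  "homogeneous m p \<Longrightarrow> homogeneous m q \<Longrightarrow> homogeneous m (p - q)"
  using homogeneous_add[of m p "- q"] homogeneous_uminus[of m q] by simp

lemma homogeneous_sum: "(\<And>x. x \<in> A \<Longrightarrow> homogeneous m (f x)) \<Longrightarrow> homogeneous m (sum f A)"
  by (induction A rule: infinite_finite_induct) (auto intro: homogeneous_add)

lemma homogeneous_mult:
  assumes "homogeneous a p" "homogeneous b q"
  shows "homogeneous (a + b) (p * q)"
  unfolding homogeneous_def
proof
  fix t assume "t \<in> keys (p * q)"
  then obtain s u where "t = s + u" "s \<in> keys p" "u \<in> keys q"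
    using keys_mult[of p q] by blast
  then show "int (mon_deg t) = a + b"
    using assms by (simp add: homogeneous_def mon_deg_add)
qed

lemma poly_ring_0 [simp]: "0 \<in> poly_ring n"
  by (simp add: poly_ring_def)

lemma poly_ring_1 [simp]: "1 \<in> poly_ring n"
  by (simp add: poly_ring_def)

lemma poly_ring_add: "p \<in> poly_ring n \<Longrightarrow> q \<in> poly_ring n \<Longrightarrow> p + q \<in> poly_ring n"
  using keys_add[of p q] by (auto simp: poly_ring_def)

lemma poly_ring_uminus: "p \<in> poly_ring n \<Longrightarrow> - p \<in> poly_ring n"
  by (auto simp: poly_ring_def in_keys_iff)

lemma poly_ring_diff: "p \<in> poly_ring n \<Longrightarrow> q \<in> poly_ring n \<Longrightarrow> p - q \<in> poly_ring n"
  using poly_ring_add[of p n "- q"] poly_ring_uminus[of q n] by simp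

lemma poly_ring_sum: "(\<And>x. x \<in> A \<Longrightarrow> f x \<in> poly_ring n) \<Longrightarrow> sum f A \<in> poly_ring n"
  by (induction A rule: infinite_finite_induct) (auto intro: poly_ring_add)

lemma poly_ring_mult:
  assumes "p \<in> poly_ring n" "q \<in> poly_ring n"
  shows "p * q \<in> poly_ring n"
  unfolding poly_ring_def
proof (intro CollectI ballI)
  fix t assume "t \<in> keys (p * q)"
  then obtain s u where "t = s + u" "s \<in> keys p" "u \<in> keys q"
    using keys_mult[of p q] by blast
  moreover have "keys s \<subseteq> {1..n}" "keys u \<subseteq> {1..n}" if "s \<in> keys p" "u \<in> keys q"
    using assms that unfolding poly_ring_def by blast+
  ultimately show "keys t \<subseteq> {1..n}"
    using keys_add[of s u] by blast
qed

lemma lookup_const_mult: "lookup (const c * p) t = c * lookup p t"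
  by (simp add: const_def mult_map_scale_conv_mult[symmetric] Poly_Mapping.map.rep_eq when_def)

definition hom_part :: "int \<Rightarrow> 'k::field mpoly \<Rightarrow> 'k mpoly" where
  "hom_part m p = Poly_Mapping.mapp (\<lambda>t c. if int (mon_deg t) = m then c else 0) p"

lemma lookup_hom_part: "lookup (hom_part m p) t = (if int (mon_deg t) = m then lookup p t else 0)"
  by (auto simp: hom_part_def lookup_mapp when_def in_keys_iff)

lemma hom_part_0 [simp]: "hom_part m 0 = 0"
  by (rule poly_mapping_eqI) (simp add: lookup_hom_part)

lemma hom_part_add: "hom_part m (p + q) = hom_part m p + hom_part m q"
  by (rule poly_mapping_eqI) (simp add: lookup_hom_part lookup_add)

lemma hom_part_sum: "hom_part m (sum f A) = (\<Sum>x\<in>A. hom_part m (f x))"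
  by (induction A rule: infinite_finite_induct) (auto simp: hom_part_add)

lemma homogeneous_hom_part: "homogeneous m (hom_part m p)"
  by (auto simp: homogeneous_def in_keys_iff lookup_hom_part split: if_splits)

lemma hom_part_homogeneous: "homogeneous m p \<Longrightarrow> hom_part m p = p"
  by (rule poly_mapping_eqI) (auto simp: lookup_hom_part homogeneous_def in_keys_iff)

lemma keys_hom_part: "keys (hom_part m p) \<subseteq> keys p"
  by (simp add: hom_part_def keys_mapp_subset)

lemma hom_part_poly_ring: "p \<in> poly_ring n \<Longrightarrow> hom_part m p \<in> poly_ring n"
  using keys_hom_part[of m p] unfolding poly_ring_def by blast

text \<open>
  The terms of \<open>p\<close> outside degree \<open>m\<close> stay outside degree \<open>m + b\<close> after multiplication by \<open>q\<close>.
\<close>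

lemma hom_part_mult:
  assumes "homogeneous b q"
  shows "hom_part (m + b) (p * q) = hom_part m p * q"
proof -
  define r where "r = p - hom_part m p"
  have "hom_part (m + b) (r * q) = 0"
  proof (rule poly_mapping_eqI)
    fix t
    show "lookup (hom_part (m + b) (r * q)) t = lookup 0 t"
    proof (rule ccontr)
      assume "\<not> ?thesis"
      then have t: "int (mon_deg t) = m + b" "t \<in> keys (r * q)"
        by (auto simp: lookup_hom_part in_keys_iff split: if_splits)
      then obtain s u where "t = s + u" "s \<in> keys r" "u \<in> keys q"
        using keys_mult[of r q] by blast
      with t(1) assms show False
        by (auto simp: homogeneous_def mon_deg_add r_def in_keys_iff lookup_minus lookup_hom_part
            split: if_splits)
    qed
  qed
  moreover have "hom_part (m + b) (hom_part m p * q) = hom_part m p * q"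
    by (intro hom_part_homogeneous homogeneous_mult homogeneous_hom_part assms)
  moreover have "p * q = hom_part m p * q + r * q"
    by (simp add: r_def algebra_simps)
  ultimately show ?thesis by (simp add: hom_part_add)
qed


section \<open>Independence of Tor of the resolution\<close>

text \<open>
  A map out of a free module of rank \<open>r\<close> is recorded by the images \<open>a k\<close> of the basis elements.  The
  same rows define the induced map on the direct powers of every ideal, so that an identity between
  rows survives tensoring.
\<close>

definition lin_app ::
    "nat \<Rightarrow> (nat \<Rightarrow> nat \<Rightarrow> 'k::field mpoly) \<Rightarrow> (nat \<Rightarrow> 'k mpoly) \<Rightarrow> nat \<Rightarrow> 'k mpoly" where
  "lin_app r a v = (\<lambda>l. \<Sum>k<r. v k * a k l)"

lemma lin_app_lin_app: "lin_app s b (lin_app r a v) = lin_app r (\<lambda>k. lin_app s b (a k)) v"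
proof
  fix l
  have "lin_app s b (lin_app r a v) l = (\<Sum>j<s. \<Sum>k<r. v k * a k j * b j l)"
    by (simp add: lin_app_def sum_distrib_right)
  also have "\<dots> = (\<Sum>k<r. \<Sum>j<s. v k * a k j * b j l)"
    by (rule sum.swap)
  finally show "lin_app s b (lin_app r a v) l = lin_app r (\<lambda>k. lin_app s b (a k)) v l"
    by (simp add: lin_app_def sum_distrib_left mult.assoc)
qed

lemma lin_app_cong: "(\<And>k. k < r \<Longrightarrow> a k = b k) \<Longrightarrow> lin_app r a v = lin_app r b v"
  by (simp add: lin_app_def fun_eq_iff)

lemma lin_app_diff_rows: "lin_app r (\<lambda>k. a k - b k) v = lin_app r a v - lin_app r b v"
  by (simp add: lin_app_def fun_eq_iff right_diff_distrib sum_subtractf)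

lemma lin_app_diff: "lin_app r a (v - w) = lin_app r a v - lin_app r a w"
  by (simp add: lin_app_def fun_eq_iff left_diff_distrib sum_subtractf)

lemma lin_app_add: "lin_app r a (v + w) = lin_app r a v + lin_app r a w"
  by (simp add: lin_app_def fun_eq_iff distrib_right sum.distrib)

lemma lin_app_0 [simp]: "lin_app r a 0 = 0"
  by (simp add: lin_app_def fun_eq_iff)

definition unit_vec :: "nat \<Rightarrow> nat \<Rightarrow> 'k::field mpoly" where
  "unit_vec k = (\<lambda>l. if l = k then 1 else 0)"

lemma lin_app_unit_vec:
  assumes "v \<in> direct_power M r"
  shows "lin_app r unit_vec v = v"
proof
  fix l
  have "lin_app r unit_vec v l = (\<Sum>k<r. if k = l then v k else 0)"
    unfolding lin_app_def unit_vec_def by (intro sum.cong) auto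
  then show "lin_app r unit_vec v l = v l"
    using assms by (simp add: sum.delta direct_power_def)
qed

definition diff_row :: "'k::field free_complex \<Rightarrow> nat \<Rightarrow> nat \<Rightarrow> nat \<Rightarrow> 'k mpoly" where
  "diff_row F i k = (\<lambda>l. if i \<ge> 1 \<and> l < fc_rank F (i - 1) then fc_mat F i k l else 0)"

lemma fc_diff_lin_app: "fc_diff F i = lin_app (fc_rank F i) (diff_row F i)"
  by (auto simp: fc_diff_def lin_app_def diff_row_def fun_eq_iff)

lemma fc_diff_0 [simp]: "fc_diff F 0 v = 0"
  by (simp add: fc_diff_def fun_eq_iff)

text \<open>
  The cycles of the complex augmented to \<open>K\<close>; exactness at \<open>F\<^sub>0\<close> and at the later \<open>F\<^sub>i\<close> then takes
  one form.
\<close>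

definition aug_cycle :: "'k::field free_complex \<Rightarrow> nat \<Rightarrow> (nat \<Rightarrow> 'k mpoly) \<Rightarrow> bool" where
  "aug_cycle F i v \<longleftrightarrow> (if i = 0 then fc_augment F v = 0 else fc_diff F i v = 0)"

lemma lookup_mult_0: "lookup (p * q) 0 = lookup p 0 * lookup (q :: 'k::field mpoly) 0"
proof -
  define r where "r = q - single 0 (lookup q 0)"
  have "lookup (p * r) 0 = 0"
  proof (rule ccontr)
    assume "lookup (p * r) 0 \<noteq> 0"
    then have "0 \<in> keys (p * r)" by (simp add: in_keys_iff)
    then obtain s u where su: "0 = s + u" "u \<in> keys r"
      using keys_mult[of p r] by blast
    then have "u = 0"
      by (metis add_is_0 lookup_add lookup_zero poly_mapping_eqI)
    with su(2) show False by (simp add: r_def in_keys_iff lookup_minus)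
  qed
  moreover have "lookup (p * single 0 c) 0 = lookup p 0 * c" for c
    using lookup_const_mult[of c p 0] by (simp add: const_def mult.commute)
  moreover have "q = r + single 0 (lookup q 0)" by (simp add: r_def)
  ultimately show ?thesis by (metis add_0 distrib_left lookup_add)
qed

lemma fc_augment_lin_app:
  "fc_augment F (lin_app r a v) = (\<Sum>k<r. lookup (v k) 0 * fc_augment F (a k))"
proof -
  have "fc_augment F (lin_app r a v)
      = (\<Sum>l<fc_rank F 0. \<Sum>k<r. lookup (v k) 0 * lookup (a k l) 0 * fc_aug F l)"
    by (simp add: fc_augment_def lin_app_def lookup_sum lookup_mult_0 sum_distrib_right)
  also have "\<dots> = (\<Sum>k<r. \<Sum>l<fc_rank F 0. lookup (v k) 0 * lookup (a k l) 0 * fc_aug F l)"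
    by (rule sum.swap)
  finally show ?thesis by (simp add: fc_augment_def sum_distrib_left mult.assoc)
qed

lemma fc_augment_diff: "fc_augment F (v - w) = fc_augment F v - fc_augment F w"
  by (simp add: fc_augment_def lookup_minus left_diff_distrib sum_subtractf)

lemma fc_augment_unit_vec: "k < fc_rank F 0 \<Longrightarrow> fc_augment F (unit_vec k) = fc_aug F k"
proof -
  assume k: "k < fc_rank F 0"
  have "fc_augment F (unit_vec k) = (\<Sum>l<fc_rank F 0. if l = k then fc_aug F l else 0)"
    unfolding fc_augment_def unit_vec_def by (intro sum.cong) auto
  then show ?thesis using k by (simp add: sum.delta)
qed

lemma resolution_exact:
  assumes "graded_free_resolution n F" "v \<in> direct_power (poly_ring n) (fc_rank F i)"
  shows "aug_cycle F i v \<longleftrightarrow>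
    v \<in> fc_diff F (i + 1) ` direct_power (poly_ring n) (fc_rank F (i + 1))"
proof -
  have "{v \<in> direct_power (poly_ring n) (fc_rank F i). aug_cycle F i v} =
      fc_diff F (i + 1) ` direct_power (poly_ring n) (fc_rank F (i + 1))"
    using assms(1) unfolding graded_free_resolution_def aug_cycle_def
    by (cases "i = 0") simp_all
  then show ?thesis using assms(2) by blast
qed

definition is_ideal :: "nat \<Rightarrow> 'k::field mpoly set \<Rightarrow> bool" where
  "is_ideal n M \<longleftrightarrow> M \<subseteq> poly_ring n \<and> 0 \<in> M \<and> (\<forall>p\<in>M. \<forall>q\<in>M. p + q \<in> M) \<and>
     (\<forall>p\<in>M. \<forall>q\<in>poly_ring n. p * q \<in> M)"

lemma is_ideal_poly_ring: "is_ideal n (poly_ring n)"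
  by (auto simp: is_ideal_def intro: poly_ring_add poly_ring_mult)

lemma is_ideal_sum: "is_ideal n M \<Longrightarrow> (\<And>x. x \<in> A \<Longrightarrow> f x \<in> M) \<Longrightarrow> sum f A \<in> M"
  by (induction A rule: infinite_finite_induct) (auto simp: is_ideal_def)

lemma tensor_comp_lin_app:
  assumes "is_ideal n M" "v \<in> tensor_comp F M i j"
    and "\<And>k. k < fc_rank F i \<Longrightarrow> a k \<in> tensor_comp G (poly_ring n) i' (fc_shift F i k)"
  shows "lin_app (fc_rank F i) a v \<in> tensor_comp G M i' j"
proof -
  have "lin_app (fc_rank F i) a v l \<in> M" if "l < fc_rank G i'" for l
    unfolding lin_app_def
  proof (rule is_ideal_sum[OF assms(1)])
    fix k assume "k \<in> {..<fc_rank F i}"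
    then show "v k * a k l \<in> M"
      using assms that by (auto simp: is_ideal_def tensor_comp_def direct_power_def)
  qed
  moreover have "homogeneous (j - fc_shift G i' l) (lin_app (fc_rank F i) a v l)"
    if "l < fc_rank G i'" for l
    unfolding lin_app_def
  proof (rule homogeneous_sum)
    fix k assume k: "k \<in> {..<fc_rank F i}"
    have "homogeneous ((j - fc_shift F i k) + (fc_shift F i k - fc_shift G i' l)) (v k * a k l)"
      by (rule homogeneous_mult) (use k assms(2,3) that in \<open>auto simp: tensor_comp_def\<close>)
    then show "homogeneous (j - fc_shift G i' l) (v k * a k l)" by simp
  qed
  moreover have "lin_app (fc_rank F i) a v l = 0" if "l \<ge> fc_rank G i'" for l
    unfolding lin_app_def
    by (rule sum.neutral) (use that assms(3) in \<open>auto simp: tensor_comp_def direct_power_def\<close>)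
  ultimately show ?thesis by (auto simp: tensor_comp_def direct_power_def)
qed

lemma diff_row_tensor_comp:
  assumes "graded_free_resolution n F" "k < fc_rank F (Suc i)"
  shows "diff_row F (Suc i) k \<in> tensor_comp F (poly_ring n) i (fc_shift F (Suc i) k)"
proof -
  have "fc_mat F (Suc i) k l \<in> poly_ring n \<and>
      homogeneous (fc_shift F (Suc i) k - fc_shift F i l) (fc_mat F (Suc i) k l)"
    if "l < fc_rank F i" for l
    using assms that unfolding graded_free_resolution_def
    by (metis One_nat_def diff_Suc_1 le_add1 plus_1_eq_Suc)
  then show ?thesis by (auto simp: tensor_comp_def direct_power_def diff_row_def)
qed

lemma unit_vec_tensor_comp:
  "k < fc_rank F i \<Longrightarrow> unit_vec k \<in> tensor_comp F (poly_ring n) i (fc_shift F i k)"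
  by (auto simp: unit_vec_def tensor_comp_def direct_power_def homogeneous_def mon_deg_def)

lemma fc_diff_unit_vec: "k < fc_rank F i \<Longrightarrow> fc_diff F i (unit_vec k) = diff_row F i k"
proof
  fix l assume k: "k < fc_rank F i"
  have "fc_diff F i (unit_vec k) l = (\<Sum>k'<fc_rank F i. if k' = k then diff_row F i k' l else 0)"
    unfolding fc_diff_lin_app lin_app_def unit_vec_def by (intro sum.cong) auto
  then show "fc_diff F i (unit_vec k) l = diff_row F i k l" using k by (simp add: sum.delta)
qed

lemma aug_cycle_diff_row:
  assumes "graded_free_resolution n F" "k < fc_rank F (Suc i)"
  shows "aug_cycle F i (diff_row F (Suc i) k)"
proof -
  have "diff_row F (Suc i) k \<in> direct_power (poly_ring n) (fc_rank F i)"
    using diff_row_tensor_comp[OF assms] by (simp add: tensor_comp_def)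
  moreover have "unit_vec k \<in> direct_power (poly_ring n) (fc_rank F (Suc i))"
    by (use assms(2) in \<open>auto simp: direct_power_def unit_vec_def\<close>)
  ultimately show ?thesis
    using resolution_exact[OF assms(1)] fc_diff_unit_vec[OF assms(2)]
    by (metis Suc_eq_plus1 image_eqI)
qed

lemma fc_diff_fc_diff:
  assumes "graded_free_resolution n F"
  shows "fc_diff F i (fc_diff F (Suc i) v) = 0"
proof (cases "i = 0")
  case False
  have "lin_app (fc_rank F i) (diff_row F i) (diff_row F (Suc i) k) = 0"
    if "k < fc_rank F (Suc i)" for k
    using aug_cycle_diff_row[OF assms that] False by (simp add: aug_cycle_def fc_diff_lin_app)
  then show ?thesis
    by (simp add: fc_diff_lin_app lin_app_lin_app fun_eq_iff) (simp add: lin_app_def)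
qed simp

text \<open>
  A preimage of a homogeneous cycle can be replaced by its homogeneous part of the same degree,
  since the matrix entries are homogeneous.
\<close>

lemma graded_exact:
  assumes F: "graded_free_resolution n F"
    and v: "v \<in> tensor_comp F (poly_ring n) i j" "aug_cycle F i v"
  shows "\<exists>w\<in>tensor_comp F (poly_ring n) (Suc i) j. fc_diff F (Suc i) w = v"
proof -
  have "v \<in> direct_power (poly_ring n) (fc_rank F i)"
    using v by (simp add: tensor_comp_def)
  then obtain w where w: "w \<in> direct_power (poly_ring n) (fc_rank F (Suc i))"
    "fc_diff F (Suc i) w = v"
    using resolution_exact[OF F] v(2) by auto
  define w' where "w' = (\<lambda>k. hom_part (j - fc_shift F (Suc i) k) (w k))"
  have "w' \<in> tensor_comp F (poly_ring n) (Suc i) j"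
    using w(1)
    by (auto simp: w'_def tensor_comp_def direct_power_def homogeneous_hom_part hom_part_poly_ring)
  moreover have "fc_diff F (Suc i) w' l = v l" for l
  proof (cases "l < fc_rank F i")
    case True
    have "w' k * diff_row F (Suc i) k l = hom_part (j - fc_shift F i l) (w k * diff_row F (Suc i) k l)"
      if "k < fc_rank F (Suc i)" for k
    proof -
      have "homogeneous (fc_shift F (Suc i) k - fc_shift F i l) (diff_row F (Suc i) k l)"
        using diff_row_tensor_comp[OF F that] True by (simp add: tensor_comp_def)
      from hom_part_mult[OF this, of "j - fc_shift F (Suc i) k" "w k"] show ?thesis
        by (simp add: w'_def)
    qed
    then have "fc_diff F (Suc i) w' l = hom_part (j - fc_shift F i l) (fc_diff F (Suc i) w l)"
      by (simp add: fc_diff_lin_app lin_app_def hom_part_sum)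
    also have "\<dots> = v l"
      unfolding w(2) using v(1) True by (intro hom_part_homogeneous) (simp add: tensor_comp_def)
    finally show ?thesis .
  next
    case False
    then show ?thesis using v(1) by (simp add: fc_diff_def tensor_comp_def direct_power_def)
  qed
  ultimately show ?thesis by blast
qed

text \<open>A graded chain map over the identity of \<open>K\<close>, in the row format of \<open>lin_app\<close>.\<close>

definition chain_map :: "nat \<Rightarrow> 'k::field free_complex \<Rightarrow> 'k free_complex \<Rightarrow>
    (nat \<Rightarrow> nat \<Rightarrow> nat \<Rightarrow> 'k mpoly) \<Rightarrow> bool" where
  "chain_map n F G a \<longleftrightarrow>
     (\<forall>i. \<forall>k<fc_rank F i. a i k \<in> tensor_comp G (poly_ring n) i (fc_shift F i k)) \<and>
     (\<forall>k<fc_rank F 0. fc_augment G (a 0 k) = fc_aug F k) \<and>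
     (\<forall>i. \<forall>k<fc_rank F (Suc i).
        fc_diff G (Suc i) (a (Suc i) k) = lin_app (fc_rank F i) (a i) (diff_row F (Suc i) k))"

text \<open>
  The augmentation sees only constant coefficients at basis elements of degree 0, and these are
  kept by the passage to homogeneous parts of degree 0.
\<close>

lemma homogeneous_augment_preimage:
  assumes G: "graded_free_resolution n G"
  shows "\<exists>v\<in>tensor_comp G (poly_ring n) 0 0. fc_augment G v = c"
proof -
  obtain u where u: "u \<in> direct_power (poly_ring n) (fc_rank G 0)" "fc_augment G u = c"
  proof -
    have "c \<in> fc_augment G ` direct_power (poly_ring n) (fc_rank G 0)"
      using G by (simp add: graded_free_resolution_def)
    then show ?thesis using that by blast
  qed
  define v where "v = (\<lambda>k. hom_part (0 - fc_shift G 0 k) (u k))"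
  have "v \<in> tensor_comp G (poly_ring n) 0 0"
    using u(1) homogeneous_hom_part[of "0 - fc_shift G 0 k" "u k" for k]
    unfolding v_def tensor_comp_def direct_power_def by (simp add: hom_part_poly_ring)
  moreover have "lookup (v k) 0 * fc_aug G k = lookup (u k) 0 * fc_aug G k"
    if "k < fc_rank G 0" for k
  proof (cases "fc_aug G k = 0")
    case False
    then have "fc_shift G 0 k = 0"
      using G that by (simp add: graded_free_resolution_def)
    then show ?thesis by (simp add: v_def lookup_hom_part mon_deg_def)
  qed simp
  then have "fc_augment G v = fc_augment G u"
    unfolding fc_augment_def by (intro sum.cong) auto
  ultimately show ?thesis using u(2) by auto
qed

text \<open>
  The images of the basis elements are chosen one homological degree after the other, as
  preimages under the differential of \<open>G\<close>.  The invariant that the map sends augmented cycles to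
  augmented cycles is what makes the next preimages exist.
\<close>

lemma chain_map_exists:
  assumes F: "graded_free_resolution n F" and G: "graded_free_resolution n G"
  shows "\<exists>a. chain_map n F G a"
proof -
  define P where "P i x \<longleftrightarrow>
      (\<forall>k<fc_rank F i. x k \<in> tensor_comp G (poly_ring n) i (fc_shift F i k)) \<and>
      (i = 0 \<longrightarrow> (\<forall>k<fc_rank F 0. fc_augment G (x k) = fc_aug F k)) \<and>
      (\<forall>v. aug_cycle F i v \<longrightarrow> aug_cycle G i (lin_app (fc_rank F i) x v))"
    for i and x :: "nat \<Rightarrow> nat \<Rightarrow> 'a mpoly"
  define Q where "Q i x y \<longleftrightarrow> (\<forall>k<fc_rank F (Suc i).
      fc_diff G (Suc i) (y k) = lin_app (fc_rank F i) x (diff_row F (Suc i) k))"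
    for i and x y :: "nat \<Rightarrow> nat \<Rightarrow> 'a mpoly"
  have "\<exists>f. \<forall>i. P i (f i) \<and> Q i (f i) (f (Suc i))"
  proof (rule dependent_nat_choice)
    have "\<exists>x. x \<in> tensor_comp G (poly_ring n) 0 (fc_shift F 0 k) \<and> fc_augment G x = fc_aug F k"
      if "k < fc_rank F 0" for k
    proof (cases "fc_aug F k = 0")
      case True
      then show ?thesis
        by (intro exI[of _ 0]) (auto simp: tensor_comp_def direct_power_def fc_augment_def)
    next
      case False
      then have "fc_shift F 0 k = 0" using F that by (simp add: graded_free_resolution_def)
      then show ?thesis using homogeneous_augment_preimage[OF G, of "fc_aug F k"] by auto
    qed
    then obtain x where x: "\<And>k. k < fc_rank F 0 \<Longrightarrow>
        x k \<in> tensor_comp G (poly_ring n) 0 (fc_shift F 0 k) \<and> fc_augment G (x k) = fc_aug F k"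
      by metis
    have "fc_augment G (lin_app (fc_rank F 0) x v) = fc_augment F v" for v
      by (simp add: fc_augment_lin_app x fc_augment_def[of F])
    with x have "P 0 x" by (simp add: P_def aug_cycle_def)
    then show "\<exists>x. P 0 x" by blast
  next
    fix x i assume P: "P i x"
    have "\<exists>y. y \<in> tensor_comp G (poly_ring n) (Suc i) (fc_shift F (Suc i) k) \<and>
        fc_diff G (Suc i) y = lin_app (fc_rank F i) x (diff_row F (Suc i) k)"
      if k: "k < fc_rank F (Suc i)" for k
    proof -
      have "lin_app (fc_rank F i) x (diff_row F (Suc i) k)
          \<in> tensor_comp G (poly_ring n) i (fc_shift F (Suc i) k)"
        by (rule tensor_comp_lin_app[OF is_ideal_poly_ring diff_row_tensor_comp[OF F k]])
          (use P in \<open>simp add: P_def\<close>)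
      moreover have "aug_cycle G i (lin_app (fc_rank F i) x (diff_row F (Suc i) k))"
        using P aug_cycle_diff_row[OF F k] by (simp add: P_def)
      ultimately show ?thesis using graded_exact[OF G] by blast
    qed
    then obtain y where y: "\<And>k. k < fc_rank F (Suc i) \<Longrightarrow>
        y k \<in> tensor_comp G (poly_ring n) (Suc i) (fc_shift F (Suc i) k) \<and>
        fc_diff G (Suc i) (y k) = lin_app (fc_rank F i) x (diff_row F (Suc i) k)"
      by metis
    have "fc_diff G (Suc i) (lin_app (fc_rank F (Suc i)) y v)
        = lin_app (fc_rank F i) x (fc_diff F (Suc i) v)" for v
      unfolding fc_diff_lin_app lin_app_lin_app
      by (rule lin_app_cong) (use y in \<open>simp add: fc_diff_lin_app\<close>)
    with y have "P (Suc i) y" by (simp add: P_def aug_cycle_def)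
    moreover have "Q i x y" using y by (simp add: Q_def)
    ultimately show "\<exists>y. P (Suc i) y \<and> Q i x y" by blast
  qed
  then obtain f where f: "\<And>i. P i (f i)" "\<And>i. Q i (f i) (f (Suc i))" by blast
  then have "chain_map n F G f" by (simp add: chain_map_def P_def Q_def)
  then show ?thesis by blast
qed

lemma chain_map_commutes:
  assumes "chain_map n F G a"
  shows "fc_diff G (Suc i) (lin_app (fc_rank F (Suc i)) (a (Suc i)) v)
    = lin_app (fc_rank F i) (a i) (fc_diff F (Suc i) v)"
  unfolding fc_diff_lin_app lin_app_lin_app
  by (rule lin_app_cong) (use assms in \<open>simp add: chain_map_def fc_diff_lin_app\<close>)

lemma chain_map_augment:
  assumes "chain_map n F G a"
  shows "fc_augment G (lin_app (fc_rank F 0) (a 0) v) = fc_augment F v"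
  using assms by (simp add: fc_augment_lin_app chain_map_def fc_augment_def[of F])

lemma chain_map_unit:
  assumes "graded_free_resolution n F"
  shows "chain_map n F F (\<lambda>i. unit_vec)"
proof -
  have "lin_app (fc_rank F i) unit_vec (diff_row F (Suc i) k) = diff_row F (Suc i) k"
    if "k < fc_rank F (Suc i)" for i k
    by (rule lin_app_unit_vec[of _ "poly_ring n"])
      (use diff_row_tensor_comp[OF assms that] in \<open>simp add: tensor_comp_def\<close>)
  then show ?thesis
    by (simp add: chain_map_def unit_vec_tensor_comp fc_augment_unit_vec fc_diff_unit_vec)
qed

lemma chain_map_comp:
  assumes "chain_map n F G a" "chain_map n G H b"
  shows "chain_map n F H (\<lambda>i k. lin_app (fc_rank G i) (b i) (a i k))"
  unfolding chain_map_def
proof (intro conjI allI impI)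
  fix i k assume "k < fc_rank F i"
  then show "lin_app (fc_rank G i) (b i) (a i k) \<in> tensor_comp H (poly_ring n) i (fc_shift F i k)"
    using assms by (intro tensor_comp_lin_app[OF is_ideal_poly_ring]) (auto simp: chain_map_def)
next
  fix k assume "k < fc_rank F 0"
  then show "fc_augment H (lin_app (fc_rank G 0) (b 0) (a 0 k)) = fc_aug F k"
    using assms chain_map_augment[OF assms(2)] by (simp add: chain_map_def)
next
  fix i k assume "k < fc_rank F (Suc i)"
  then show "fc_diff H (Suc i) (lin_app (fc_rank G (Suc i)) (b (Suc i)) (a (Suc i) k))
    = lin_app (fc_rank F i) (\<lambda>k. lin_app (fc_rank G i) (b i) (a i k)) (diff_row F (Suc i) k)"
    using assms(1)
    by (simp add: chain_map_commutes[OF assms(2)] chain_map_def flip: lin_app_lin_app)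
qed

text \<open>
  The homotopy formula is \<open>d h\<^sub>i = a\<^sub>i - b\<^sub>i - h\<^bsub>i-1\<^esub> d\<close>.  It is recorded only for cycles of \<open>F\<close>, where
  the last term vanishes: this suffices on homology, and it is also the invariant needed to
  construct \<open>h\<close> degree by degree.  The vector \<open>v\<close> may have entries in any ideal.
\<close>

lemma homotopy_exists:
  assumes F: "graded_free_resolution n F" and G: "graded_free_resolution n G"
    and a: "chain_map n F G a" and b: "chain_map n F G b"
  shows "\<exists>h. (\<forall>i. \<forall>k<fc_rank F i. h i k \<in> tensor_comp G (poly_ring n) (Suc i) (fc_shift F i k)) \<and>
    (\<forall>i v. fc_diff F i v = 0 \<longrightarrow> fc_diff G (Suc i) (lin_app (fc_rank F i) (h i) v)
       = lin_app (fc_rank F i) (a i) v - lin_app (fc_rank F i) (b i) v)"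
proof -
  define c where "c i k = a i k - b i k" for i k
  have c: "lin_app r (c i) v = lin_app r (a i) v - lin_app r (b i) v" for r i v
    by (simp add: lin_app_diff_rows c_def[abs_def])
  have c_comp: "c i k \<in> tensor_comp G (poly_ring n) i (fc_shift F i k)" if "k < fc_rank F i" for i k
    using a b that
    by (auto simp: c_def chain_map_def tensor_comp_def direct_power_def
        intro: poly_ring_diff homogeneous_diff)
  have c_Suc: "fc_diff G (Suc i) (c (Suc i) k) = lin_app (fc_rank F i) (c i) (diff_row F (Suc i) k)"
    if "k < fc_rank F (Suc i)" for i k
    unfolding c using a b that by (simp add: c_def fc_diff_lin_app lin_app_diff chain_map_def)
  define P where "P i x \<longleftrightarrow>
      (\<forall>k<fc_rank F i. x k \<in> tensor_comp G (poly_ring n) (Suc i) (fc_shift F i k)) \<and>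
      (\<forall>v. fc_diff F i v = 0 \<longrightarrow>
         fc_diff G (Suc i) (lin_app (fc_rank F i) x v) = lin_app (fc_rank F i) (c i) v)"
    for i and x :: "nat \<Rightarrow> nat \<Rightarrow> 'a mpoly"
  have "\<exists>f. \<forall>i. P i (f i) \<and> True"
  proof (rule dependent_nat_choice)
    have "\<exists>y\<in>tensor_comp G (poly_ring n) (Suc 0) (fc_shift F 0 k). fc_diff G (Suc 0) y = c 0 k"
      if "k < fc_rank F 0" for k
      by (rule graded_exact[OF G c_comp[OF that]])
        (use a b that in \<open>simp add: aug_cycle_def c_def fc_augment_diff chain_map_def\<close>)
    then obtain x where x: "\<And>k. k < fc_rank F 0 \<Longrightarrow>
        x k \<in> tensor_comp G (poly_ring n) (Suc 0) (fc_shift F 0 k) \<and> fc_diff G (Suc 0) (x k) = c 0 k"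
      by metis
    have "fc_diff G (Suc 0) (lin_app (fc_rank F 0) x v) = lin_app (fc_rank F 0) (c 0) v" for v
      unfolding fc_diff_lin_app lin_app_lin_app
      by (rule lin_app_cong) (use x in \<open>simp add: fc_diff_lin_app\<close>)
    with x have "P 0 x" by (simp add: P_def)
    then show "\<exists>x. P 0 x" by blast
  next
    fix x i assume P: "P i x"
    let ?e = "\<lambda>k. c (Suc i) k - lin_app (fc_rank F i) x (diff_row F (Suc i) k)"
    have "\<exists>y\<in>tensor_comp G (poly_ring n) (Suc (Suc i)) (fc_shift F (Suc i) k).
        fc_diff G (Suc (Suc i)) y = ?e k"
      if k: "k < fc_rank F (Suc i)" for k
    proof (rule graded_exact[OF G])
      have "lin_app (fc_rank F i) x (diff_row F (Suc i) k)
          \<in> tensor_comp G (poly_ring n) (Suc i) (fc_shift F (Suc i) k)"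
        by (rule tensor_comp_lin_app[OF is_ideal_poly_ring diff_row_tensor_comp[OF F k]])
          (use P in \<open>simp add: P_def\<close>)
      then show "?e k \<in> tensor_comp G (poly_ring n) (Suc i) (fc_shift F (Suc i) k)"
        using c_comp[OF k]
        by (auto simp: tensor_comp_def direct_power_def intro: poly_ring_diff homogeneous_diff)
      have "fc_diff F i (diff_row F (Suc i) k) = 0"
        using fc_diff_fc_diff[OF F, of i "unit_vec k"] fc_diff_unit_vec[OF k] by simp
      then have "fc_diff G (Suc i) (lin_app (fc_rank F i) x (diff_row F (Suc i) k))
          = fc_diff G (Suc i) (c (Suc i) k)"
        using P c_Suc[OF k] by (simp add: P_def)
      then show "aug_cycle G (Suc i) (?e k)"
        by (simp add: aug_cycle_def fc_diff_lin_app lin_app_diff)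
    qed
    then obtain y where y: "\<And>k. k < fc_rank F (Suc i) \<Longrightarrow>
        y k \<in> tensor_comp G (poly_ring n) (Suc (Suc i)) (fc_shift F (Suc i) k) \<and>
        fc_diff G (Suc (Suc i)) (y k) = ?e k"
      by metis
    have "fc_diff G (Suc (Suc i)) (lin_app (fc_rank F (Suc i)) y v)
        = lin_app (fc_rank F (Suc i)) (c (Suc i)) v
          - lin_app (fc_rank F i) x (fc_diff F (Suc i) v)" for v
    proof -
      have "fc_diff G (Suc (Suc i)) (lin_app (fc_rank F (Suc i)) y v)
          = lin_app (fc_rank F (Suc i)) ?e v"
        unfolding fc_diff_lin_app lin_app_lin_app
        by (rule lin_app_cong) (use y in \<open>simp add: fc_diff_lin_app\<close>)
      then show ?thesis by (simp add: lin_app_diff_rows fc_diff_lin_app lin_app_lin_app)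
    qed
    with y have "P (Suc i) y" by (simp add: P_def)
    then show "\<exists>y. P (Suc i) y \<and> True" by blast
  qed
  then show ?thesis unfolding P_def c by blast
qed

text \<open>
  Chain maps in both directions compose to a map homotopic to the identity, and all the maps
  involved are matrices, so the argument survives tensoring with \<open>M\<close>.
\<close>

lemma acyclicity_independent:
  assumes F: "graded_free_resolution n F" and G: "graded_free_resolution n G"
    and M: "is_ideal n M"
    and ac: "tensor_cycles G M i j \<subseteq> tensor_boundaries G M i j"
  shows "tensor_cycles F M i j \<subseteq> tensor_boundaries F M i j"
proof
  fix v assume "v \<in> tensor_cycles F M i j"
  then have v: "v \<in> tensor_comp F M i j" "fc_diff F i v = 0"
    by (auto simp: tensor_cycles_def)
  obtain a b where a: "chain_map n F G a" and b: "chain_map n G F b"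
    using chain_map_exists F G by meson
  obtain h where h: "\<And>i k. k < fc_rank F i \<Longrightarrow>
        h i k \<in> tensor_comp F (poly_ring n) (Suc i) (fc_shift F i k)"
    "\<And>i v. fc_diff F i v = 0 \<Longrightarrow> fc_diff F (Suc i) (lin_app (fc_rank F i) (h i) v)
       = lin_app (fc_rank F i) (\<lambda>k. lin_app (fc_rank G i) (b i) (a i k)) v
         - lin_app (fc_rank F i) unit_vec v"
    using homotopy_exists[OF F F chain_map_comp[OF a b] chain_map_unit[OF F]] by metis
  let ?av = "lin_app (fc_rank F i) (a i) v"
  have "?av \<in> tensor_comp G M i j"
    by (rule tensor_comp_lin_app[OF M v(1)]) (use a in \<open>simp add: chain_map_def\<close>)
  moreover have "fc_diff G i ?av = 0"
  proof (cases i)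
    case (Suc i')
    then show ?thesis using chain_map_commutes[OF a, of i' v] v(2) by simp
  qed simp
  ultimately have "?av \<in> tensor_cycles G M i j" by (simp add: tensor_cycles_def)
  with ac have "?av \<in> tensor_boundaries G M i j" by (rule subsetD)
  then obtain w where w: "w \<in> tensor_comp G M (Suc i) j" "?av = fc_diff G (Suc i) w"
    by (auto simp: tensor_boundaries_def)
  let ?bw = "lin_app (fc_rank G (Suc i)) (b (Suc i)) w"
  let ?hv = "lin_app (fc_rank F i) (h i) v"
  have bw: "?bw \<in> tensor_comp F M (Suc i) j"
    by (rule tensor_comp_lin_app[OF M w(1)]) (use b in \<open>simp add: chain_map_def\<close>)
  have hv: "?hv \<in> tensor_comp F M (Suc i) j"
    by (rule tensor_comp_lin_app[OF M v(1) h(1)])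
  have "lin_app (fc_rank F i) unit_vec v = v"
    using v(1) by (intro lin_app_unit_vec[of _ M]) (simp add: tensor_comp_def)
  then have "fc_diff F (Suc i) ?hv = lin_app (fc_rank G i) (b i) ?av - v"
    using h(2)[OF v(2)] by (simp add: lin_app_lin_app)
  also have "lin_app (fc_rank G i) (b i) ?av = fc_diff F (Suc i) ?bw"
    by (simp add: w(2) chain_map_commutes[OF b])
  finally have "v = fc_diff F (Suc i) (?bw - ?hv)"
    by (simp only: fc_diff_lin_app lin_app_diff diff_diff_eq2 add_diff_cancel_left' add_diff_cancel_left)
  moreover have "?bw - ?hv \<in> tensor_comp F M (Suc i) j"
  proof -
    have neg: "- p \<in> M" if "p \<in> M" for p
    proof -
      have "(- 1 :: 'a mpoly) \<in> poly_ring n" by (rule poly_ring_uminus[OF poly_ring_1])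
      then have "p * (- 1) \<in> M" using M that unfolding is_ideal_def by blast
      then show ?thesis by simp
    qed
    have "p - q \<in> M" if "p \<in> M" "q \<in> M" for p q
    proof -
      have "p + - q \<in> M" using M that(1) neg[OF that(2)] unfolding is_ideal_def by blast
      then show ?thesis by simp
    qed
    then show ?thesis
      using bw hv by (auto simp: tensor_comp_def direct_power_def intro: homogeneous_diff)
  qed
  ultimately show "v \<in> tensor_boundaries F M i j" by (auto simp: tensor_boundaries_def)
qed


section \<open>The combinatorial Koszul differential\<close>

text \<open>
  The sign with which \<open>k\<close> is moved to its place in the increasing enumeration of \<open>s\<close>.  It is the same
  for \<open>s\<close> with and without \<open>k\<close>, so it serves both for adjoining and for removing \<open>k\<close>.
\<close>

definition vertex_sign :: "nat \<Rightarrow> nat set \<Rightarrow> 'a::comm_ring_1" where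
  "vertex_sign k s = (-1) ^ card {u \<in> s. u < k}"

lemma vertex_sign_square [simp]: "vertex_sign k s * vertex_sign k s = 1"
  by (simp add: vertex_sign_def flip: power_add mult_2)

lemma vertex_sign_square_left [simp]: "vertex_sign k s * (vertex_sign k s * x) = x"
  by (simp flip: mult.assoc)

lemma vertex_sign_insert:
  assumes "finite s" "k \<notin> s"
  shows "vertex_sign l (insert k s) = (if k < l then - vertex_sign l s else vertex_sign l s)"
proof (cases "k < l")
  case True
  then have "{u \<in> insert k s. u < l} = insert k {u \<in> s. u < l}" by auto
  then show ?thesis using assms True by (simp add: vertex_sign_def)
next
  case False
  then have "{u \<in> insert k s. u < l} = {u \<in> s. u < l}" by auto
  then show ?thesis using False by (simp add: vertex_sign_def)
qed

lemma vertex_sign_self: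
  assumes "finite s" "k \<notin> s"
  shows "vertex_sign k (insert k s) = vertex_sign k s"
  using assms by (simp add: vertex_sign_insert)

lemma vertex_sign_swap:
  assumes "finite s" "k \<notin> s" "l \<notin> s" "k \<noteq> l"
  shows "vertex_sign k s * vertex_sign l (insert k s) =
    - (vertex_sign l s * vertex_sign k (insert l s))"
  using assms by (auto simp: vertex_sign_insert)

lemma vertex_sign_split:
  assumes "finite W" "s \<subseteq> W"
  shows "vertex_sign k W = vertex_sign k s * vertex_sign k (W - s)"
proof -
  have "{u \<in> W. u < k} = {u \<in> s. u < k} \<union> {u \<in> W - s. u < k}" using assms by auto
  moreover have "finite {u \<in> s. u < k}" "finite {u \<in> W - s. u < k}"
    by (rule finite_subset[of _ W]; use assms in auto)+
  moreover have "{u \<in> s. u < k} \<inter> {u \<in> W - s. u < k} = {}" by auto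
  ultimately have "card {u \<in> W. u < k} = card {u \<in> s. u < k} + card {u \<in> W - s. u < k}"
    by (simp add: card_Un_disjoint)
  then show ?thesis by (simp add: vertex_sign_def power_add)
qed

text \<open>
  The Koszul differential on the vertex set \<open>V\<close>; the chain \<open>f\<close> has coefficient \<open>f s\<close> at the exterior
  basis element of \<open>s\<close>.  The weights \<open>x\<close> are the variables in the Koszul complex itself, and 1 in
  each of its fine degrees, where only scalars are left.
\<close>

definition kos :: "(nat \<Rightarrow> 'a::comm_ring_1) \<Rightarrow> nat set \<Rightarrow> (nat set \<Rightarrow> 'a) \<Rightarrow> nat set \<Rightarrow> 'a" where
  "kos x V f r = (\<Sum>k\<in>V - r. vertex_sign k r * x k * f (insert k r))"

text \<open>
  The diagonal is left out because antisymmetry does not make it vanish in characteristic 2.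
\<close>

lemma antisymmetric_sum_eq_0:
  fixes g :: "'b \<Rightarrow> 'b \<Rightarrow> 'a::comm_ring_1"
  assumes "finite A" "\<And>k l. k \<in> A \<Longrightarrow> l \<in> A \<Longrightarrow> k \<noteq> l \<Longrightarrow> g k l = - g l k"
  shows "(\<Sum>k\<in>A. \<Sum>l\<in>A - {k}. g k l) = 0"
  using assms
proof (induction A rule: finite_induct)
  case (insert a A)
  have "(\<Sum>l\<in>insert a A - {k}. g k l) = g k a + (\<Sum>l\<in>A - {k}. g k l)" if "k \<in> A" for k
  proof -
    have "insert a A - {k} = insert a (A - {k})" using that insert.hyps by auto
    then show ?thesis using insert.hyps by simp
  qed
  moreover have "insert a A - {a} = A" using insert.hyps by auto
  ultimately have "(\<Sum>k\<in>insert a A. \<Sum>l\<in>insert a A - {k}. g k l)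
      = (\<Sum>l\<in>A. g a l) + (\<Sum>k\<in>A. g k a) + (\<Sum>k\<in>A. \<Sum>l\<in>A - {k}. g k l)"
    using insert.hyps by (simp add: sum.distrib)
  also have "(\<Sum>k\<in>A. \<Sum>l\<in>A - {k}. g k l) = 0"
    using insert.IH insert.prems by blast
  also have "(\<Sum>k\<in>A. g k a) = (\<Sum>k\<in>A. - g a k)"
    using insert.prems insert.hyps by (intro sum.cong) auto
  finally show ?case by (simp add: sum_negf)
qed simp

lemma kos_kos:
  assumes "finite V" "finite r"
  shows "kos x V (kos x V f) r = 0"
proof -
  define g where "g k l = vertex_sign k r * x k *
      (vertex_sign l (insert k r) * x l * f (insert l (insert k r)))" for k l
  have "kos x V (kos x V f) r = (\<Sum>k\<in>V - r. \<Sum>l\<in>(V - r) - {k}. g k l)"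
    unfolding kos_def g_def
    by (intro sum.cong refl) (simp add: sum_distrib_left Diff_insert[symmetric] insert_commute)
  also have "\<dots> = 0"
  proof (rule antisymmetric_sum_eq_0)
    fix k l assume kl: "k \<in> V - r" "l \<in> V - r" "k \<noteq> l"
    have "g k l = (vertex_sign k r * vertex_sign l (insert k r)) *
        (x k * x l * f (insert l (insert k r)))"
      by (simp add: g_def mult_ac)
    also have "\<dots> = - (vertex_sign l r * vertex_sign k (insert l r)) *
        (x k * x l * f (insert l (insert k r)))"
      by (subst vertex_sign_swap) (use assms kl in auto)
    also have "\<dots> = - g l k"
      by (simp add: g_def mult_ac insert_commute)
    finally show "g k l = - g l k" .
  qed (use assms in simp)
  finally show ?thesis .
qed

lemma kos_cong:
  "(\<And>k. k \<in> V - r \<Longrightarrow> f (insert k r) = g (insert k r)) \<Longrightarrow> kos x V f r = kos x V g r"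
  by (simp add: kos_def)

lemma kos_add: "kos x V (\<lambda>s. f s + g s) r = kos x V f r + kos x V g r"
  by (simp add: kos_def distrib_left sum.distrib)

lemma kos_diff: "kos x V (\<lambda>s. f s - g s) r = kos x V f r - kos x V g r"
  by (simp add: kos_def right_diff_distrib sum_subtractf)

lemma kos_scale: "kos x V (\<lambda>s. c * f s) r = c * kos x V f r"
  by (simp add: kos_def sum_distrib_left mult_ac)

lemma kos_0 [simp]: "kos x V (\<lambda>s. 0) r = 0"
  by (simp add: kos_def)

abbreviation bd :: "nat set \<Rightarrow> (nat set \<Rightarrow> 'a::comm_ring_1) \<Rightarrow> nat set \<Rightarrow> 'a" where
  "bd \<equiv> kos (\<lambda>_. 1)"

text \<open>
  Exterior multiplication by the vertex \<open>k\<close>.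
\<close>

definition cone :: "nat \<Rightarrow> (nat set \<Rightarrow> 'a::comm_ring_1) \<Rightarrow> nat set \<Rightarrow> 'a" where
  "cone k f s = (if k \<in> s then vertex_sign k s * f (s - {k}) else 0)"

text \<open>
  Exterior multiplication by a vertex is a contraction: \<open>bd \<circ> cone + cone \<circ> bd\<close> is the identity.
  The second term involves only the boundary at \<open>s - {k}\<close>, so there is nothing to assume for \<open>k \<notin> s\<close>,
  in particular not in the lowest degree.
\<close>

lemma bd_cone:
  assumes "finite V" "k \<in> V" "s \<subseteq> V"
    and cycle: "\<And>r. s = insert k r \<Longrightarrow> k \<notin> r \<Longrightarrow> bd V f r = 0"
  shows "bd V (cone k f) s = f s"
proof (cases "k \<in> s")
  case False
  have fin: "finite s" using assms finite_subset by blast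
  have "bd V (cone k f) s = (\<Sum>l\<in>V - s. if l = k then f s else 0)"
    unfolding kos_def
  proof (rule sum.cong)
    fix l assume "l \<in> V - s"
    then show "vertex_sign l s * 1 * cone k f (insert l s) = (if l = k then f s else 0)"
      using False fin by (auto simp: cone_def vertex_sign_self)
  qed simp
  then show ?thesis using assms False by simp
next
  case True
  define r where "r = s - {k}"
  have r: "s = insert k r" "k \<notin> r" "r \<subseteq> V" using True assms by (auto simp: r_def)
  have fin: "finite r" using r assms finite_subset by blast
  have "bd V (cone k f) s
      = (\<Sum>l\<in>V - s. - vertex_sign k r * (vertex_sign l r * 1 * f (insert l r)))"
    unfolding kos_def
  proof (rule sum.cong)
    fix l assume l: "l \<in> V - s"
    have "insert l s - {k} = insert l r" using l r by auto
    then have "vertex_sign l s * 1 * cone k f (insert l s)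
        = (vertex_sign l (insert k r) * vertex_sign k (insert l (insert k r))) * f (insert l r)"
      using l r by (simp add: cone_def mult_ac)
    also have "vertex_sign k (insert l (insert k r)) = (vertex_sign k (insert l r) :: 'a)"
      using vertex_sign_self[of "insert l r" k] l r fin by (simp add: insert_commute)
    also have "vertex_sign l (insert k r) * vertex_sign k (insert l r)
        = (- (vertex_sign k r * vertex_sign l r) :: 'a)"
      using l r fin by (auto simp: vertex_sign_insert)
    finally show "vertex_sign l s * 1 * cone k f (insert l s)
      = - vertex_sign k r * (vertex_sign l r * 1 * f (insert l r))"
      by simp
  qed simp
  also have "\<dots> = - vertex_sign k r * (bd V f r - vertex_sign k r * f s)"
  proof -
    have "V - r = insert k (V - s)" using r(1,2) assms(2) by blast
    then have "bd V f r = vertex_sign k r * f s + (\<Sum>l\<in>V - s. vertex_sign l r * 1 * f (insert l r))"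
      unfolding kos_def using True assms(1) \<open>s = insert k r\<close>[symmetric] by simp
    then show ?thesis by (simp add: sum_distrib_left)
  qed
  also have "\<dots> = f s" using cycle[OF r(1,2)] by simp
  finally show ?thesis .
qed


section \<open>Alexander duality in one squarefree degree\<close>

text \<open>
  Finite-dimensional duality: a subspace of the functions on \<open>C\<close> is everything unless a nonzero
  functional kills it.  Induction on \<open>C\<close> produces the functional explicitly.
\<close>

lemma surjective_or_annihilated:
  fixes D :: "('b \<Rightarrow> 'k::field) set"
  assumes "finite C" "0 \<in> D"
    and add: "\<And>v w. v \<in> D \<Longrightarrow> w \<in> D \<Longrightarrow> (\<lambda>F. v F + w F) \<in> D"
    and scale: "\<And>c w. w \<in> D \<Longrightarrow> (\<lambda>F. c * w F) \<in> D"
    and ann: "\<And>z. (\<And>w. w \<in> D \<Longrightarrow> (\<Sum>F\<in>C. z F * w F) = 0) \<Longrightarrow> \<forall>F\<in>C. z F = 0"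
  shows "\<exists>w\<in>D. \<forall>F\<in>C. w F = u F"
  using assms(1) ann
proof (induction C arbitrary: u rule: finite_induct)
  case empty
  then show ?case using \<open>0 \<in> D\<close> by blast
next
  case (insert G C)
  have surj: "\<exists>w\<in>D. \<forall>F\<in>C. w F = u F" for u
  proof (rule insert.IH)
    fix z assume z: "\<And>w. w \<in> D \<Longrightarrow> (\<Sum>F\<in>C. z F * w F) = 0"
    have "(\<Sum>F\<in>insert G C. (z(G := 0)) F * w F) = (\<Sum>F\<in>C. z F * w F)" for w
      using insert.hyps by (auto intro!: sum.cong)
    with z have "\<forall>F\<in>insert G C. (z(G := 0)) F = 0" by (intro insert.prems) simp
    with insert.hyps show "\<forall>F\<in>C. z F = 0" by (metis fun_upd_apply insertCI)
  qed
  have "\<exists>w. w \<in> D \<and> (\<forall>F\<in>C. w F = (if F = H then 1 else 0))" for H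
    using surj[of "\<lambda>F. if F = H then 1 else 0"] by blast
  then obtain b where b: "\<And>H. b H \<in> D" "\<And>H F. F \<in> C \<Longrightarrow> b H F = (if F = H then 1 else 0)"
    by metis
  \<comment> \<open>Otherwise the value at \<open>G\<close> is determined by the values on \<open>C\<close>, and \<open>z\<close> below is that relation.\<close>
  have "\<exists>w\<in>D. (\<forall>F\<in>C. w F = 0) \<and> w G \<noteq> 0"
  proof (rule ccontr)
    assume *: "\<not> ?thesis"
    define z where "z F = (if F = G then 1 else - b F G)" for F
    have "\<forall>F\<in>insert G C. z F = 0"
    proof (rule insert.prems)
      fix w assume w: "w \<in> D"
      have comb: "(\<lambda>F. \<Sum>H\<in>A. c H * b H F) \<in> D" if "finite A" for c A
        using that
      proof (induction A rule: finite_induct)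
        case empty
        then show ?case using \<open>0 \<in> D\<close> by (simp add: zero_fun_def)
      next
        case (insert H A)
        have "(\<lambda>F. c H * b H F + (\<Sum>H\<in>A. c H * b H F)) \<in> D"
          by (intro add scale b(1) insert.IH)
        then show ?case using insert.hyps by simp
      qed
      define v where "v F = w F + (-1) * (\<Sum>H\<in>C. w H * b H F)" for F
      have "v \<in> D"
        unfolding v_def[abs_def] by (intro add w scale comb insert.hyps)
      moreover have "v F = 0" if "F \<in> C" for F
      proof -
        have "(\<Sum>H\<in>C. w H * b H F) = (\<Sum>H\<in>C. if H = F then w H else 0)"
          using that b by (intro sum.cong) auto
        then show ?thesis using that insert.hyps by (simp add: v_def)
      qed
      ultimately have "v G = 0" using * by blast
      then have "w G = (\<Sum>H\<in>C. w H * b H G)" by (simp add: v_def)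
      moreover have "(\<Sum>F\<in>C. z F * w F) = - (\<Sum>H\<in>C. w H * b H G)"
        unfolding sum_negf[symmetric] using insert.hyps by (intro sum.cong) (auto simp: z_def)
      ultimately show "(\<Sum>F\<in>insert G C. z F * w F) = 0"
        using insert.hyps by (simp add: z_def)
    qed
    then show False by (simp add: z_def)
  qed
  then obtain q where q: "q \<in> D" "\<forall>F\<in>C. q F = 0" "q G \<noteq> 0" by blast
  obtain w where w: "w \<in> D" "\<forall>F\<in>C. w F = u F" using surj by blast
  define w' where "w' F = w F + ((u G - w G) / q G) * q F" for F
  have "w' \<in> D" unfolding w'_def[abs_def] by (intro add scale w q)
  moreover have "\<forall>F\<in>insert G C. w' F = u F" using w q by (simp add: w'_def)
  ultimately show ?case by blast
qed

text \<open>
  The sum is the coefficient at \<open>e\<close> of the simplicial boundary of the chain \<open>z\<close>, with the sign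
  convention of \<open>induced_orientation\<close>.  These are the top-dimensional cycles of the clique complex
  when no clique has more than \<open>d\<close> vertices.
\<close>

definition clutter_cycle :: "nat \<Rightarrow> nat set set \<Rightarrow> (nat set \<Rightarrow> 'k::field) \<Rightarrow> bool" where
  "clutter_cycle d C z \<longleftrightarrow>
     (\<forall>e. card e = d - 1 \<longrightarrow>
        (\<Sum>F\<in>{F \<in> C. e \<subseteq> F}. z F * vertex_sign (the_elem (F - e)) F) = 0)"

text \<open>
  Complementation in \<open>W\<close> turns the signs of the Koszul differential into those of the simplicial
  coboundary up to this rescaling of the basis.
\<close>

definition twist :: "nat set \<Rightarrow> nat set \<Rightarrow> 'a::comm_ring_1" where
  "twist W s = (\<Prod>k\<in>s. vertex_sign k W)"

lemma twist_square [simp]: "twist W s * twist W s = 1"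
  by (simp add: twist_def flip: prod.distrib)

lemma twist_square_left [simp]: "twist W s * (twist W s * x) = x"
  by (simp flip: mult.assoc)

lemma remove_one_element:
  assumes "finite F" "card F = d" "d \<ge> 1" "e \<subseteq> F" "card e = d - 1"
  obtains k where "k \<in> F" "k \<notin> e" "F = insert k e" "the_elem (F - e) = k" "e = F - {k}"
proof -
  have "card (F - e) = 1"
    using assms by (simp add: card_Diff_subset finite_subset)
  then obtain k where k: "F - e = {k}" by (auto simp: card_1_singleton_iff)
  show ?thesis by (rule that[of k]) (use k assms in auto)
qed

lemma twist_facet:
  assumes "finite W" "F \<subseteq> W" "card F = d" "d \<ge> 1" "e \<subseteq> F" "card e = d - 1"
  shows "twist W F * vertex_sign (the_elem (F - e)) (W - F)
    = twist W e * vertex_sign (the_elem (F - e)) F"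
proof -
  have fin: "finite F" using assms finite_subset by blast
  obtain k where k: "k \<in> F" "k \<notin> e" "F = insert k e" "the_elem (F - e) = k"
    using remove_one_element[OF fin assms(3-6)] by metis
  have "finite e" using fin assms finite_subset by blast
  then have "twist W F = vertex_sign k W * (twist W e :: 'a)"
    using k by (simp add: twist_def)
  also have "vertex_sign k W = vertex_sign k F * (vertex_sign k (W - F) :: 'a)"
    by (rule vertex_sign_split) (use assms in auto)
  finally show ?thesis using k(4) by (simp add: mult_ac)
qed

lemma bd_complement:
  assumes "finite W" "F \<subseteq> W" "card F = d" "d \<ge> 1"
  shows "bd W y (W - F) =
    (\<Sum>e\<in>{e \<in> nsets W (d - 1). e \<subseteq> F}. vertex_sign (the_elem (F - e)) (W - F) * y (W - e))"
proof -
  have fin: "finite F" using assms finite_subset by blast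
  have "bij_betw (\<lambda>k. F - {k}) F {e \<in> nsets W (d - 1). e \<subseteq> F}"
  proof (rule bij_betwI')
    fix k l assume "k \<in> F" "l \<in> F"
    then show "(F - {k} = F - {l}) = (k = l)" by auto
  next
    fix k assume "k \<in> F"
    then show "F - {k} \<in> {e \<in> nsets W (d - 1). e \<subseteq> F}"
      using assms fin by (auto simp: nsets_def)
  next
    fix e assume "e \<in> {e \<in> nsets W (d - 1). e \<subseteq> F}"
    then have "e \<subseteq> F" "card e = d - 1" by (auto simp: nsets_def)
    from remove_one_element[OF fin assms(3,4) this] show "\<exists>k\<in>F. e = F - {k}" by metis
  qed
  then have "(\<Sum>e\<in>{e \<in> nsets W (d - 1). e \<subseteq> F}.
        vertex_sign (the_elem (F - e)) (W - F) * y (W - e))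
      = (\<Sum>k\<in>F. vertex_sign (the_elem (F - (F - {k}))) (W - F) * y (W - (F - {k})))"
    by (rule sum.reindex_bij_betw[symmetric])
  also have "\<dots> = (\<Sum>k\<in>F. vertex_sign k (W - F) * 1 * y (insert k (W - F)))"
  proof (rule sum.cong)
    fix k assume "k \<in> F"
    then have "F - (F - {k}) = {k}" "W - (F - {k}) = insert k (W - F)" using assms by auto
    then show "vertex_sign (the_elem (F - (F - {k}))) (W - F) * y (W - (F - {k}))
      = vertex_sign k (W - F) * 1 * y (insert k (W - F))" by simp
  qed simp
  also have "\<dots> = bd W y (W - F)"
    unfolding kos_def using assms by (intro sum.cong) auto
  finally show ?thesis ..
qed

text \<open>
  Read on complements and rescaled by \<open>twist\<close>, the Koszul differential is the simplicial
  coboundary, so pairing it with \<open>z\<close> amounts to pairing with the boundary of \<open>z\<close>.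
\<close>

lemma koszul_pairing:
  assumes W: "finite W" and C: "C \<subseteq> nsets W d" and d: "d \<ge> 1"
  shows "(\<Sum>F\<in>C. z F * twist W F * bd W y (W - F))
    = (\<Sum>e\<in>nsets W (d - 1). twist W e * y (W - e) *
        (\<Sum>F\<in>{F \<in> C. e \<subseteq> F}. z F * vertex_sign (the_elem (F - e)) F))"
proof -
  have fin: "finite C" "finite (nsets W (d - 1))"
    using W C finite_subset finite_imp_finite_nsets by blast+
  have "z F * twist W F * bd W y (W - F)
      = (\<Sum>e\<in>{e \<in> nsets W (d - 1). e \<subseteq> F}.
           twist W e * y (W - e) * (z F * vertex_sign (the_elem (F - e)) F))"
    if "F \<in> C" for F
  proof -
    have F: "F \<subseteq> W" "card F = d" using that C by (auto simp: nsets_def)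
    show ?thesis
      unfolding bd_complement[OF W F d] sum_distrib_left
    proof (rule sum.cong)
      fix e assume "e \<in> {e \<in> nsets W (d - 1). e \<subseteq> F}"
      then have e: "e \<subseteq> F" "card e = d - 1" by (auto simp: nsets_def)
      have "z F * twist W F * (vertex_sign (the_elem (F - e)) (W - F) * y (W - e))
          = z F * (twist W F * vertex_sign (the_elem (F - e)) (W - F)) * y (W - e)"
        by (simp only: mult_ac)
      then show "z F * twist W F * (vertex_sign (the_elem (F - e)) (W - F) * y (W - e))
          = twist W e * y (W - e) * (z F * vertex_sign (the_elem (F - e)) F)"
        unfolding twist_facet[OF W F d e] by (simp only: mult_ac)
    qed simp
  qed
  then have "(\<Sum>F\<in>C. z F * twist W F * bd W y (W - F))
      = (\<Sum>F\<in>C. \<Sum>e\<in>{e \<in> nsets W (d - 1). e \<subseteq> F}.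
           twist W e * y (W - e) * (z F * vertex_sign (the_elem (F - e)) F))"
    by simp
  also have "\<dots> = (\<Sum>e\<in>nsets W (d - 1). \<Sum>F\<in>{F \<in> C. e \<subseteq> F}.
           twist W e * y (W - e) * (z F * vertex_sign (the_elem (F - e)) F))"
    by (rule sum.swap_restrict[OF fin])
  finally show ?thesis by (simp add: sum_distrib_left)
qed

text \<open>
  The coboundary map into the functions on \<open>C\<close> is onto because its transpose, the boundary map on
  chains supported in \<open>C\<close>, is injective.
\<close>

lemma bd_onto_clutter:
  fixes u :: "nat set \<Rightarrow> 'k::field"
  assumes W: "finite W" and C: "C \<subseteq> nsets W d" and d: "d \<ge> 1"
    and acyclic: "\<And>z :: nat set \<Rightarrow> 'k. clutter_cycle d C z \<Longrightarrow> \<forall>F\<in>C. z F = 0"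
  shows "\<exists>y. \<forall>F\<in>C. bd W y (W - F) = u F"
proof -
  define D where "D = range (\<lambda>y F. bd W y (W - F) :: 'k)"
  have "\<exists>w\<in>D. \<forall>F\<in>C. w F = u F"
  proof (rule surjective_or_annihilated)
    show "finite C" using W C finite_subset finite_imp_finite_nsets by blast
    show "0 \<in> D" unfolding D_def by (rule image_eqI[of _ _ "\<lambda>_. 0"]) (auto simp: fun_eq_iff)
  next
    fix v w assume "v \<in> D" "w \<in> D"
    then obtain y y' where "v = (\<lambda>F. bd W y (W - F))" "w = (\<lambda>F. bd W y' (W - F))"
      by (auto simp: D_def)
    then show "(\<lambda>F. v F + w F) \<in> D"
      unfolding D_def by (intro image_eqI[of _ _ "\<lambda>s. y s + y' s"]) (auto simp: kos_add)
  next
    fix c w assume "w \<in> D"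
    then obtain y where "w = (\<lambda>F. bd W y (W - F))" by (auto simp: D_def)
    then show "(\<lambda>F. c * w F) \<in> D"
      unfolding D_def by (intro image_eqI[of _ _ "\<lambda>s. c * y s"]) (auto simp: kos_scale)
  next
    fix z assume z: "\<And>w. w \<in> D \<Longrightarrow> (\<Sum>F\<in>C. z F * w F) = 0"
    define z' where "z' F = z F * twist W F" for F
    have zz': "z F = z' F * twist W F" for F by (simp add: z'_def mult.assoc)
    have "clutter_cycle d C z'"
      unfolding clutter_cycle_def
    proof (intro allI impI)
      fix e :: "nat set" assume e: "card e = d - 1"
      let ?S = "\<lambda>e. \<Sum>F\<in>{F \<in> C. e \<subseteq> F}. z' F * vertex_sign (the_elem (F - e)) F"
      show "?S e = 0"
      proof (cases "e \<subseteq> W")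
        case False
        then have "{F \<in> C. e \<subseteq> F} = {}" using C by (auto simp: nsets_def)
        then show ?thesis by (simp only: sum.empty)
      next
        case True
        then have e_in: "e \<in> nsets W (d - 1)"
          using e W finite_subset by (auto simp: nsets_def)
        \<comment> \<open>Test \<open>z\<close> against the boundary of the basis element complementary to \<open>e\<close>.\<close>
        let ?y = "\<lambda>s. if s = W - e then 1 else 0"
        have "0 = (\<Sum>F\<in>C. z' F * twist W F * bd W ?y (W - F))"
          using z[of "\<lambda>F. bd W ?y (W - F)"] by (simp add: D_def zz')
        also have "\<dots> = (\<Sum>e'\<in>nsets W (d - 1). twist W e' * ?y (W - e') * ?S e')"
          by (rule koszul_pairing[OF W C d])
        also have "\<dots> = (\<Sum>e'\<in>nsets W (d - 1). if e' = e then twist W e * ?S e else 0)"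
        proof (rule sum.cong)
          fix e' assume "e' \<in> nsets W (d - 1)"
          then have "W - e' = W - e \<longleftrightarrow> e' = e" using True by (auto simp: nsets_def)
          then show "twist W e' * ?y (W - e') * ?S e' = (if e' = e then twist W e * ?S e else 0)"
            by simp
        qed simp
        also have "\<dots> = twist W e * ?S e"
          by (subst sum.delta[OF finite_imp_finite_nsets[OF W]]) (use e_in in simp)
        finally have "0 = twist W e * ?S e" .
        then have "twist W e * (twist W e * ?S e) = twist W e * 0" by (simp only:)
        then show ?thesis by (simp only: twist_square_left mult_zero_right)
      qed
    qed
    from acyclic[OF this] show "\<forall>F\<in>C. z F = 0" by (simp add: zz')
  qed
  then show ?thesis by (auto simp: D_def)
qed

lemma koszul_pairing_cycle:
  assumes "finite W" "C \<subseteq> nsets W d" "d \<ge> 1" "clutter_cycle d C z"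
  shows "(\<Sum>F\<in>C. z F * twist W F * bd W y (W - F)) = 0"
  unfolding koszul_pairing[OF assms(1-3)]
  by (rule sum.neutral) (use assms(4) in \<open>auto simp: clutter_cycle_def nsets_def\<close>)


section \<open>The Koszul complex\<close>

definition sqfree_mon :: "nat set \<Rightarrow> (nat \<Rightarrow>\<^sub>0 nat)" where
  "sqfree_mon s = (\<Sum>k\<in>s. single k 1)"

lemma lookup_sqfree_mon: "finite s \<Longrightarrow> lookup (sqfree_mon s) k = (if k \<in> s then 1 else 0)"
  by (simp add: sqfree_mon_def lookup_sum lookup_single when_def)

lemma keys_sqfree_mon [simp]: "finite s \<Longrightarrow> keys (sqfree_mon s) = s"
  by (auto simp: in_keys_iff lookup_sqfree_mon split: if_splits)

lemma sqfree_mon_empty [simp]: "sqfree_mon {} = 0"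
  by (simp add: sqfree_mon_def)

lemma mon_deg_sqfree_mon: "finite s \<Longrightarrow> mon_deg (sqfree_mon s) = card s"
  by (simp add: mon_deg_def lookup_sqfree_mon)

lemma lookup_mon_minus: "lookup (a - b) k = lookup a k - lookup (b :: nat \<Rightarrow>\<^sub>0 nat) k"
  by (simp add: minus_poly_mapping.rep_eq)

lemma minus_sqfree_mon_add:
  assumes "finite s" "s \<subseteq> keys a"
  shows "(a - sqfree_mon s) + sqfree_mon s = a"
proof (rule poly_mapping_eqI)
  fix k
  have "lookup a k \<noteq> 0" if "k \<in> s" using assms that by (auto simp: in_keys_iff)
  then show "lookup (a - sqfree_mon s + sqfree_mon s) k = lookup a k"
    using assms by (auto simp: lookup_add lookup_mon_minus lookup_sqfree_mon)
qed

lemma sqfree_mon_subset_keys_add: "finite s \<Longrightarrow> s \<subseteq> keys (t + sqfree_mon s)"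
  by (auto simp: in_keys_iff lookup_add lookup_sqfree_mon)

lemma mon_deg_minus_sqfree_mon:
  assumes "finite s" "s \<subseteq> keys a"
  shows "int (mon_deg (a - sqfree_mon s)) = int (mon_deg a) - int (card s)"
proof -
  have "mon_deg a = mon_deg (a - sqfree_mon s) + card s"
    using assms mon_deg_add[of "a - sqfree_mon s" "sqfree_mon s"]
    by (simp add: minus_sqfree_mon_add mon_deg_sqfree_mon)
  then show ?thesis by simp
qed

lemma prod_var: "finite s \<Longrightarrow> (\<Prod>k\<in>s. var k) = single (sqfree_mon s) 1"
  by (induction s rule: finite_induct) (simp_all add: var_def sqfree_mon_def mult_single)

lemma lookup_single_mult:
  "lookup (single s c * p) (s + t) = c * lookup (p :: 'k::field mpoly) t"
  by (simp add: lookup_mult lookup_single when_mult)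

lemma lookup_var_mult:
  "lookup (var k * p) t = (if k \<in> keys t then lookup p (t - single k 1) else 0)"
proof (cases "k \<in> keys t")
  case True
  have "t = single k 1 + (t - single k 1)"
    using True by (intro poly_mapping_eqI)
      (auto simp: lookup_add lookup_mon_minus lookup_single when_def in_keys_iff)
  then have "lookup (var k * p) t = lookup (single (single k 1) 1 * p) (single k 1 + (t - single k 1))"
    by (simp add: var_def)
  then show ?thesis using True by (simp only: lookup_single_mult) simp
next
  case False
  have "t \<notin> keys (var k * p)"
  proof
    assume "t \<in> keys (var k * p)"
    then obtain u where "t = single k 1 + u"
      using keys_mult[of "var k" p] by (auto simp: var_def)
    with False show False by (simp add: in_keys_iff lookup_add)
  qed
  with False show ?thesis by (simp add: in_keys_iff)
qed

lemma lookup_vertex_sign_mult: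
  "lookup (vertex_sign k s * p) t = vertex_sign k s * lookup (p :: 'k::field mpoly) t"
  by (cases "even (card {u \<in> s. u < k})") (auto simp: vertex_sign_def)

text \<open>
  The coefficients of a Koszul chain in the fine degree \<open>a\<close>.  The basis element of \<open>s\<close> has fine
  degree \<open>sqfree_mon s\<close>; when that does not divide \<open>a\<close>, the truncated difference of exponents would
  name an unrelated monomial, so the coefficient is set to 0.
\<close>

definition fine_part :: "(nat set \<Rightarrow> 'k::field mpoly) \<Rightarrow> (nat \<Rightarrow>\<^sub>0 nat) \<Rightarrow> nat set \<Rightarrow> 'k" where
  "fine_part u a s = (if s \<subseteq> keys a then lookup (u s) (a - sqfree_mon s) else 0)"

text \<open>
  The differential preserves fine degrees: multiplication by \<open>x\<^sub>k\<close> makes up for the removal of \<open>k\<close>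
  from the exterior part.
\<close>

lemma lookup_kos_var:
  assumes r: "finite r" "r \<subseteq> keys a"
  shows "lookup (kos var {1..n} u r) (a - sqfree_mon r) = bd (keys a \<inter> {1..n}) (fine_part u a) r"
proof -
  have "lookup (vertex_sign k r * var k * u (insert k r)) (a - sqfree_mon r)
      = vertex_sign k r * 1 * fine_part u a (insert k r)" if "k \<in> {1..n} - r" for k
  proof -
    have "k \<in> keys (a - sqfree_mon r) \<longleftrightarrow> k \<in> keys a"
      using r that by (simp add: in_keys_iff lookup_mon_minus lookup_sqfree_mon)
    moreover have "a - sqfree_mon r - single k 1 = a - sqfree_mon (insert k r)"
      using r that by (intro poly_mapping_eqI)
        (auto simp: lookup_mon_minus lookup_sqfree_mon lookup_single when_def)
    ultimately show ?thesis
      using r by (simp add: fine_part_def mult.assoc lookup_vertex_sign_mult lookup_var_mult)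
  qed
  then have "lookup (kos var {1..n} u r) (a - sqfree_mon r)
      = (\<Sum>k\<in>{1..n} - r. vertex_sign k r * 1 * fine_part u a (insert k r))"
    unfolding kos_def lookup_sum by (intro sum.cong) auto
  also have "\<dots> = bd (keys a \<inter> {1..n}) (fine_part u a) r"
    unfolding kos_def
    by (rule sum.mono_neutral_right) (auto simp: fine_part_def)
  finally show ?thesis .
qed

definition fine_degrees :: "nat \<Rightarrow> nat \<Rightarrow> (nat set \<Rightarrow> 'k::field mpoly) \<Rightarrow> (nat \<Rightarrow>\<^sub>0 nat) set" where
  "fine_degrees n i u = (\<Union>s\<in>nsets {1..n} i. (\<lambda>t. t + sqfree_mon s) ` keys (u s))"

text \<open>
  A chain has finitely many fine degrees, and a preimage can be assembled from preimages in each of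
  them.  The set \<open>T\<close> collects the monomials allowed as coefficients of the preimage, so that the
  lemma covers the polynomial ring as well as monomial ideals.
\<close>

lemma koszul_exact_finely_graded:
  fixes u :: "nat set \<Rightarrow> 'k::field mpoly"
  assumes u: "\<And>s. s \<in> nsets {1..n} i \<Longrightarrow> u s \<in> poly_ring n"
    and fine: "\<And>a. a \<in> fine_degrees n i u \<Longrightarrow> \<exists>g.
        (\<forall>s\<in>nsets {1..n} (Suc i). g s \<noteq> 0 \<longrightarrow> s \<subseteq> keys a \<and> a - sqfree_mon s \<in> T) \<and>
        (\<forall>s\<in>nsets {1..n} i. s \<subseteq> keys a \<longrightarrow> bd (keys a) g s = fine_part u a s)"
  obtains w where
    "\<And>s t. s \<in> nsets {1..n} (Suc i) \<Longrightarrow> t \<in> keys (w s) \<Longrightarrow>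
       t \<in> T \<and> (\<exists>a\<in>fine_degrees n i u. s \<subseteq> keys a \<and> t = a - sqfree_mon s)"
    "\<And>s. s \<in> nsets {1..n} (Suc i) \<Longrightarrow> w s \<in> poly_ring n"
    "\<And>s. s \<in> nsets {1..n} i \<Longrightarrow> kos var {1..n} w s = u s"
proof -
  let ?A = "fine_degrees n i u"
  have finA: "finite ?A"
    unfolding fine_degrees_def by (auto intro!: finite_imp_finite_nsets)
  have keys_A: "keys a \<subseteq> {1..n}" if "a \<in> ?A" for a
  proof -
    obtain s t where st: "s \<in> nsets {1..n} i" "t \<in> keys (u s)" "a = t + sqfree_mon s"
      using \<open>a \<in> ?A\<close> by (auto simp: fine_degrees_def)
    then have "keys t \<subseteq> {1..n}" "finite s" "s \<subseteq> {1..n}"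
      using u[OF st(1)] by (auto simp: poly_ring_def nsets_def)
    then show ?thesis using st(3) keys_add[of t "sqfree_mon s"] by auto
  qed
  have "\<forall>a. \<exists>g. a \<in> ?A \<longrightarrow>
      (\<forall>s\<in>nsets {1..n} (Suc i). g s \<noteq> 0 \<longrightarrow> s \<subseteq> keys a \<and> a - sqfree_mon s \<in> T) \<and>
      (\<forall>s\<in>nsets {1..n} i. s \<subseteq> keys a \<longrightarrow> bd (keys a) g s = fine_part u a s)"
    using fine by blast
  then obtain g where "\<forall>a. a \<in> ?A \<longrightarrow>
      (\<forall>s\<in>nsets {1..n} (Suc i). g a s \<noteq> 0 \<longrightarrow> s \<subseteq> keys a \<and> a - sqfree_mon s \<in> T) \<and>
      (\<forall>s\<in>nsets {1..n} i. s \<subseteq> keys a \<longrightarrow> bd (keys a) (g a) s = fine_part u a s)"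
    by (rule choice[THEN exE])
  then have g: "\<And>a s. a \<in> ?A \<Longrightarrow> s \<in> nsets {1..n} (Suc i) \<Longrightarrow> g a s \<noteq> 0 \<Longrightarrow>
        s \<subseteq> keys a \<and> a - sqfree_mon s \<in> T"
    "\<And>a s. a \<in> ?A \<Longrightarrow> s \<in> nsets {1..n} i \<Longrightarrow> s \<subseteq> keys a \<Longrightarrow>
        bd (keys a) (g a) s = fine_part u a s"
    by blast+
  define w where "w s = (\<Sum>a\<in>?A. if s \<subseteq> keys a then single (a - sqfree_mon s) (g a s) else 0)" for s
  have keys_w: "t \<in> T \<and> (\<exists>a\<in>?A. s \<subseteq> keys a \<and> t = a - sqfree_mon s)"
    if s: "s \<in> nsets {1..n} (Suc i)" and "t \<in> keys (w s)" for s t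
  proof -
    have "keys (w s) \<subseteq> (\<Union>a\<in>?A. keys (if s \<subseteq> keys a then single (a - sqfree_mon s) (g a s) else 0))"
      unfolding w_def by (rule keys_sum)
    with that(2) obtain a where "a \<in> ?A"
      "t \<in> keys (if s \<subseteq> keys a then single (a - sqfree_mon s) (g a s) else 0)"
      by blast
    then have "a \<in> ?A" "s \<subseteq> keys a" "t = a - sqfree_mon s" "g a s \<noteq> 0"
      by (auto split: if_splits)
    then show ?thesis using g(1)[OF _ s] by blast
  qed
  have w_ring: "w s \<in> poly_ring n" if s: "s \<in> nsets {1..n} (Suc i)" for s
    unfolding poly_ring_def
  proof (intro CollectI ballI)
    fix t assume "t \<in> keys (w s)"
    then obtain a where "a \<in> ?A" "t = a - sqfree_mon s" using keys_w[OF s] by blast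
    moreover have "keys (a - sqfree_mon s) \<subseteq> keys a" by (auto simp: in_keys_iff lookup_mon_minus)
    ultimately show "keys t \<subseteq> {1..n}" using keys_A by blast
  qed
  have fine_w: "fine_part w b s = (if b \<in> ?A then g b s else 0)"
    if s: "s \<in> nsets {1..n} (Suc i)" for b s
  proof (cases "s \<subseteq> keys b")
    case True
    have fs: "finite s" using s by (auto simp: nsets_def)
    have "lookup (w s) (b - sqfree_mon s) = (\<Sum>a\<in>?A. if a = b then g a s else 0)"
      unfolding w_def lookup_sum
    proof (rule sum.cong)
      fix a
      have "a = b" if "s \<subseteq> keys a" "a - sqfree_mon s = b - sqfree_mon s"
        by (rule box_equals[OF _ minus_sqfree_mon_add[OF fs that(1)] minus_sqfree_mon_add[OF fs True]])
          (simp only: that(2))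
      then show "lookup (if s \<subseteq> keys a then single (a - sqfree_mon s) (g a s) else 0)
          (b - sqfree_mon s) = (if a = b then g a s else 0)"
        using True by (auto simp: lookup_single when_def)
    qed simp
    then show ?thesis using True finA by (simp add: fine_part_def)
  next
    case False
    then show ?thesis using g(1)[OF _ s, of b] by (auto simp: fine_part_def)
  qed
  have "kos var {1..n} w s = u s" if s: "s \<in> nsets {1..n} i" for s
  proof (rule poly_mapping_eqI)
    fix t
    define a where "a = t + sqfree_mon s"
    have fs: "finite s" "s \<subseteq> {1..n}" using s by (auto simp: nsets_def)
    have sa: "s \<subseteq> keys a" "a - sqfree_mon s = t"
      using fs by (auto simp: a_def in_keys_iff lookup_add lookup_sqfree_mon)
    have ins: "insert k s \<in> nsets {1..n} (Suc i)" if "k \<in> {1..n} - s" for k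
      using s that by (auto simp: nsets_def)
    have "lookup (kos var {1..n} w s) t = bd (keys a \<inter> {1..n}) (fine_part w a) s"
      using lookup_kos_var[OF fs(1) sa(1)] sa(2) by simp
    also have "\<dots> = lookup (u s) t"
    proof (cases "a \<in> ?A")
      case True
      have "bd (keys a \<inter> {1..n}) (fine_part w a) s = bd (keys a \<inter> {1..n}) (g a) s"
        by (rule kos_cong) (use fine_w[OF ins] True in auto)
      also have "\<dots> = bd (keys a) (g a) s"
        using keys_A[OF True] by (simp only: Int_absorb2)
      also have "\<dots> = fine_part u a s" by (rule g(2)[OF True s sa(1)])
      finally show ?thesis using sa by (simp add: fine_part_def)
    next
      case False
      have "bd (keys a \<inter> {1..n}) (fine_part w a) s = bd (keys a \<inter> {1..n}) (\<lambda>_. 0) s"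
        by (rule kos_cong) (use fine_w[OF ins] False in auto)
      moreover have "t \<notin> keys (u s)"
        using False s by (auto simp: fine_degrees_def a_def)
      ultimately show ?thesis by (simp add: in_keys_iff)
    qed
    finally show "lookup (kos var {1..n} w s) t = lookup (u s) t" .
  qed
  with keys_w w_ring show thesis using that by blast
qed

lemma bd_fine_part_cycle:
  assumes u: "\<And>s. s \<in> nsets {1..n} i \<Longrightarrow> u s \<in> poly_ring n"
    and cycle: "\<And>r. r \<in> nsets {1..n} (i - 1) \<Longrightarrow> i \<ge> 1 \<Longrightarrow> kos var {1..n} u r = 0"
    and a: "a \<in> fine_degrees n i u" and s: "s \<in> nsets {1..n} i" "s \<subseteq> keys a" and k: "k \<in> keys a"
  shows "bd (keys a) (cone k (fine_part u a)) s = fine_part u a s"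
proof (rule bd_cone)
  fix r assume r: "s = insert k r" "k \<notin> r"
  have "finite s" using s by (auto simp: nsets_def)
  then have "r \<in> nsets {1..n} (i - 1)" "i \<ge> 1" "finite r"
    using r s by (auto simp: nsets_def)
  then have "bd (keys a \<inter> {1..n}) (fine_part u a) r = 0"
    using lookup_kos_var[of r a n u] r s cycle by simp
  moreover have "keys a \<subseteq> {1..n}"
  proof -
    obtain s t where st: "s \<in> nsets {1..n} i" "t \<in> keys (u s)" "a = t + sqfree_mon s"
      using a by (auto simp: fine_degrees_def)
    then have "keys t \<subseteq> {1..n}" "finite s" "s \<subseteq> {1..n}"
      using u[OF st(1)] by (auto simp: poly_ring_def nsets_def)
    then show ?thesis using st(3) keys_add[of t "sqfree_mon s"] by auto
  qed
  ultimately show "bd (keys a) (fine_part u a) r = 0" by (simp add: Int_absorb2)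
qed (use s k in auto)

text \<open>The \<open>i\<close>-subsets of the vertex set are enumerated to match the format of free complexes.\<close>

definition enum_nsets :: "nat \<Rightarrow> nat \<Rightarrow> nat \<Rightarrow> nat set" where
  "enum_nsets n i = (SOME f. bij_betw f {..<card (nsets {1..n} i)} (nsets {1..n} i))"

lemma enum_nsets: "bij_betw (enum_nsets n i) {..<card (nsets {1..n} i)} (nsets {1..n} i)"
proof -
  have "\<exists>f. bij_betw f {..<card (nsets {1..n} i)} (nsets {1..n} i)"
    using ex_bij_betw_nat_finite[OF finite_imp_finite_nsets[of "{1..n}" i]]
    by (simp add: lessThan_atLeast0)
  then show ?thesis unfolding enum_nsets_def by (rule someI_ex)
qed

definition koszul :: "nat \<Rightarrow> 'k::field free_complex" where
  "koszul n = \<lparr>fc_rank = \<lambda>i. card (nsets {1..n} i), fc_shift = \<lambda>i k. int i,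
     fc_mat = \<lambda>i k l. let s = enum_nsets n i k; r = enum_nsets n (i - 1) l in
       if r \<subseteq> s then vertex_sign (the_elem (s - r)) r * var (the_elem (s - r)) else 0,
     fc_aug = \<lambda>k. 1\<rparr>"

definition vec_of :: "nat \<Rightarrow> nat \<Rightarrow> (nat set \<Rightarrow> 'k::field mpoly) \<Rightarrow> nat \<Rightarrow> 'k mpoly" where
  "vec_of n i u = (\<lambda>l. if l < card (nsets {1..n} i) then u (enum_nsets n i l) else 0)"

lemma vec_of_cong: "(\<And>s. s \<in> nsets {1..n} i \<Longrightarrow> u s = w s) \<Longrightarrow> vec_of n i u = vec_of n i w"
  using bij_betwE[OF enum_nsets[of n i]] by (auto simp: vec_of_def fun_eq_iff)

lemma vec_of_eq_0_iff: "vec_of n i u = 0 \<longleftrightarrow> (\<forall>s\<in>nsets {1..n} i. u s = 0)"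
proof
  assume *: "vec_of n i u = 0"
  show "\<forall>s\<in>nsets {1..n} i. u s = 0"
  proof
    fix s assume "s \<in> nsets {1..n} i"
    then obtain l where "l < card (nsets {1..n} i)" "enum_nsets n i l = s"
      using bij_betw_imp_surj_on[OF enum_nsets[of n i]] by (metis imageE lessThan_iff)
    then show "u s = 0" using fun_cong[OF *, of l] by (simp add: vec_of_def)
  qed
next
  assume "\<forall>s\<in>nsets {1..n} i. u s = 0"
  then have "vec_of n i u = vec_of n i (\<lambda>_. 0)" by (intro vec_of_cong) auto
  then show "vec_of n i u = 0" by (simp add: vec_of_def fun_eq_iff)
qed

lemma vec_of_diff: "vec_of n i u - vec_of n i w = vec_of n i (\<lambda>s. u s - w s)"
  by (simp add: vec_of_def fun_eq_iff)

lemma vec_of_surj: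
  assumes "\<forall>k\<ge>card (nsets {1..n} i). v k = 0"
  obtains u where "v = vec_of n i u"
    "\<And>s. s \<in> nsets {1..n} i \<Longrightarrow> \<exists>k<card (nsets {1..n} i). u s = v k"
proof
  let ?g = "inv_into {..<card (nsets {1..n} i)} (enum_nsets n i)"
  show "v = vec_of n i (\<lambda>s. v (?g s))"
    using assms bij_betw_inv_into_left[OF enum_nsets[of n i]] by (auto simp: vec_of_def fun_eq_iff)
  show "\<exists>k<card (nsets {1..n} i). v (?g s) = v k" if "s \<in> nsets {1..n} i" for s
    using bij_betwE[OF bij_betw_inv_into[OF enum_nsets[of n i]]] that by auto
qed

lemma direct_power_koszul:
  "direct_power M (fc_rank (koszul n) i) = vec_of n i ` {u. \<forall>s\<in>nsets {1..n} i. u s \<in> M}"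
    (is "?L = ?R")
proof
  show "?L \<subseteq> ?R"
  proof
    fix v assume v: "v \<in> ?L"
    then obtain u where u: "v = vec_of n i u"
      "\<And>s. s \<in> nsets {1..n} i \<Longrightarrow> \<exists>k<card (nsets {1..n} i). u s = v k"
      using vec_of_surj[of n i v] by (auto simp: direct_power_def koszul_def)
    have "u s \<in> M" if "s \<in> nsets {1..n} i" for s
      using u(2)[OF that] v by (auto simp: direct_power_def koszul_def)
    then show "v \<in> ?R" using u(1) by blast
  qed
  show "?R \<subseteq> ?L"
    using bij_betwE[OF enum_nsets[of n i]] by (auto simp: direct_power_def koszul_def vec_of_def)
qed

lemma tensor_comp_koszul:
  "tensor_comp (koszul n) M i j =
     vec_of n i ` {u. \<forall>s\<in>nsets {1..n} i. u s \<in> M \<and> homogeneous (j - int i) (u s)}"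
    (is "?L = ?R")
proof
  show "?L \<subseteq> ?R"
  proof
    fix v assume v: "v \<in> ?L"
    then obtain u where u: "v = vec_of n i u"
      "\<And>s. s \<in> nsets {1..n} i \<Longrightarrow> \<exists>k<card (nsets {1..n} i). u s = v k"
      using vec_of_surj[of n i v] by (auto simp: tensor_comp_def direct_power_def koszul_def)
    have "u s \<in> M \<and> homogeneous (j - int i) (u s)" if "s \<in> nsets {1..n} i" for s
      using u(2)[OF that] v by (auto simp: tensor_comp_def direct_power_def koszul_def)
    then show "v \<in> ?R" using u(1) by blast
  qed
  show "?R \<subseteq> ?L"
    using bij_betwE[OF enum_nsets[of n i]]
    by (auto simp: tensor_comp_def direct_power_def koszul_def vec_of_def)
qed

lemma fc_diff_koszul:
  "fc_diff (koszul n) (Suc i) (vec_of n (Suc i) u) = vec_of n i (kos var {1..n} u)"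
proof
  fix l
  show "fc_diff (koszul n) (Suc i) (vec_of n (Suc i) u) l = vec_of n i (kos var {1..n} u) l"
  proof (cases "l < card (nsets {1..n} i)")
    case True
    define r where "r = enum_nsets n i l"
    have r: "r \<in> nsets {1..n} i"
      using bij_betwE[OF enum_nsets[of n i]] True by (simp add: r_def)
    let ?h = "\<lambda>s. u s * (if r \<subseteq> s then vertex_sign (the_elem (s - r)) r * var (the_elem (s - r)) else 0)"
    have "fc_diff (koszul n) (Suc i) (vec_of n (Suc i) u) l
        = (\<Sum>k<card (nsets {1..n} (Suc i)). ?h (enum_nsets n (Suc i) k))"
      using True by (simp add: fc_diff_def koszul_def vec_of_def Let_def r_def cong: if_cong)
    also have "\<dots> = (\<Sum>s\<in>nsets {1..n} (Suc i). ?h s)"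
      by (rule sum.reindex_bij_betw[OF enum_nsets])
    also have "\<dots> = (\<Sum>s\<in>{s \<in> nsets {1..n} (Suc i). r \<subseteq> s}. ?h s)"
      by (rule sum.mono_neutral_right) (auto simp: finite_imp_finite_nsets)
    also have "\<dots> = (\<Sum>k\<in>{1..n} - r. ?h (insert k r))"
    proof (rule sum.reindex_bij_betw[symmetric], rule bij_betwI')
      fix k k' assume "k \<in> {1..n} - r" "k' \<in> {1..n} - r"
      then show "(insert k r = insert k' r) = (k = k')" by auto
    next
      fix k assume "k \<in> {1..n} - r"
      then show "insert k r \<in> {s \<in> nsets {1..n} (Suc i). r \<subseteq> s}"
        using r by (auto simp: nsets_def)
    next
      fix s assume "s \<in> {s \<in> nsets {1..n} (Suc i). r \<subseteq> s}"
      then have s: "finite s" "card s = Suc i" "r \<subseteq> s" "s \<subseteq> {1..n}" by (auto simp: nsets_def)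
      have "card r = Suc i - 1" using r by (simp add: nsets_def)
      then obtain k where "k \<in> s" "k \<notin> r" "s = insert k r"
        using remove_one_element[OF s(1,2) _ s(3)] by (metis le_add1 plus_1_eq_Suc)
      then show "\<exists>k\<in>{1..n} - r. s = insert k r" using s by auto
    qed
    also have "\<dots> = kos var {1..n} u r"
      unfolding kos_def
    proof (rule sum.cong)
      fix k assume "k \<in> {1..n} - r"
      then have "insert k r - r = {k}" by auto
      then show "?h (insert k r) = vertex_sign k r * var k * u (insert k r)"
        by (simp add: subset_insertI mult_ac)
    qed simp
    finally show ?thesis using True by (simp add: vec_of_def r_def)
  next
    case False
    then show ?thesis by (simp add: fc_diff_def koszul_def vec_of_def)
  qed
qed

lemma nsets_0: "nsets A 0 = {{}}"
  by (auto simp: nsets_def)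

lemma enum_nsets_0: "enum_nsets n 0 0 = {}"
  using bij_betwE[OF enum_nsets[of n 0]] by (simp add: nsets_0)

lemma fc_augment_koszul: "fc_augment (koszul n) (vec_of n 0 u) = lookup (u {}) 0"
  by (simp add: fc_augment_def koszul_def vec_of_def nsets_0 enum_nsets_0)

lemma poly_ring_var: "k \<in> {1..n} \<Longrightarrow> var k \<in> poly_ring n"
  by (auto simp: poly_ring_def var_def)

lemma homogeneous_var: "homogeneous 1 (var k)"
  by (simp add: homogeneous_def var_def mon_deg_def)

lemma poly_ring_vertex_sign_mult: "p \<in> poly_ring n \<Longrightarrow> vertex_sign k s * p \<in> poly_ring n"
  by (cases "even (card {u \<in> s. u < k})") (auto simp: vertex_sign_def intro: poly_ring_uminus)

lemma homogeneous_vertex_sign_mult: "homogeneous m p \<Longrightarrow> homogeneous m (vertex_sign k s * p)"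
  by (cases "even (card {u \<in> s. u < k})") (auto simp: vertex_sign_def intro: homogeneous_uminus)

text \<open>
  A cone over any variable occurring in a fine degree contracts that degree.  The usual Euler
  homotopy would divide by degrees and fail in positive characteristic.
\<close>

lemma koszul_exact:
  fixes u :: "nat set \<Rightarrow> 'k::field mpoly"
  assumes u: "\<And>s. s \<in> nsets {1..n} i \<Longrightarrow> u s \<in> poly_ring n"
    and cycle: "aug_cycle (koszul n) i (vec_of n i u)"
  obtains w where "\<And>s. s \<in> nsets {1..n} (Suc i) \<Longrightarrow> w s \<in> poly_ring n"
    "\<And>s. s \<in> nsets {1..n} i \<Longrightarrow> kos var {1..n} w s = u s"
proof -
  have kos_0: "kos var {1..n} u r = 0" if "r \<in> nsets {1..n} (i - 1)" "i \<ge> 1" for r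
    using cycle that fc_diff_koszul[of n "i - 1" u] by (simp add: aug_cycle_def vec_of_eq_0_iff)
  show thesis
  proof (rule koszul_exact_finely_graded[where T = UNIV, OF u])
    fix a assume a: "a \<in> fine_degrees n i u"
    then obtain s t where st: "s \<in> nsets {1..n} i" "t \<in> keys (u s)" "a = t + sqfree_mon s"
      by (auto simp: fine_degrees_def)
    have fs: "finite s" "card s = i" using st by (auto simp: nsets_def)
    \<comment> \<open>The degree \<open>0\<close> only occurs in \<open>F\<^sub>0\<close>, where the augmentation excludes it.\<close>
    have "keys a \<noteq> {}"
    proof (cases "i = 0")
      case True
      then have "s = {}" using fs by simp
      with True cycle have "lookup (u s) 0 = 0" by (simp add: aug_cycle_def fc_augment_koszul)
      with st(2) have "t \<noteq> 0" by (auto simp: in_keys_iff)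
      then show ?thesis using st(3) \<open>s = {}\<close> by simp
    next
      case False
      then have "s \<noteq> {}" using fs by auto
      then show ?thesis using sqfree_mon_subset_keys_add[OF fs(1), of t] st(3) by auto
    qed
    then obtain k where k: "k \<in> keys a" by blast
    have "s \<subseteq> keys a" if "cone k (fine_part u a) s \<noteq> 0" for s
      using that k by (auto simp: cone_def fine_part_def split: if_splits)
    then show "\<exists>g. (\<forall>s\<in>nsets {1..n} (Suc i). g s \<noteq> 0 \<longrightarrow> s \<subseteq> keys a \<and> a - sqfree_mon s \<in> UNIV) \<and>
        (\<forall>s\<in>nsets {1..n} i. s \<subseteq> keys a \<longrightarrow> bd (keys a) g s = fine_part u a s)"
      using bd_fine_part_cycle[OF u kos_0 a _ _ k] by blast
  next
    fix w assume "\<And>s. s \<in> nsets {1..n} (Suc i) \<Longrightarrow> w s \<in> poly_ring n"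
      "\<And>s. s \<in> nsets {1..n} i \<Longrightarrow> kos var {1..n} w s = u s"
    then show thesis by (rule that)
  qed
qed

lemma aug_cycle_koszul_boundary:
  "aug_cycle (koszul n) i (fc_diff (koszul n) (Suc i) (vec_of n (Suc i) u))"
proof (cases i)
  case 0
  have "lookup (kos var {1..n} u {}) 0 = 0"
    by (simp add: kos_def lookup_sum mult.assoc lookup_vertex_sign_mult lookup_var_mult)
  then show ?thesis by (simp add: aug_cycle_def 0 fc_diff_koszul fc_augment_koszul)
next
  case (Suc i')
  have "finite r" if "r \<in> nsets {1..n} i'" for r using that by (simp add: nsets_def)
  then show ?thesis
    by (simp add: aug_cycle_def Suc fc_diff_koszul vec_of_eq_0_iff kos_kos)
qed

lemma koszul_resolution_exact:
  "{v \<in> direct_power (poly_ring n :: 'k::field mpoly set)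
        (fc_rank (koszul n :: 'k free_complex) i). aug_cycle (koszul n) i v} =
   fc_diff (koszul n) (Suc i) ` direct_power (poly_ring n)
        (fc_rank (koszul n :: 'k free_complex) (Suc i))"
    (is "?L = ?R")
proof
  show "?L \<subseteq> ?R"
  proof
    fix v assume "v \<in> ?L"
    then obtain u where u: "v = vec_of n i u" "\<And>s. s \<in> nsets {1..n} i \<Longrightarrow> u s \<in> poly_ring n"
      "aug_cycle (koszul n) i (vec_of n i u)"
      by (auto simp: direct_power_koszul)
    obtain w where w: "\<And>s. s \<in> nsets {1..n} (Suc i) \<Longrightarrow> w s \<in> poly_ring n"
      "\<And>s. s \<in> nsets {1..n} i \<Longrightarrow> kos var {1..n} w s = u s"
      using koszul_exact[OF u(2,3)] by blast
    have "v = fc_diff (koszul n) (Suc i) (vec_of n (Suc i) w)"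
      unfolding u(1) fc_diff_koszul by (rule vec_of_cong) (rule w(2)[symmetric])
    moreover have "vec_of n (Suc i) w \<in> direct_power (poly_ring n) (fc_rank (koszul n) (Suc i))"
      using w(1) by (auto simp: direct_power_koszul)
    ultimately show "v \<in> ?R" by blast
  qed
  show "?R \<subseteq> ?L"
  proof
    fix v :: "nat \<Rightarrow> 'k mpoly" assume "v \<in> ?R"
    then obtain w where w: "v = fc_diff (koszul n) (Suc i) (vec_of n (Suc i) w)"
      "\<forall>s\<in>nsets {1..n} (Suc i). w s \<in> poly_ring n"
      by (auto simp: direct_power_koszul)
    have "kos var {1..n} w s \<in> poly_ring n" if "s \<in> nsets {1..n} i" for s
      unfolding kos_def mult.assoc
    proof (intro poly_ring_sum poly_ring_vertex_sign_mult poly_ring_mult poly_ring_var)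
      fix k assume "k \<in> {1..n} - s"
      then show "k \<in> {1..n}" "w (insert k s) \<in> poly_ring n"
        using that w(2) by (auto simp: nsets_def)
    qed
    then have "v \<in> direct_power (poly_ring n) (fc_rank (koszul n) i)"
      unfolding w(1) fc_diff_koszul direct_power_koszul by blast
    then show "v \<in> ?L" using aug_cycle_koszul_boundary w(1) by auto
  qed
qed

lemma koszul_graded_free_resolution:
  "graded_free_resolution n (koszul n :: 'k::field free_complex)"
  unfolding graded_free_resolution_def
proof (intro conjI allI impI)
  fix i k l :: nat
  assume i: "i \<ge> 1" and kl: "k < fc_rank (koszul n :: 'k free_complex) i"
    "l < fc_rank (koszul n :: 'k free_complex) (i - 1)"
  define s r where "s = enum_nsets n i k" and "r = enum_nsets n (i - 1) l"
  have s: "s \<in> nsets {1..n} i" and r: "r \<in> nsets {1..n} (i - 1)"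
    using bij_betwE[OF enum_nsets[of n i]] bij_betwE[OF enum_nsets[of n "i - 1"]] kl
    unfolding s_def r_def by (simp_all add: koszul_def)
  have "the_elem (s - r) \<in> {1..n}" if rs: "r \<subseteq> s"
  proof -
    have "finite s" "card s = i" "card r = i - 1" and sn: "s \<subseteq> {1..n}"
      using s r by (auto simp: nsets_def)
    then obtain k where "k \<in> s" "the_elem (s - r) = k"
      using remove_one_element[OF _ _ i rs] by metis
    then show ?thesis using sn by blast
  qed
  moreover have mat: "fc_mat (koszul n) i k l =
      (if r \<subseteq> s then vertex_sign (the_elem (s - r)) r * var (the_elem (s - r)) else 0 :: 'k mpoly)"
    by (simp add: koszul_def s_def r_def Let_def)
  ultimately show "fc_mat (koszul n :: 'k free_complex) i k l \<in> poly_ring n"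
    by (auto intro!: poly_ring_vertex_sign_mult poly_ring_var simp del: atLeastAtMost_iff)
  have "fc_shift (koszul n :: 'k free_complex) i k - fc_shift (koszul n :: 'k free_complex) (i - 1) l = 1"
    using i by (simp add: koszul_def)
  with mat show "homogeneous (fc_shift (koszul n :: 'k free_complex) i k
      - fc_shift (koszul n :: 'k free_complex) (i - 1) l) (fc_mat (koszul n :: 'k free_complex) i k l)"
    by (auto intro: homogeneous_vertex_sign_mult homogeneous_var)
next
  fix k show "fc_shift (koszul n :: 'k free_complex) 0 k = 0" by (simp add: koszul_def)
next
  have "c \<in> fc_augment (koszul n) ` direct_power (poly_ring n) (fc_rank (koszul n :: 'k free_complex) 0)"
    for c :: 'k
    unfolding direct_power_koszul
    by (rule image_eqI[of _ _ "vec_of n 0 (\<lambda>_. const c)"])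
      (auto simp: fc_augment_koszul const_def poly_ring_def)
  then show "fc_augment (koszul n) `
      direct_power (poly_ring n) (fc_rank (koszul n :: 'k free_complex) 0) = (UNIV :: 'k set)"
    by blast
next
  show "{v \<in> direct_power (poly_ring n :: 'k mpoly set) (fc_rank (koszul n :: 'k free_complex) 0).
      fc_augment (koszul n) v = 0} =
    fc_diff (koszul n) 1 ` direct_power (poly_ring n) (fc_rank (koszul n :: 'k free_complex) 1)"
    using koszul_resolution_exact[of n 0] by (simp add: aug_cycle_def)
next
  fix i :: nat assume "i \<ge> 1"
  then show "{v \<in> direct_power (poly_ring n :: 'k mpoly set) (fc_rank (koszul n :: 'k free_complex) i).
      fc_diff (koszul n) i v = 0} =
    fc_diff (koszul n) (i + 1) `
      direct_power (poly_ring n) (fc_rank (koszul n :: 'k free_complex) (i + 1))"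
    using koszul_resolution_exact[of n i] by (simp add: aug_cycle_def)
qed


section \<open>Nonvanishing of graded Betti numbers\<close>

text \<open>
  A proper inclusion lowers the dimension because \<open>V\<close> is finite-dimensional.
\<close>

lemma (in vector_space) dim_diff_neq_0_iff:
  assumes U: "subspace U" and UV: "U \<subseteq> V" and V: "V \<subseteq> span T" "finite T"
  shows "dim V - dim U \<noteq> 0 \<longleftrightarrow> \<not> V \<subseteq> U"
proof
  assume "dim V - dim U \<noteq> 0"
  then show "\<not> V \<subseteq> U" using UV by auto
next
  assume "\<not> V \<subseteq> U"
  then obtain v where v: "v \<in> V" "v \<notin> U" by blast
  obtain B where B: "B \<subseteq> U" "independent B" "U \<subseteq> span B" "card B = dim U"
    using basis_exists[of U] by blast
  have "span B = U" using B U span_subspace by blast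
  then have ind: "independent (insert v B)"
    using B(2) v(2) by (simp add: independent_insert)
  have "insert v B \<subseteq> V" using v B UV by auto
  from maximal_independent_subset_extend[OF this ind] obtain B' where
    B': "insert v B \<subseteq> B'" "B' \<subseteq> V" "independent B'" "V \<subseteq> span B'" by blast
  have "finite B'"
    using independent_span_bound[OF V(2) B'(3)] B'(2) V(1) by blast
  have "v \<notin> B" using v(2) B(1) by blast
  have "finite B" using \<open>finite B'\<close> B'(1) finite_subset by auto
  then have "card B < card (insert v B)" using \<open>v \<notin> B\<close> by simp
  also have "\<dots> \<le> card B'" by (rule card_mono[OF \<open>finite B'\<close> B'(1)])
  also have "card B' = dim V" using B' basis_card_eq_dim by blast
  finally show "dim V - dim U \<noteq> 0" using B(4) by simp
qed

lemma sum_fun_apply: "(\<Sum>x\<in>A. f x) l = (\<Sum>x\<in>A. f x l)"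
  by (induction A rule: infinite_finite_induct) auto

lemma mpoly_sum_monomials: "p = (\<Sum>t\<in>keys p. single t (lookup p t))"
proof (rule poly_mapping_eqI)
  fix s
  have "lookup (\<Sum>t\<in>keys p. single t (lookup p t)) s = (\<Sum>t\<in>keys p. if t = s then lookup p t else 0)"
    by (simp add: lookup_sum lookup_single when_def)
  then show "lookup p s = lookup (\<Sum>t\<in>keys p. single t (lookup p t)) s"
    by (simp add: in_keys_iff)
qed

lemma finite_monomials: "finite {t. keys t \<subseteq> {1..n} \<and> mon_deg t \<le> m}"
proof (rule finite_imageD[of lookup])
  show "inj_on lookup {t. keys t \<subseteq> {1..n} \<and> mon_deg t \<le> m}"
    by (rule inj_onI) (simp only: lookup_inject)
  have "lookup t k \<le> mon_deg t" for t k
    by (cases "k \<in> keys t")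
      (use member_le_sum[of k "keys t" "lookup t"] in \<open>auto simp: mon_deg_def in_keys_iff\<close>)
  then have le: "lookup t k \<le> m" if "mon_deg t \<le> m" for t k
    using that le_trans by blast
  have "lookup ` {t. keys t \<subseteq> {1..n} \<and> mon_deg t \<le> m}
      \<subseteq> {f. \<forall>k. (k \<in> {1..n} \<longrightarrow> f k \<in> {..m}) \<and> (k \<notin> {1..n} \<longrightarrow> f k = 0)}"
    by (auto simp: in_keys_iff le simp del: atLeastAtMost_iff)
  then show "finite (lookup ` {t. keys t \<subseteq> {1..n} \<and> mon_deg t \<le> m})"
    by (rule finite_subset) (rule finite_set_of_finite_funs; simp)
qed

lemma lin_app_vec_scale: "lin_app r a (vec_scale c v) = vec_scale c (lin_app r a v)"
  by (simp add: lin_app_def vec_scale_def fun_eq_iff sum_distrib_left mult.assoc)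

lemma const_in_poly_ring: "const c \<in> poly_ring n"
  by (simp add: const_def poly_ring_def)

lemma homogeneous_const_mult: "homogeneous m p \<Longrightarrow> homogeneous m (const c * p)"
  by (auto simp: homogeneous_def in_keys_iff lookup_const_mult)

lemma tensor_comp_subspace:
  assumes "is_ideal n M"
  shows "module.subspace vec_scale (tensor_comp F M i j)"
proof -
  interpret vec: vector_space vec_scale by (rule vector_space_vec_scale)
  show ?thesis
    unfolding vec.subspace_def
  proof (intro conjI ballI allI)
    show "0 \<in> tensor_comp F M i j"
      using assms by (auto simp: is_ideal_def tensor_comp_def direct_power_def)
  next
    fix v w assume "v \<in> tensor_comp F M i j" "w \<in> tensor_comp F M i j"
    then show "v + w \<in> tensor_comp F M i j"
      using assms by (auto simp: is_ideal_def tensor_comp_def direct_power_def intro: homogeneous_add)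
  next
    fix c v assume "v \<in> tensor_comp F M i j"
    moreover have "const c * p \<in> M" if "p \<in> M" for p
    proof -
      have "p * const c \<in> M" using assms that const_in_poly_ring unfolding is_ideal_def by blast
      then show ?thesis by (simp add: mult.commute)
    qed
    ultimately show "vec_scale c v \<in> tensor_comp F M i j"
      by (auto simp: tensor_comp_def direct_power_def vec_scale_def intro: homogeneous_const_mult)
  qed
qed

text \<open>
  There are finitely many monomials of each degree in \<open>n\<close> variables.
\<close>

lemma tensor_comp_finite_dim:
  fixes M :: "'k::field mpoly set"
  assumes "M \<subseteq> poly_ring n"
  obtains T where "finite T" "tensor_comp F M i j \<subseteq> module.span vec_scale T"
proof -
  interpret vec: vector_space "vec_scale :: 'k \<Rightarrow> (nat \<Rightarrow> 'k mpoly) \<Rightarrow> _"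
    by (rule vector_space_vec_scale)
  define r where "r = fc_rank F i"
  define e where "e k t = (\<lambda>l. if l = k then single t 1 else 0 :: 'k mpoly)" for k :: nat and t
  define X where "X k = {t. keys t \<subseteq> {1..n} \<and> mon_deg t \<le> nat (j - fc_shift F i k)}" for k
  define T where "T = (\<Union>k<r. e k ` X k)"
  have "v \<in> vec.span T" if v: "v \<in> tensor_comp F M i j" for v
  proof -
    have keys: "t \<in> X k" if "k < r" "t \<in> keys (v k)" for k t
    proof -
      have "v k \<in> M" "homogeneous (j - fc_shift F i k) (v k)"
        using v that(1) by (auto simp: tensor_comp_def direct_power_def r_def)
      then have "v k \<in> poly_ring n" "int (mon_deg t) = j - fc_shift F i k"
        using assms that(2) by (auto simp: homogeneous_def)
      then show ?thesis using that(2) by (auto simp: X_def poly_ring_def)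
    qed
    have "v = (\<Sum>k<r. \<Sum>t\<in>keys (v k). vec_scale (lookup (v k) t) (e k t))"
    proof
      fix l
      have "(\<Sum>t\<in>keys (v k). vec_scale (lookup (v k) t) (e k t)) l = (if k = l then v k else 0)" for k
      proof (cases "k = l")
        case True
        have "(\<Sum>t\<in>keys (v k). vec_scale (lookup (v k) t) (e k t) l)
            = (\<Sum>t\<in>keys (v k). single t (lookup (v k) t))"
          using True by (simp add: vec_scale_def e_def const_def mult_single)
        also have "\<dots> = v k" by (rule mpoly_sum_monomials[symmetric])
        finally show ?thesis using True by (simp add: sum_fun_apply)
      qed (simp add: sum_fun_apply vec_scale_def e_def)
      then have "(\<Sum>k<r. \<Sum>t\<in>keys (v k). vec_scale (lookup (v k) t) (e k t)) l
          = (\<Sum>k<r. if k = l then v k else 0)"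
        by (simp only: sum_fun_apply[of _ "{..<r}"])
      also have "\<dots> = v l"
        using v by (auto simp: tensor_comp_def direct_power_def r_def)
      finally show "v l = (\<Sum>k<r. \<Sum>t\<in>keys (v k). vec_scale (lookup (v k) t) (e k t)) l" ..
    qed
    also have "\<dots> \<in> vec.span T"
      using keys by (intro vec.span_sum vec.span_scale vec.span_base) (auto simp: T_def)
    finally show ?thesis .
  qed
  moreover have "finite T" unfolding T_def X_def using finite_monomials by auto
  ultimately show thesis using that[of T] by blast
qed

lemma tensor_boundaries_subset_cycles:
  assumes "graded_free_resolution n F" "is_ideal n M"
  shows "tensor_boundaries F M i j \<subseteq> tensor_cycles F M i j"
proof
  fix v assume "v \<in> tensor_boundaries F M i j"
  then obtain w where w: "w \<in> tensor_comp F M (Suc i) j" "v = fc_diff F (Suc i) w"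
    by (auto simp: tensor_boundaries_def)
  have "v \<in> tensor_comp F M i j"
    unfolding w(2) fc_diff_lin_app
    by (rule tensor_comp_lin_app[OF assms(2) w(1) diff_row_tensor_comp[OF assms(1)]])
  then show "v \<in> tensor_cycles F M i j"
    using fc_diff_fc_diff[OF assms(1)] by (simp add: tensor_cycles_def w(2))
qed

text \<open>
  Betti numbers are defined through an arbitrary resolution.  Since only their vanishing matters
  here, it is enough to compare acyclicity in each bidegree with that of the Koszul complex.
\<close>

lemma betti_neq_0_iff:
  fixes M :: "'k::field mpoly set"
  assumes M: "is_ideal n M"
  shows "betti n M i j \<noteq> 0 \<longleftrightarrow>
    \<not> tensor_cycles (koszul n) M i j \<subseteq> tensor_boundaries (koszul n) M i j"
proof -
  interpret vec: vector_space "vec_scale :: 'k \<Rightarrow> (nat \<Rightarrow> 'k mpoly) \<Rightarrow> _"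
    by (rule vector_space_vec_scale)
  define F :: "'k free_complex" where "F = (SOME F. graded_free_resolution n F)"
  have F: "graded_free_resolution n F"
    unfolding F_def by (rule someI[where P = "graded_free_resolution n", OF koszul_graded_free_resolution])
  obtain T where T: "finite T" "tensor_comp F M i j \<subseteq> vec.span T"
    using tensor_comp_finite_dim M unfolding is_ideal_def by metis
  have sub: "vec.subspace (tensor_boundaries F M i j)"
  proof -
    have sub: "vec.subspace (tensor_comp F M (Suc i) j)" by (rule tensor_comp_subspace[OF M])
    show ?thesis
      unfolding vec.subspace_def
    proof (intro conjI ballI allI)
      show "0 \<in> tensor_boundaries F M i j"
        using vec.subspace_0[OF sub]
        by (auto simp: tensor_boundaries_def fc_diff_lin_app intro!: image_eqI[of _ _ 0])
    next
      fix v w assume "v \<in> tensor_boundaries F M i j" "w \<in> tensor_boundaries F M i j"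
      then obtain v' w' where "v' \<in> tensor_comp F M (Suc i) j" "w' \<in> tensor_comp F M (Suc i) j"
        "v = fc_diff F (Suc i) v'" "w = fc_diff F (Suc i) w'"
        by (auto simp: tensor_boundaries_def)
      then show "v + w \<in> tensor_boundaries F M i j"
        using vec.subspace_add[OF sub]
        by (auto simp: tensor_boundaries_def fc_diff_lin_app intro!: image_eqI[of _ _ "v' + w'"] lin_app_add[symmetric])
    next
      fix c v assume "v \<in> tensor_boundaries F M i j"
      then obtain v' where "v' \<in> tensor_comp F M (Suc i) j" "v = fc_diff F (Suc i) v'"
        by (auto simp: tensor_boundaries_def)
      then show "vec_scale c v \<in> tensor_boundaries F M i j"
        using vec.subspace_scale[OF sub]
        by (auto simp: tensor_boundaries_def fc_diff_lin_app intro!: image_eqI[of _ _ "vec_scale c v'"] lin_app_vec_scale[symmetric])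
    qed
  qed
  have "tensor_cycles F M i j \<subseteq> vec.span T"
    using T(2) by (auto simp: tensor_cycles_def)
  then have "betti n M i j \<noteq> 0 \<longleftrightarrow> \<not> tensor_cycles F M i j \<subseteq> tensor_boundaries F M i j"
    unfolding betti_def Let_def F_def[symmetric]
    by (rule vec.dim_diff_neq_0_iff[OF sub tensor_boundaries_subset_cycles[OF F M] _ T(1)])
  also have "\<dots> \<longleftrightarrow> \<not> tensor_cycles (koszul n) M i j \<subseteq> tensor_boundaries (koszul n) M i j"
    using acyclicity_independent[OF F koszul_graded_free_resolution M]
      acyclicity_independent[OF koszul_graded_free_resolution F M] by blast
  finally show ?thesis .
qed


section \<open>Squarefree monomial ideals\<close>

definition has_generator :: "nat set set \<Rightarrow> (nat \<Rightarrow>\<^sub>0 nat) \<Rightarrow> bool" where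
  "has_generator T t \<longleftrightarrow> (\<exists>A\<in>T. A \<subseteq> keys t)"

lemma ideal_generated_add:
  assumes "p \<in> ideal_generated n G" "q \<in> ideal_generated n G"
  shows "p + q \<in> ideal_generated n G"
proof -
  obtain a b where "p = (\<Sum>g\<in>G. a g * g)" "q = (\<Sum>g\<in>G. b g * g)"
    "\<forall>g\<in>G. a g \<in> poly_ring n" "\<forall>g\<in>G. b g \<in> poly_ring n"
    using assms by (auto simp: ideal_generated_def)
  then have "p + q = (\<Sum>g\<in>G. (a g + b g) * g)" "\<forall>g\<in>G. a g + b g \<in> poly_ring n"
    by (auto simp: distrib_right sum.distrib intro: poly_ring_add)
  then show ?thesis unfolding ideal_generated_def
    by (intro CollectI exI[of _ "\<lambda>g. a g + b g"] conjI)
qed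

lemma ideal_generated_0: "0 \<in> ideal_generated n G"
  unfolding ideal_generated_def by (intro CollectI exI[of _ "\<lambda>_. 0"]) simp

lemma ideal_generated_multiple:
  assumes "finite G" "g \<in> G" "q \<in> poly_ring n"
  shows "q * g \<in> ideal_generated n G"
proof -
  have "(\<Sum>g'\<in>G. (if g' = g then q else 0) * g') = (\<Sum>g'\<in>G. if g' = g then q * g' else 0)"
    by (rule sum.cong) auto
  then have "q * g = (\<Sum>g'\<in>G. (if g' = g then q else 0) * g')"
    using assms by (simp add: sum.delta)
  then show ?thesis unfolding ideal_generated_def
    using assms(3) by (intro CollectI exI[of _ "\<lambda>g'. if g' = g then q else 0"]) auto
qed

lemma circuit_ideal_eq:
  assumes T: "T \<subseteq> nsets {1..n} d"
  shows "(circuit_ideal n T :: 'k::field mpoly set)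
    = {p \<in> poly_ring n. \<forall>t\<in>keys p. has_generator T t}" (is "?L = ?R")
proof
  let ?x = "\<lambda>A. \<Prod>k\<in>A. var k :: 'k mpoly"
  have A: "finite A" "A \<subseteq> {1..n}" if "A \<in> T" for A
    using T that by (auto simp: nsets_def)
  have finT: "finite T"
    using T finite_imp_finite_nsets[of "{1..n}"] finite_subset by blast
  show "?L \<subseteq> ?R"
  proof
    fix p assume "p \<in> ?L"
    then obtain q where p: "p = (\<Sum>g\<in>?x ` T. q g * g)" and q: "\<forall>g\<in>?x ` T. q g \<in> poly_ring n"
      by (auto simp: circuit_ideal_def ideal_generated_def)
    have "q (?x A) * ?x A \<in> poly_ring n" if "A \<in> T" for A
      using q A[OF that] that
      by (intro poly_ring_mult) (auto simp: prod_var poly_ring_def)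
    then have "p \<in> poly_ring n" unfolding p by (intro poly_ring_sum) auto
    moreover have "has_generator T t" if "t \<in> keys p" for t
    proof -
      have "t \<in> (\<Union>g\<in>?x ` T. keys (q g * g))"
        using that keys_sum[of "\<lambda>g. q g * g" "?x ` T"] by (auto simp: p)
      then obtain B where B: "B \<in> T" "t \<in> keys (q (?x B) * ?x B)" by blast
      then obtain s where "t = s + sqfree_mon B"
        using keys_mult[of "q (?x B)" "?x B"] A[OF B(1)] by (auto simp: prod_var)
      then show ?thesis
        using B(1) sqfree_mon_subset_keys_add[OF A(1)[OF B(1)], of s] by (auto simp: has_generator_def)
    qed
    ultimately show "p \<in> ?R" by blast
  qed
  show "?R \<subseteq> ?L"
  proof
    fix p assume p: "p \<in> ?R"
    have "single t (lookup p t) \<in> ?L" if t: "t \<in> keys p" for t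
    proof -
      obtain B where B: "B \<in> T" "B \<subseteq> keys t" using p t by (auto simp: has_generator_def)
      have "single t (lookup p t) = single (t - sqfree_mon B) (lookup p t) * ?x B"
        using A[OF B(1)] B(2) by (simp add: prod_var mult_single minus_sqfree_mon_add)
      moreover have "keys (t - sqfree_mon B) \<subseteq> keys t"
        by (auto simp: in_keys_iff lookup_mon_minus)
      then have "single (t - sqfree_mon B) (lookup p t) \<in> poly_ring n"
        using p t by (auto simp: poly_ring_def split: if_splits)
      ultimately show ?thesis
        unfolding circuit_ideal_def using ideal_generated_multiple[of "?x ` T" "?x B"] finT B(1) by simp
    qed
    then have "(\<Sum>t\<in>A. single t (lookup p t)) \<in> ?L" if "A \<subseteq> keys p" for A
      using that
      by (induction A rule: infinite_finite_induct)
        (auto simp: circuit_ideal_def ideal_generated_0 intro: ideal_generated_add)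
    from this[of "keys p"] show "p \<in> ?L" using mpoly_sum_monomials[of p] by simp
  qed
qed

lemma is_ideal_circuit_ideal:
  assumes "T \<subseteq> nsets {1..n} d"
  shows "is_ideal n (circuit_ideal n T :: 'k::field mpoly set)"
  unfolding circuit_ideal_eq[OF assms] is_ideal_def
proof (intro conjI ballI)
  fix p q :: "'k mpoly"
  assume p: "p \<in> {p \<in> poly_ring n. \<forall>t\<in>keys p. has_generator T t}" and q: "q \<in> poly_ring n"
  have "has_generator T t" if "t \<in> keys (p * q)" for t
  proof -
    obtain s u where su: "t = s + u" "s \<in> keys p" using keys_mult[of p q] \<open>t \<in> _\<close> by blast
    then obtain A where "A \<in> T" "A \<subseteq> keys s" using p by (auto simp: has_generator_def)
    moreover have "keys s \<subseteq> keys t" by (auto simp: su in_keys_iff lookup_add)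
    ultimately show ?thesis by (auto simp: has_generator_def)
  qed
  then show "p * q \<in> {p \<in> poly_ring n. \<forall>t\<in>keys p. has_generator T t}"
    using p q by (auto intro: poly_ring_mult)
next
  fix p q :: "'k mpoly"
  assume "p \<in> {p \<in> poly_ring n. \<forall>t\<in>keys p. has_generator T t}"
    "q \<in> {p \<in> poly_ring n. \<forall>t\<in>keys p. has_generator T t}"
  then show "p + q \<in> {p \<in> poly_ring n. \<forall>t\<in>keys p. has_generator T t}"
    using keys_add[of p q] by (auto intro: poly_ring_add)
qed auto

lemma card_keys_le_mon_deg: "card (keys t) \<le> mon_deg t"
proof -
  have "(\<Sum>k\<in>keys t. 1) \<le> (\<Sum>k\<in>keys t. lookup t k)"
    by (rule sum_mono) (auto simp: in_keys_iff Suc_le_eq)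
  then show ?thesis by (simp add: mon_deg_def)
qed

lemma has_generator_mon_deg:
  assumes "T \<subseteq> nsets {1..n} d" "has_generator T t"
  shows "d \<le> mon_deg t"
proof -
  obtain A where A: "A \<in> T" "A \<subseteq> keys t" using assms by (auto simp: has_generator_def)
  then have "card A = d" using assms by (auto simp: nsets_def)
  then have "d \<le> card (keys t)" using card_mono[OF finite_keys A(2)] by simp
  then show ?thesis using card_keys_le_mon_deg[of t] by simp
qed

lemma circuit_in_ideal:
  assumes "T \<subseteq> nsets {1..n} d" "A \<in> T"
  shows "single (sqfree_mon A) 1 \<in> (circuit_ideal n T :: 'k::field mpoly set)"
proof -
  have "finite A" "A \<subseteq> {1..n}" using assms by (auto simp: nsets_def)
  then show ?thesis
    using assms(2) by (auto simp: circuit_ideal_eq[OF assms(1)] poly_ring_def has_generator_def)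
qed

lemma circuit_ideal_neq_0:
  assumes "T \<subseteq> nsets {1..n} d" "T \<noteq> {}"
  shows "(circuit_ideal n T :: 'k::field mpoly set) \<noteq> {0}"
proof -
  obtain A where "A \<in> T" using assms by blast
  from circuit_in_ideal[OF assms(1) this] have "single (sqfree_mon A) (1::'k) \<in> circuit_ideal n T" .
  moreover have "single (sqfree_mon A) (1::'k) \<noteq> 0"
    by (metis lookup_single_eq lookup_zero zero_neq_one)
  ultimately show ?thesis by auto
qed

lemma indeg_circuit_ideal:
  assumes T: "T \<subseteq> nsets {1..n} d" "T \<noteq> {}"
  shows "indeg (circuit_ideal n T :: 'k::field mpoly set) = ereal (real d)"
  unfolding indeg_def
proof (rule antisym)
  let ?I = "circuit_ideal n T :: 'k mpoly set"
  let ?S = "{ereal (real_of_int i) | i. \<exists>p\<in>?I. p \<noteq> 0 \<and> homogeneous i p}"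
  obtain A where A: "A \<in> T" using T by blast
  let ?p = "single (sqfree_mon A) 1 :: 'k mpoly"
  have "finite A" "card A = d" using A T by (auto simp: nsets_def)
  then have "homogeneous (int d) ?p" by (simp add: homogeneous_def mon_deg_sqfree_mon)
  moreover have "?p \<noteq> 0" by (metis lookup_single_eq lookup_zero zero_neq_one)
  moreover have "?p \<in> ?I" by (rule circuit_in_ideal[OF T(1) A])
  ultimately have "ereal (real_of_int (int d)) \<in> ?S" by blast
  from Inf_lower[OF this] show "Inf ?S \<le> ereal (real d)" by simp
  show "ereal (real d) \<le> Inf ?S"
  proof (rule Inf_greatest)
    fix x assume "x \<in> ?S"
    then obtain i p where p: "x = ereal (real_of_int i)" "p \<in> ?I" "p \<noteq> 0" "homogeneous i p" by blast
    from p(3) obtain t where t: "t \<in> keys p"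
      by (metis in_keys_iff lookup_zero poly_mapping_eqI)
    then have "int (mon_deg t) = i" "has_generator T t"
      using p(2,4) unfolding homogeneous_def circuit_ideal_eq[OF T(1)] by blast+
    then have "int d \<le> i" using has_generator_mon_deg[OF T(1)] by auto
    then show "ereal (real d) \<le> x" using p(1) by simp
  qed
qed


section \<open>Linear resolutions and simplicial cycles\<close>

lemma clutter_cycle_extend:
  assumes "finite C" "C' \<subseteq> C" "clutter_cycle d C' z"
  shows "clutter_cycle d C (\<lambda>F. if F \<in> C' then z F else 0)"
  unfolding clutter_cycle_def
proof (intro allI impI)
  fix e :: "nat set" assume "card e = d - 1"
  have "(\<Sum>F\<in>{F \<in> C. e \<subseteq> F}. (if F \<in> C' then z F else 0) * vertex_sign (the_elem (F - e)) F)
      = (\<Sum>F\<in>{F \<in> C'. e \<subseteq> F}. z F * vertex_sign (the_elem (F - e)) F)"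
    using assms(1,2) by (intro sum.mono_neutral_cong_right) auto
  also have "\<dots> = 0" using assms(3) \<open>card e = d - 1\<close> by (simp add: clutter_cycle_def)
  finally show "(\<Sum>F\<in>{F \<in> C. e \<subseteq> F}. (if F \<in> C' then z F else 0) * vertex_sign (the_elem (F - e)) F) = 0" .
qed

text \<open>
  A set of more than \<open>d\<close> vertices is not a clique, so it contains the support of a generator.
\<close>

lemma has_generator_large_support:
  assumes noclique: "\<forall>V\<in>nsets {1..n} (d + 1). \<not> nsets V d \<subseteq> C"
    and t: "keys t \<subseteq> {1..n}" "d + 1 \<le> card (keys t)"
  shows "has_generator (complement_clutter n d C) t"
proof -
  obtain V where V: "V \<subseteq> keys t" "card V = d + 1" "finite V"
    using obtain_subset_with_card_n[OF t(2)] by blast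
  then have "V \<in> nsets {1..n} (d + 1)" using t(1) by (auto simp: nsets_def)
  then obtain A where "A \<in> nsets V d" "A \<notin> C" using noclique by blast
  then show ?thesis
    using V(1) t(1) unfolding has_generator_def complement_clutter_def nsets_def by blast
qed

lemma keys_minus_sqfree_mon:
  assumes "finite s" "s \<subseteq> keys a" "\<And>k. lookup a k \<le> 1"
  shows "keys (a - sqfree_mon s) = keys a - s"
proof -
  have "lookup a k - 1 = 0" for k using assms(3)[of k] by simp
  then show ?thesis
    using assms(1) by (auto simp: in_keys_iff lookup_mon_minus lookup_sqfree_mon split: if_splits)
qed

text \<open>
  Vanishing of \<open>Tor\<^sub>i\<close> in degree \<open>j > i + d\<close>, one fine degree \<open>a\<close> at a time.  If \<open>a\<close> is not squarefree,
  a cone over a repeated variable contracts.  If \<open>a\<close> is the product of the variables in \<open>W\<close>, the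
  coefficients of the cycle are supported on sets of \<open>j - i \<ge> d + 1\<close> vertices, and those of its cone
  on sets with one vertex less.  The latter all lie in the ideal when \<open>j - i > d + 1\<close>; when
  \<open>j - i = d + 1\<close>, the coefficients on circuits have to be cancelled, which is possible by
  \<open>bd_onto_clutter\<close>.
\<close>

lemma koszul_circuit_ideal_acyclic:
  fixes n d :: nat and C :: "nat set set"
  defines "I \<equiv> circuit_ideal n (complement_clutter n d C) :: 'k::field mpoly set"
  assumes d: "d \<ge> 1" and C: "C \<subseteq> nsets {1..n} d"
    and noclique: "\<forall>V\<in>nsets {1..n} (d + 1). \<not> nsets V d \<subseteq> C"
    and acyclic: "\<And>z :: nat set \<Rightarrow> 'k. clutter_cycle d C z \<Longrightarrow> \<forall>F\<in>C. z F = 0"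
    and ij: "j - int i > int d"
  shows "tensor_cycles (koszul n) I i j \<subseteq> tensor_boundaries (koszul n) I i j"
proof
  let ?T = "complement_clutter n d C"
  let ?gen = "has_generator ?T"
  have T: "?T \<subseteq> nsets {1..n} d" by (auto simp: complement_clutter_def)
  have I: "I = {p \<in> poly_ring n. \<forall>t\<in>keys p. ?gen t}"
    unfolding I_def by (rule circuit_ideal_eq[OF T])
  fix v assume "v \<in> tensor_cycles (koszul n) I i j"
  then have v: "v \<in> tensor_comp (koszul n) I i j" "fc_diff (koszul n) i v = 0"
    by (auto simp: tensor_cycles_def)
  then obtain u where u: "v = vec_of n i u"
    "\<And>s. s \<in> nsets {1..n} i \<Longrightarrow> u s \<in> I \<and> homogeneous (j - int i) (u s)"
    by (auto simp: tensor_comp_koszul)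
  then have u_ring: "\<And>s. s \<in> nsets {1..n} i \<Longrightarrow> u s \<in> poly_ring n"
    and u_gen: "\<And>s t. s \<in> nsets {1..n} i \<Longrightarrow> t \<in> keys (u s) \<Longrightarrow> ?gen t"
    and u_hom: "\<And>s t. s \<in> nsets {1..n} i \<Longrightarrow> t \<in> keys (u s) \<Longrightarrow> int (mon_deg t) = j - int i"
    by (auto simp: I homogeneous_def)
  have kos_0: "kos var {1..n} u r = 0" if "r \<in> nsets {1..n} (i - 1)" "i \<ge> 1" for r
    using v(2) that fc_diff_koszul[of n "i - 1" u] by (simp add: u(1) vec_of_eq_0_iff)
  have deg_a: "int (mon_deg a) = j" and keys_a: "keys a \<subseteq> {1..n}" if a: "a \<in> fine_degrees n i u" for a
  proof -
    obtain s t where st: "s \<in> nsets {1..n} i" "t \<in> keys (u s)" "a = t + sqfree_mon s"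
      using a by (auto simp: fine_degrees_def)
    have s: "finite s" "card s = i" "s \<subseteq> {1..n}" using st(1) by (auto simp: nsets_def)
    show "int (mon_deg a) = j"
      using u_hom[OF st(1,2)] s by (simp add: st(3) mon_deg_add mon_deg_sqfree_mon)
    have "keys t \<subseteq> {1..n}" using u_ring[OF st(1)] st(2) by (auto simp: poly_ring_def)
    then show "keys a \<subseteq> {1..n}" using st(3) keys_add[of t "sqfree_mon s"] s by auto
  qed
  have fine: "\<exists>g. (\<forall>s\<in>nsets {1..n} (Suc i). g s \<noteq> 0 \<longrightarrow> s \<subseteq> keys a \<and> a - sqfree_mon s \<in> {t. ?gen t}) \<and>
      (\<forall>s\<in>nsets {1..n} i. s \<subseteq> keys a \<longrightarrow> bd (keys a) g s = fine_part u a s)"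
    if a: "a \<in> fine_degrees n i u" for a
  proof -
    define f where "f = fine_part u a"
    have bd_cone_f: "bd (keys a) (cone k f) s = f s"
      if "k \<in> keys a" "s \<in> nsets {1..n} i" "s \<subseteq> keys a" for k s
      unfolding f_def by (rule bd_fine_part_cycle[OF u_ring kos_0 a that(2,3,1)])
    have cone_f: "k \<in> s" "s \<subseteq> keys a" "?gen (a - sqfree_mon (s - {k}))"
      if k: "k \<in> keys a" and s: "s \<in> nsets {1..n} (Suc i)" and "cone k f s \<noteq> 0" for k s
    proof -
      show ks: "k \<in> s" using that by (auto simp: cone_def split: if_splits)
      have f: "f (s - {k}) \<noteq> 0" using that by (auto simp: cone_def split: if_splits)
      then show "s \<subseteq> keys a" using k by (auto simp: f_def fine_part_def split: if_splits)
      have "s - {k} \<in> nsets {1..n} i" using s ks by (auto simp: nsets_def)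
      moreover have "a - sqfree_mon (s - {k}) \<in> keys (u (s - {k}))"
        using f by (auto simp: f_def fine_part_def in_keys_iff split: if_splits)
      ultimately show "?gen (a - sqfree_mon (s - {k}))" by (rule u_gen)
    qed
    show ?thesis
    proof (cases "\<exists>k. lookup a k \<ge> 2")
      case True
      \<comment> \<open>Moving \<open>x\<^sub>k\<close> into the exterior part does not change the support of the coefficient.\<close>
      then obtain k where k2: "lookup a k \<ge> 2" by blast
      then have k: "k \<in> keys a" by (simp add: in_keys_iff)
      have "s \<subseteq> keys a \<and> ?gen (a - sqfree_mon s)"
        if s: "s \<in> nsets {1..n} (Suc i)" "cone k f s \<noteq> 0" for s
      proof -
        have "finite s" using s by (simp add: nsets_def)
        then have "keys (a - sqfree_mon (s - {k})) \<subseteq> keys (a - sqfree_mon s)"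
          using k2 by (auto simp: in_keys_iff lookup_mon_minus lookup_sqfree_mon split: if_splits)
        then show ?thesis using cone_f[OF k s] unfolding has_generator_def by blast
      qed
      then show ?thesis using bd_cone_f[OF k] unfolding f_def by (intro exI[of _ "cone k f"]) (simp add: f_def)
    next
      case False
      then have sqfree: "lookup a k \<le> 1" for k by (metis Suc_1 not_less_eq_eq One_nat_def)
      define W where "W = keys a"
      have W: "finite W" "W \<subseteq> {1..n}" using keys_a[OF a] by (auto simp: W_def)
      have "mon_deg a = (\<Sum>k\<in>W. 1)"
        unfolding mon_deg_def W_def
      proof (rule sum.cong)
        fix k assume "k \<in> keys a"
        then show "lookup a k = 1" using sqfree[of k] by (simp add: in_keys_iff)
      qed simp
      then have cardW: "int (card W) = j" using deg_a[OF a] by simp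
      have keys_minus: "keys (a - sqfree_mon s) = W - s" if "s \<subseteq> W" for s
        using keys_minus_sqfree_mon[OF finite_subset[OF that W(1)], of a] that sqfree
        by (simp add: W_def)
      have card_minus: "int (card (W - s)) = j - int (Suc i)" if "s \<in> nsets {1..n} (Suc i)" "s \<subseteq> W" for s
      proof -
        have "finite s" "card s = Suc i" using that(1) by (auto simp: nsets_def)
        then have "card W = card (W - s) + Suc i"
          using card_Diff_subset[OF _ that(2)] card_mono[OF W(1) that(2)] by simp
        then show ?thesis using cardW by simp
      qed
      have "W \<noteq> {}" using cardW ij by auto
      then obtain k where k: "k \<in> keys a" unfolding W_def by blast
      show ?thesis
      proof (cases "j - int i \<ge> int d + 2")
        case True
        \<comment> \<open>The coefficients of the cone are supported on at least \<open>d + 1\<close> vertices.\<close>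
        have "s \<subseteq> keys a \<and> ?gen (a - sqfree_mon s)"
          if s: "s \<in> nsets {1..n} (Suc i)" "cone k f s \<noteq> 0" for s
        proof -
          have sW: "s \<subseteq> W" using cone_f(2)[OF k s] by (simp add: W_def)
          have "d + 1 \<le> card (keys (a - sqfree_mon s))"
            using card_minus[OF s(1) sW] True by (simp add: keys_minus[OF sW])
          then have "?gen (a - sqfree_mon s)"
            using W(2) keys_minus[OF sW] by (intro has_generator_large_support[OF noclique]) auto
          then show ?thesis using sW by (simp add: W_def)
        qed
        then show ?thesis using bd_cone_f[OF k] unfolding f_def by (intro exI[of _ "cone k f"]) (simp add: f_def)
      next
        case False
        then have jid: "j = int i + int d + 1" using ij by simp
        define CW where "CW = {F \<in> C. F \<subseteq> W}"
        have CW: "CW \<subseteq> nsets W d" using C by (auto simp: CW_def nsets_def)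
        have finC: "finite C" using C finite_imp_finite_nsets[of "{1..n}"] finite_subset by blast
        \<comment> \<open>The cone may have coefficients supported on circuits.  Subtracting the boundary of a
          suitable \<open>y\<close> removes them and leaves the boundary of the cone unchanged.\<close>
        have "\<forall>F\<in>CW. z F = 0" if z: "clutter_cycle d CW z" for z :: "nat set \<Rightarrow> 'k"
        proof -
          have "\<forall>F\<in>C. (if F \<in> CW then z F else 0) = 0"
            by (rule acyclic, rule clutter_cycle_extend[OF finC _ z]) (auto simp: CW_def)
          then show ?thesis by (auto simp: CW_def)
        qed
        from bd_onto_clutter[OF W(1) CW d this, of "\<lambda>F. cone k f (W - F)"]
        obtain y where y: "\<forall>F\<in>CW. bd W y (W - F) = cone k f (W - F)" by blast
        define g where "g s = (if s \<subseteq> W then cone k f s - bd W y s else 0)" for s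
        have "s \<subseteq> keys a \<and> ?gen (a - sqfree_mon s)"
          if s: "s \<in> nsets {1..n} (Suc i)" "g s \<noteq> 0" for s
        proof -
          have sW: "s \<subseteq> W" using s(2) by (auto simp: g_def split: if_splits)
          have "int (card (W - s)) = int d" using card_minus[OF s(1) sW] jid by simp
          then have Ws: "W - s \<in> nsets {1..n} d" using W by (auto simp: nsets_def)
          have "W - (W - s) = s" using sW by auto
          then have "W - s \<notin> C" using y s(2) by (auto simp: g_def CW_def split: if_splits)
          with Ws have "W - s \<in> ?T" by (simp add: complement_clutter_def)
          then have "?gen (a - sqfree_mon s)"
            using keys_minus[OF sW] by (auto simp: has_generator_def)
          then show ?thesis using sW by (simp add: W_def)
        qed
        moreover have "bd W g s = f s" if s: "s \<in> nsets {1..n} i" "s \<subseteq> W" for s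
        proof -
          have "bd W g s = bd W (\<lambda>s. cone k f s - bd W y s) s"
            by (rule kos_cong) (use s in \<open>auto simp: g_def\<close>)
          also have "\<dots> = bd W (cone k f) s - bd W (bd W y) s" by (rule kos_diff)
          also have "bd W (bd W y) s = 0"
            using s by (intro kos_kos[OF W(1)]) (simp add: nsets_def)
          also have "bd W (cone k f) s = f s" using bd_cone_f[OF k] s by (simp add: W_def)
          finally show ?thesis by simp
        qed
        ultimately show ?thesis
          by (intro exI[of _ g]) (simp add: f_def W_def)
      qed
    qed
  qed
  show "v \<in> tensor_boundaries (koszul n) I i j"
  proof (rule koszul_exact_finely_graded[OF u_ring fine])
    fix w assume w: "\<And>s t. s \<in> nsets {1..n} (Suc i) \<Longrightarrow> t \<in> keys (w s) \<Longrightarrow>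
        t \<in> {t. ?gen t} \<and> (\<exists>a\<in>fine_degrees n i u. s \<subseteq> keys a \<and> t = a - sqfree_mon s)"
      "\<And>s. s \<in> nsets {1..n} (Suc i) \<Longrightarrow> w s \<in> poly_ring n"
      "\<And>s. s \<in> nsets {1..n} i \<Longrightarrow> kos var {1..n} w s = u s"
    have "w s \<in> I \<and> homogeneous (j - int (Suc i)) (w s)" if s: "s \<in> nsets {1..n} (Suc i)" for s
    proof
      show "w s \<in> I" using w(1,2)[OF s] by (auto simp: I)
      show "homogeneous (j - int (Suc i)) (w s)"
        unfolding homogeneous_def
      proof
        fix t assume "t \<in> keys (w s)"
        then obtain a where a: "a \<in> fine_degrees n i u" "s \<subseteq> keys a" "t = a - sqfree_mon s"
          using w(1)[OF s] by blast
        have "finite s" "card s = Suc i" using s by (auto simp: nsets_def)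
        then show "int (mon_deg t) = j - int (Suc i)"
          using mon_deg_minus_sqfree_mon[OF _ a(2)] deg_a[OF a(1)] by (simp add: a(3))
      qed
    qed
    then have "vec_of n (Suc i) w \<in> tensor_comp (koszul n) I (Suc i) j"
      by (auto simp: tensor_comp_koszul)
    moreover have "v = fc_diff (koszul n) (Suc i) (vec_of n (Suc i) w)"
      unfolding u(1) fc_diff_koszul by (rule vec_of_cong) (rule w(3)[symmetric])
    ultimately show "v \<in> tensor_boundaries (koszul n) I i j" by (auto simp: tensor_boundaries_def)
  qed
qed

text \<open>
  The class of a generator is nonzero because the ideal vanishes in degree \<open>d - 1\<close>.
\<close>

lemma koszul_circuit_ideal_generators:
  assumes T: "T \<subseteq> nsets {1..n} d" "T \<noteq> {}"
  shows "\<not> tensor_cycles (koszul n) (circuit_ideal n T :: 'k::field mpoly set) 0 (int d)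
    \<subseteq> tensor_boundaries (koszul n) (circuit_ideal n T) 0 (int d)"
proof
  let ?I = "circuit_ideal n T :: 'k mpoly set"
  assume sub: "tensor_cycles (koszul n) ?I 0 (int d) \<subseteq> tensor_boundaries (koszul n) ?I 0 (int d)"
  obtain A where A: "A \<in> T" using T by blast
  have "finite A" "card A = d" using A T by (auto simp: nsets_def)
  then have "homogeneous (int d) (single (sqfree_mon A) 1 :: 'k mpoly)"
    by (simp add: homogeneous_def mon_deg_sqfree_mon)
  then have "vec_of n 0 (\<lambda>_. single (sqfree_mon A) 1) \<in> tensor_cycles (koszul n) ?I 0 (int d)"
    using circuit_in_ideal[OF T(1) A] by (auto simp: tensor_cycles_def tensor_comp_koszul)
  with sub obtain w where w: "\<forall>s\<in>nsets {1..n} (Suc 0). w s \<in> ?I \<and> homogeneous (int d - int (Suc 0)) (w s)"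
    "vec_of n 0 (\<lambda>_. single (sqfree_mon A) 1) = fc_diff (koszul n) (Suc 0) (vec_of n (Suc 0) w)"
    by (auto simp: tensor_boundaries_def tensor_comp_koszul)
  have "w s = 0" if s: "s \<in> nsets {1..n} (Suc 0)" for s
  proof (rule ccontr)
    assume "w s \<noteq> 0"
    then obtain t where t: "t \<in> keys (w s)" by (metis in_keys_iff lookup_zero poly_mapping_eqI)
    then have "has_generator T t" "int (mon_deg t) = int d - 1"
      using w(1) s by (auto simp: circuit_ideal_eq[OF T(1)] homogeneous_def)
    then show False using has_generator_mon_deg[OF T(1)] by fastforce
  qed
  then have "kos var {1..n} w {} = kos var {1..n} (\<lambda>_. 0) {}"
    by (intro kos_cong) (auto simp: nsets_def)
  moreover have "vec_of n 0 (\<lambda>s. single (sqfree_mon A) 1 - kos var {1..n} w s) = 0"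
    using w(2) by (simp add: fc_diff_koszul vec_of_diff[symmetric])
  ultimately have "single (sqfree_mon A) (1::'k) = 0"
    by (simp add: vec_of_eq_0_iff nsets_0)
  then show False by (metis lookup_single_eq lookup_zero zero_neq_one)
qed

text \<open>
  A scalar chain, placed in the fine degree of the product of the variables in \<open>W\<close>.
\<close>

lemma kos_var_sqfree:
  assumes W: "finite W" "r \<subseteq> W"
  shows "kos var W (\<lambda>s. single (sqfree_mon (W - s)) (c s)) r
    = single (sqfree_mon (W - r)) (bd W c r :: 'k::field)"
proof -
  have "vertex_sign k r * var k * single (sqfree_mon (W - insert k r)) (c (insert k r))
      = single (sqfree_mon (W - r)) (vertex_sign k r * 1 * c (insert k r))" if k: "k \<in> W - r" for k
  proof -
    have "sqfree_mon (insert k (W - insert k r)) = single k 1 + sqfree_mon (W - insert k r)"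
      unfolding sqfree_mon_def using W by simp
    moreover have "insert k (W - insert k r) = W - r" using k by auto
    ultimately have "sqfree_mon (W - r) = single k 1 + sqfree_mon (W - insert k r)" by simp
    moreover have "vertex_sign k r * single t b = single t (vertex_sign k r * b :: 'k)" for t b
      by (cases "even (card {u \<in> r. u < k})") (auto simp: vertex_sign_def single_uminus)
    ultimately show ?thesis by (simp add: var_def mult.assoc mult_single)
  qed
  then have "kos var W (\<lambda>s. single (sqfree_mon (W - s)) (c s)) r
      = (\<Sum>k\<in>W - r. single (sqfree_mon (W - r)) (vertex_sign k r * 1 * c (insert k r)))"
    unfolding kos_def by (intro sum.cong) auto
  also have "\<dots> = single (sqfree_mon (W - r)) (bd W c r)"
    by (rule poly_mapping_eqI) (simp add: lookup_sum lookup_single when_def kos_def)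
  finally show ?thesis .
qed

text \<open>
  The coboundary of the indicator function \<open>f\<close> of the circuit \<open>G\<close> is supported on nonfaces, so it
  gives a Koszul cycle with coefficients in the ideal.  If it were the boundary of a chain with
  coefficients in the ideal, i.e. the coboundary of a cochain \<open>y\<close> vanishing on \<open>C\<close>, then \<open>f - y\<close>
  would be a cocycle of the full simplex, hence a coboundary, and its pairing with the cycle \<open>z\<close>
  would be zero.  But this pairing is \<open>z G\<close> up to sign.
\<close>

lemma koszul_circuit_ideal_not_acyclic:
  fixes n d :: nat and C :: "nat set set" and z :: "nat set \<Rightarrow> 'k::field"
  defines "I \<equiv> circuit_ideal n (complement_clutter n d C) :: 'k mpoly set"
  assumes d: "d \<ge> 1" and C: "C \<subseteq> nsets {1..n} d" and n: "n = i + d + 1"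
    and noclique: "\<forall>V\<in>nsets {1..n} (d + 1). \<not> nsets V d \<subseteq> C"
    and z: "clutter_cycle d C z" "G \<in> C" "z G \<noteq> 0"
  shows "\<not> tensor_cycles (koszul n) I i (int n) \<subseteq> tensor_boundaries (koszul n) I i (int n)"
proof
  assume sub: "tensor_cycles (koszul n) I i (int n) \<subseteq> tensor_boundaries (koszul n) I i (int n)"
  define W where "W = {1..n}"
  have W: "finite W" "card W = n" by (simp_all add: W_def)
  let ?T = "complement_clutter n d C"
  have T: "?T \<subseteq> nsets {1..n} d" by (auto simp: complement_clutter_def)
  have I: "I = {p \<in> poly_ring n. \<forall>t\<in>keys p. has_generator ?T t}"
    unfolding I_def by (rule circuit_ideal_eq[OF T])
  have card_minus: "card (W - s) = n - m" if "s \<in> nsets W m" for s m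
    using that by (simp add: nsets_def card_Diff_subset W(2))
  define f :: "nat set \<Rightarrow> 'k" where "f s = (if s = W - G then 1 else 0)" for s
  define u :: "nat set \<Rightarrow> 'k mpoly" where "u s = single (sqfree_mon (W - s)) (bd W f s)" for s
  have "u s \<in> I \<and> homogeneous (int n - int i) (u s)" if s: "s \<in> nsets W i" for s
  proof
    have "card (W - s) = d + 1" using card_minus[OF s] n by simp
    then have "has_generator ?T (sqfree_mon (W - s))"
      using W(1) by (intro has_generator_large_support[OF noclique]) (auto simp: W_def)
    then show "u s \<in> I" using W(1) by (auto simp: I u_def poly_ring_def W_def)
    show "homogeneous (int n - int i) (u s)"
      using W(1) n \<open>card (W - s) = d + 1\<close> by (auto simp: u_def homogeneous_def mon_deg_sqfree_mon)
  qed
  then have "vec_of n i u \<in> tensor_comp (koszul n) I i (int n)"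
    by (auto simp: tensor_comp_koszul W_def)
  moreover have "fc_diff (koszul n) i (vec_of n i u) = 0"
  proof (cases i)
    case (Suc i')
    have "kos var W u r = 0" if r: "r \<in> nsets W i'" for r
    proof -
      have "r \<subseteq> W" "finite r" using r by (auto simp: nsets_def)
      then show ?thesis
        using kos_var_sqfree[OF W(1), of r "bd W f"] kos_kos[OF W(1), of r "\<lambda>_. 1" f]
        by (simp add: u_def[abs_def])
    qed
    then show ?thesis unfolding Suc fc_diff_koszul by (simp add: vec_of_eq_0_iff W_def)
  qed simp
  ultimately have "vec_of n i u \<in> tensor_boundaries (koszul n) I i (int n)"
    using sub by (auto simp: tensor_cycles_def)
  then obtain w where w: "\<forall>s\<in>nsets W (Suc i). w s \<in> I"
    "vec_of n i u = fc_diff (koszul n) (Suc i) (vec_of n (Suc i) w)"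
    by (auto simp: tensor_boundaries_def tensor_comp_koszul W_def)
  have kos_w: "kos var W w s = u s" if "s \<in> nsets W i" for s
  proof -
    have "vec_of n i (\<lambda>s. u s - kos var {1..n} w s) = 0"
      using w(2) by (simp add: fc_diff_koszul vec_of_diff[symmetric])
    then show ?thesis using that by (simp add: vec_of_eq_0_iff W_def)
  qed
  \<comment> \<open>In the fine degree of the product of all variables, \<open>f\<close> and \<open>y\<close> have the same boundary.\<close>
  define y where "y = fine_part w (sqfree_mon W)"
  have sq_minus: "sqfree_mon W - sqfree_mon s = sqfree_mon (W - s)" if "s \<subseteq> W" for s
    using that W(1) finite_subset[OF that W(1)]
    by (intro poly_mapping_eqI) (auto simp: lookup_mon_minus lookup_sqfree_mon)
  have bd_y: "bd W y s = bd W f s" if s: "s \<in> nsets W i" for s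
  proof -
    have sW: "finite s" "s \<subseteq> W" using s by (auto simp: nsets_def)
    have "lookup (kos var {1..n} w s) (sqfree_mon W - sqfree_mon s) = bd W y s"
      using lookup_kos_var[of s "sqfree_mon W" n w] sW W(1) by (simp add: y_def W_def)
    then show ?thesis using kos_w[OF s] sq_minus[OF sW(2)] by (simp add: u_def W_def)
  qed
  have "y (W - F) = 0" if F: "F \<in> C" for F
  proof -
    have FW: "F \<subseteq> W" "card F = d" "finite F" using F C by (auto simp: nsets_def W_def)
    have "W - F \<in> nsets W (Suc i)"
      using FW W n by (auto simp: nsets_def card_Diff_subset)
    then have "w (W - F) \<in> I" using w(1) by blast
    moreover have "\<not> has_generator ?T (sqfree_mon F)"
    proof
      assume "has_generator ?T (sqfree_mon F)"
      then obtain A where "A \<in> ?T" "A \<subseteq> F" using FW by (auto simp: has_generator_def)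
      moreover then have "card A = d" using T by (auto simp: nsets_def)
      ultimately have "A = F" using card_subset_eq[OF FW(3)] FW(2) by auto
      then show False using \<open>A \<in> ?T\<close> F by (simp add: complement_clutter_def)
    qed
    ultimately have "lookup (w (W - F)) (sqfree_mon F) = 0" by (auto simp: I in_keys_iff)
    moreover have "W - (W - F) = F" using FW(1) by auto
    ultimately show ?thesis using W(1) by (simp add: y_def fine_part_def sq_minus)
  qed
  moreover have "f (W - F) = (if F = G then 1 else 0)" if "F \<in> C" for F
  proof -
    have "F \<subseteq> W" "G \<subseteq> W" using that z(2) C by (auto simp: nsets_def W_def)
    then have "W - F = W - G \<longleftrightarrow> F = G" by auto
    then show ?thesis by (simp add: f_def)
  qed
  ultimately have fy: "f (W - F) - y (W - F) = (if F = G then 1 else 0)" if "F \<in> C" for F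
    using that by simp
  let ?h = "\<lambda>s. f s - y s"
  have "1 \<in> W" using n by (simp add: W_def)
  have bd_h: "bd W (cone 1 ?h) (W - F) = ?h (W - F)" if F: "F \<in> C" for F
  proof (rule bd_cone[OF W(1) \<open>1 \<in> W\<close>])
    fix r assume r: "W - F = insert 1 r" "1 \<notin> r"
    have FW: "F \<subseteq> W" "card F = d" "finite F" using F C by (auto simp: nsets_def W_def)
    then have "card (W - F) = i + 1" using W n by (simp add: card_Diff_subset)
    moreover have "finite r" using r W by (metis finite_Diff finite_insert)
    ultimately have "r \<in> nsets W i" using r by (auto simp: nsets_def)
    then show "bd W ?h r = 0" using bd_y by (simp add: kos_diff)
  qed auto
  have finC: "finite C" using C finite_imp_finite_nsets[of "{1..n}"] finite_subset by blast
  have "0 = (\<Sum>F\<in>C. z F * twist W F * bd W (cone 1 ?h) (W - F))"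
    using koszul_pairing_cycle[OF W(1) _ d z(1)] C by (simp add: W_def)
  also have "\<dots> = (\<Sum>F\<in>C. if F = G then z G * twist W G else 0)"
    using bd_h fy by (intro sum.cong) auto
  also have "\<dots> = z G * twist W G" using finC z(2) by simp
  finally have "z G * twist W G * twist W G = 0" by simp
  then show False using z(3) by (simp only: mult.assoc twist_square) simp
qed

text \<open>
  The ideal is generated in degree \<open>d\<close>, which determines its initial degree and gives \<open>reg \<ge> d\<close>.  So
  the question is whether \<open>Tor\<^sub>i\<close> vanishes in degree \<open>j\<close> whenever \<open>j - i > d\<close>.  The inequality \<open>d < n\<close>
  and the clique condition exclude the zero ideal.
\<close>

theorem linear_resolution_iff_acyclic:
  assumes d: "d \<ge> 1" and C: "C \<subseteq> nsets {1..n} d" and n: "d < n"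
    and noclique: "\<forall>V\<in>nsets {1..n} (d + 1). \<not> nsets V d \<subseteq> C"
  shows "has_linear_resolution n d (circuit_ideal n (complement_clutter n d C) :: 'k::field mpoly set)
    \<longleftrightarrow> (\<forall>z :: nat set \<Rightarrow> 'k. clutter_cycle d C z \<longrightarrow> (\<forall>F\<in>C. z F = 0))"
proof -
  let ?T = "complement_clutter n d C"
  let ?I = "circuit_ideal n ?T :: 'k mpoly set"
  have T: "?T \<subseteq> nsets {1..n} d" by (auto simp: complement_clutter_def)
  have "{1..d + 1} \<in> nsets {1..n} (d + 1)" using n by (auto simp: nsets_def)
  with noclique obtain A where "A \<in> nsets {1..d + 1} d" "A \<notin> C" by blast
  then have "A \<in> ?T" using n by (auto simp: complement_clutter_def nsets_def)
  then have T0: "?T \<noteq> {}" by blast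
  have betti: "betti n ?I i j \<noteq> 0 \<longleftrightarrow>
      \<not> tensor_cycles (koszul n) ?I i j \<subseteq> tensor_boundaries (koszul n) ?I i j" for i j
    by (rule betti_neq_0_iff[OF is_ideal_circuit_ideal[OF T]])
  let ?S = "{ereal (real_of_int (j - int i)) | i j. betti n ?I i j \<noteq> 0}"
  have linear: "has_linear_resolution n d ?I \<longleftrightarrow> Sup ?S = ereal (real d)"
    using circuit_ideal_neq_0[OF T T0, where 'k = 'k] indeg_circuit_ideal[OF T T0, where 'k = 'k]
    by (simp add: has_linear_resolution_def reg_def)
  show ?thesis
  proof
    assume lin: "has_linear_resolution n d ?I"
    show "\<forall>z :: nat set \<Rightarrow> 'k. clutter_cycle d C z \<longrightarrow> (\<forall>F\<in>C. z F = 0)"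
    proof (intro allI impI ballI, rule ccontr)
      fix z :: "nat set \<Rightarrow> 'k" and G assume "clutter_cycle d C z" "G \<in> C" "z G \<noteq> 0"
      \<comment> \<open>By Hochster's formula a top cycle of the whole complex appears in this position.\<close>
      then have "betti n ?I (n - d - 1) (int n) \<noteq> 0"
        unfolding betti using n by (intro koszul_circuit_ideal_not_acyclic[OF d C _ noclique]) auto
      then have "ereal (real_of_int (int n - int (n - d - 1))) \<in> ?S" by blast
      then have "ereal (real_of_int (int n - int (n - d - 1))) \<le> Sup ?S" by (rule Sup_upper)
      then show False using lin linear n by simp
    qed
  next
    assume acyclic: "\<forall>z :: nat set \<Rightarrow> 'k. clutter_cycle d C z \<longrightarrow> (\<forall>F\<in>C. z F = 0)"
    have "Sup ?S \<le> ereal (real d)"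
    proof (rule Sup_least)
      fix x assume "x \<in> ?S"
      then obtain i j where x: "x = ereal (real_of_int (j - int i))" and "betti n ?I i j \<noteq> 0" by blast
      then have "\<not> j - int i > int d"
        unfolding betti using koszul_circuit_ideal_acyclic[OF d C noclique, where 'k = 'k] acyclic
        by blast
      then have "real_of_int (j - int i) \<le> real d" by linarith
      then show "x \<le> ereal (real d)" by (simp add: x)
    qed
    moreover have "ereal (real d) \<le> Sup ?S"
    proof -
      have "betti n ?I 0 (int d) \<noteq> 0"
        unfolding betti by (rule koszul_circuit_ideal_generators[OF T T0])
      then have "ereal (real_of_int (int d - int 0)) \<in> ?S" by blast
      from Sup_upper[OF this] show ?thesis by simp
    qed
    ultimately show "has_linear_resolution n d ?I" unfolding linear by (rule antisym)
  qed
qed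


section \<open>Cycles on pseudo-manifolds\<close>

lemma pseudo_manifold_chain:
  assumes "pseudo_manifold d C" "F \<in> C" "G \<in> C"
  obtains s and H :: "nat \<Rightarrow> nat set" where "H 0 = F" "H s = G" "\<forall>i\<le>s. H i \<in> C"
    "\<forall>i<s. card (H i \<inter> H (Suc i)) = d - 1"
proof -
  have "strongly_connected d C" using assms(1) by (simp add: pseudo_manifold_def)
  from this[unfolded strongly_connected_def, THEN bspec, OF assms(2), THEN bspec, OF assms(3)]
  show thesis by (elim exE conjE) (rule that)
qed

lemma pseudo_manifold_ridge:
  assumes "pseudo_manifold d C" "card e = d - 1" "F \<in> C" "G \<in> C" "F \<noteq> G" "e \<subseteq> F" "e \<subseteq> G"
  shows "{H \<in> C. e \<subseteq> H} = {F, G}"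
proof -
  have "e \<in> SC d C" using assms by (auto simp: SC_def)
  then have card: "card {H \<in> C. e \<subseteq> H} = 2"
    using assms(1) by (simp add: pseudo_manifold_def clutter_deg_def)
  then have "finite {H \<in> C. e \<subseteq> H}" by (metis card.infinite zero_neq_numeral)
  then show ?thesis
    using assms card by (intro card_subset_eq[symmetric]) auto
qed

lemma ridge_two_circuits:
  assumes "pseudo_manifold d C" "e \<in> SC d C"
  obtains F G where "F \<in> C" "G \<in> C" "F \<noteq> G" "e \<subseteq> F" "e \<subseteq> G" "{H \<in> C. e \<subseteq> H} = {F, G}"
proof -
  have "card {H \<in> C. e \<subseteq> H} = 2"
    using assms by (simp add: pseudo_manifold_def clutter_deg_def)
  then obtain F G where "{H \<in> C. e \<subseteq> H} = {F, G}" "F \<noteq> G" by (auto simp: card_2_iff)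
  then show thesis by (intro that[of F G]) blast+
qed

lemma clutter_cycle_iff_ridges:
  assumes "pseudo_manifold d C"
  shows "clutter_cycle d C z \<longleftrightarrow>
    (\<forall>e F G. card e = d - 1 \<longrightarrow> F \<in> C \<longrightarrow> G \<in> C \<longrightarrow> F \<noteq> G \<longrightarrow> e \<subseteq> F \<longrightarrow> e \<subseteq> G \<longrightarrow>
      z F * vertex_sign (the_elem (F - e)) F = - (z G * vertex_sign (the_elem (G - e)) G))"
    (is "?L \<longleftrightarrow> ?R")
proof
  assume ?L
  show ?R
  proof (intro allI impI)
    fix e F G assume *: "card e = d - 1" "F \<in> C" "G \<in> C" "F \<noteq> G" "e \<subseteq> F" "e \<subseteq> G"
    have "(\<Sum>H\<in>{H \<in> C. e \<subseteq> H}. z H * vertex_sign (the_elem (H - e)) H) = 0"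
      using \<open>?L\<close> *(1) by (simp add: clutter_cycle_def)
    then show "z F * vertex_sign (the_elem (F - e)) F = - (z G * vertex_sign (the_elem (G - e)) G)"
      unfolding pseudo_manifold_ridge[OF assms *] using *(4) by (simp add: eq_neg_iff_add_eq_0)
  qed
next
  assume R: ?R
  show ?L
    unfolding clutter_cycle_def
  proof (intro allI impI)
    fix e :: "nat set" assume e: "card e = d - 1"
    show "(\<Sum>F\<in>{F \<in> C. e \<subseteq> F}. z F * vertex_sign (the_elem (F - e)) F) = 0"
    proof (cases "e \<in> SC d C")
      case True
      then obtain F G where FG: "F \<in> C" "G \<in> C" "F \<noteq> G" "e \<subseteq> F" "e \<subseteq> G" "{H \<in> C. e \<subseteq> H} = {F, G}"
        using ridge_two_circuits[OF assms] by metis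
      then show ?thesis unfolding FG(6) using R[rule_format, OF e FG(1-5)] by simp
    next
      case False
      then have "{F \<in> C. e \<subseteq> F} = {}" using e by (auto simp: SC_def)
      then show ?thesis by (simp only: sum.empty)
    qed
  qed
qed

text \<open>
  The sum over a ridge has two terms with coefficients \<open>\<plusminus>1\<close>, so neighbouring circuits have
  the same coefficient up to sign, and this propagates along the chains of circuits.
\<close>

lemma clutter_cycle_constant_up_to_sign:
  fixes z :: "nat set \<Rightarrow> 'k::field"
  assumes pm: "pseudo_manifold d C" and z: "clutter_cycle d C z" and FG: "F \<in> C" "G \<in> C"
  shows "z G = z F \<or> z G = - z F"
proof -
  have adjacent: "z H' = z H \<or> z H' = - z H"
    if "H \<in> C" "H' \<in> C" "card (H \<inter> H') = d - 1" for H H'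
  proof (cases "H = H'")
    case False
    let ?e = "H \<inter> H'"
    have "z H * vertex_sign (the_elem (H - ?e)) H = - (z H' * vertex_sign (the_elem (H' - ?e)) H')"
      using z[unfolded clutter_cycle_iff_ridges[OF pm]] that False by blast
    then show ?thesis
      by (cases "even (card {u \<in> H. u < the_elem (H - ?e)})";
          cases "even (card {u \<in> H'. u < the_elem (H' - ?e)})";
          simp add: vertex_sign_def; metis minus_minus)
  qed simp
  obtain s and H :: "nat \<Rightarrow> nat set" where H: "H 0 = F" "H s = G" "\<forall>i\<le>s. H i \<in> C"
    "\<forall>i<s. card (H i \<inter> H (Suc i)) = d - 1"
    by (rule pseudo_manifold_chain[OF pm FG])
  have "i \<le> s \<Longrightarrow> z (H i) = z F \<or> z (H i) = - z F" for i
  proof (induction i)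
    case (Suc i)
    then have "z (H i) = z F \<or> z (H i) = - z F" by simp
    moreover have "z (H (Suc i)) = z (H i) \<or> z (H (Suc i)) = - z (H i)"
      using Suc.prems H(3,4) by (intro adjacent) auto
    ultimately show ?case by (metis minus_minus)
  qed (simp add: H(1))
  from this[of s] show ?thesis by (simp add: H(2))
qed

lemma induced_orientation_vertex_sign:
  "induced_orientation ori F e = ori F * vertex_sign (the_elem (F - e)) F"
  by (simp add: induced_orientation_def vertex_sign_def)

lemma of_int_vertex_sign: "of_int (vertex_sign k s) = vertex_sign k s"
  by (simp add: vertex_sign_def)

lemma orientable_imp_cycle:
  assumes pm: "pseudo_manifold d C" and "orientable d C"
  shows "\<exists>z :: nat set \<Rightarrow> 'k::field. clutter_cycle d C z \<and> (\<exists>F\<in>C. z F \<noteq> 0)"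
proof -
  obtain ori where ori: "\<forall>F\<in>C. ori F = 1 \<or> ori F = - 1"
    "\<forall>e\<in>SC d C. \<forall>F\<in>C. \<forall>G\<in>C. F \<noteq> G \<and> e \<subseteq> F \<and> e \<subseteq> G \<longrightarrow>
       induced_orientation ori F e = - induced_orientation ori G e"
    using assms(2) by (auto simp: orientable_def)
  define z where "z F = (of_int (ori F) :: 'k)" for F
  have "clutter_cycle d C z"
    unfolding clutter_cycle_iff_ridges[OF pm]
  proof (intro allI impI)
    fix e F G assume *: "card e = d - 1" "F \<in> C" "G \<in> C" "F \<noteq> G" "e \<subseteq> F" "e \<subseteq> G"
    then have "e \<in> SC d C" by (auto simp: SC_def)
    with ori(2) * have "induced_orientation ori F e = - induced_orientation ori G e" by blast
    then have "of_int (ori F * vertex_sign (the_elem (F - e)) F)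
        = (of_int (- (ori G * vertex_sign (the_elem (G - e)) G)) :: 'k)"
      by (simp add: induced_orientation_vertex_sign)
    then show "z F * vertex_sign (the_elem (F - e)) F = - (z G * vertex_sign (the_elem (G - e)) G)"
      by (simp add: z_def of_int_vertex_sign)
  qed
  moreover obtain F where "F \<in> C" using pm by (auto simp: pseudo_manifold_def)
  moreover then have "z F \<noteq> 0" using ori(1) by (auto simp: z_def)
  ultimately show ?thesis by blast
qed

text \<open>
  All signs are 1, and every ridge lies in an even number of circuits.
\<close>

lemma CHAR_2_imp_cycle:
  assumes pm: "pseudo_manifold d C" and "CHAR('k::field) = 2"
  shows "\<exists>z :: nat set \<Rightarrow> 'k. clutter_cycle d C z \<and> (\<exists>F\<in>C. z F \<noteq> 0)"
proof -
  have "of_nat CHAR('k) = (0 :: 'k)" by (rule of_nat_CHAR)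
  then have "(1 :: 'k) + 1 = 0" by (simp add: assms(2))
  then have minus_1: "(- 1 :: 'k) = 1" by (simp add: minus_unique)
  then have "vertex_sign k s = (1 :: 'k)" for k s
    unfolding vertex_sign_def minus_1 by simp
  then have "clutter_cycle d C (\<lambda>_. 1 :: 'k)"
    unfolding clutter_cycle_iff_ridges[OF pm] using minus_1 by simp
  then show ?thesis using pm by (intro exI[of _ "\<lambda>_. 1"]) (auto simp: pseudo_manifold_def)
qed

text \<open>
  Comparison with a fixed nonzero value turns the coefficients of the cycle into integer signs.  Two
  signs that cancel in \<open>K\<close> cancel as integers because \<open>2 \<noteq> 0\<close> in \<open>K\<close>.
\<close>

lemma cycle_imp_orientable:
  fixes z :: "nat set \<Rightarrow> 'k::field"
  assumes pm: "pseudo_manifold d C" and char: "CHAR('k) \<noteq> 2"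
    and z: "clutter_cycle d C z" and G: "G \<in> C" "z G \<noteq> 0"
  shows "orientable d C"
proof -
  have two: "(2 :: 'k) \<noteq> 0"
  proof
    assume "(2 :: 'k) = 0"
    then have "of_nat 2 = (0 :: 'k)" by simp
    then have "CHAR('k) dvd 2" by (simp only: of_nat_eq_0_iff_char_dvd)
    then have "CHAR('k) \<le> 2" by (rule dvd_imp_le) simp
    moreover have "CHAR('k) \<noteq> 0" using \<open>CHAR('k) dvd 2\<close> by (metis dvd_0_left zero_neq_numeral)
    moreover have "CHAR('k) \<noteq> 1" by simp
    ultimately show False using char by linarith
  qed
  define ori :: "nat set \<Rightarrow> int" where "ori F = (if z F = z G then 1 else - 1)" for F
  have z_ori: "z F = of_int (ori F) * z G" if "F \<in> C" for F
    using clutter_cycle_constant_up_to_sign[OF pm z G(1) that] by (auto simp: ori_def)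
  have signs: "a = - b" if "a \<in> {1, - 1}" "b \<in> {1, - 1}" "of_int a = (- of_int b :: 'k)" for a b :: int
    using that two by auto
  have "induced_orientation ori F e = - induced_orientation ori F' e"
    if e: "e \<in> SC d C" and F: "F \<in> C" "F' \<in> C" "F \<noteq> F'" "e \<subseteq> F" "e \<subseteq> F'" for e F F'
  proof (rule signs)
    have sgn: "vertex_sign k s \<in> {1, - 1 :: int}" for k s
      by (cases "even (card {u \<in> s. u < k})") (auto simp: vertex_sign_def)
    show "induced_orientation ori F e \<in> {1, - 1}" "induced_orientation ori F' e \<in> {1, - 1}"
      unfolding induced_orientation_vertex_sign
      using sgn[of "the_elem (F - e)" F] sgn[of "the_elem (F' - e)" F'] by (auto simp: ori_def)
    have "card e = d - 1" using e by (simp add: SC_def)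
    then have "z F * vertex_sign (the_elem (F - e)) F = - (z F' * vertex_sign (the_elem (F' - e)) F')"
      using z[unfolded clutter_cycle_iff_ridges[OF pm]] F by blast
    then have "z G * of_int (induced_orientation ori F e)
        = z G * (- of_int (induced_orientation ori F' e))"
      by (simp add: z_ori F induced_orientation_vertex_sign of_int_vertex_sign mult_ac)
    then show "of_int (induced_orientation ori F e) = - (of_int (induced_orientation ori F' e) :: 'k)"
      using G(2) mult_left_cancel by blast
  qed
  then show ?thesis
    unfolding orientable_def by (intro exI[of _ ori]) (auto simp: ori_def)
qed

text \<open>
  Extended by zero, \<open>z\<close> becomes a cycle on \<open>C\<close> that vanishes on the circuits outside \<open>C'\<close>.
\<close>

lemma proper_subclutter_acyclic:
  fixes z :: "nat set \<Rightarrow> 'k::field"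
  assumes pm: "pseudo_manifold d C" and fin: "finite C" and sub: "C' \<subset> C" and z: "clutter_cycle d C' z"
  shows "\<forall>F\<in>C'. z F = 0"
proof
  fix F assume F: "F \<in> C'"
  obtain G where G: "G \<in> C" "G \<notin> C'" using sub by blast
  define z' where "z' F = (if F \<in> C' then z F else 0)" for F
  have "clutter_cycle d C z'"
    unfolding z'_def[abs_def] by (rule clutter_cycle_extend[OF fin _ z]) (use sub in auto)
  then have "z' F = z' G \<or> z' F = - z' G"
    using clutter_cycle_constant_up_to_sign[OF pm _ G(1)] F sub by blast
  then show "z F = 0" using F G by (simp add: z'_def)
qed


section \<open>The boundary of a simplex\<close>

lemma two_facets_of_simplex:
  assumes V: "finite V" "card V = d + 1" and F: "F \<in> nsets V d" "G \<in> nsets V d" "F \<noteq> G"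
    and e: "card e = d - 1" "e \<subseteq> F" "e \<subseteq> G" and d: "d \<ge> 1"
  obtains a b where "a \<in> V" "b \<in> V" "a \<noteq> b" "F = V - {a}" "G = V - {b}"
    "e = V - {a, b}"
proof -
  have FV: "F \<subseteq> V" "card F = d" "finite F" "G \<subseteq> V" "card G = d" "finite G"
    using F by (auto simp: nsets_def)
  have cards: "1 \<le> d + 1" "card F = d + 1 - 1" "card G = d + 1 - 1" using FV by simp_all
  obtain a where a: "a \<in> V" "a \<notin> F" "F = V - {a}"
    by (rule remove_one_element[OF V cards(1) FV(1) cards(2)])
  obtain b where b: "b \<in> V" "b \<notin> G" "G = V - {b}"
    by (rule remove_one_element[OF V cards(1) FV(4) cards(3)])
  have ab: "a \<noteq> b" using F(3) a b by auto
  have "card (V - {a, b}) = d - 1" using V a b ab by (simp add: card_Diff_subset)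
  moreover have "e \<subseteq> V - {a, b}" using e a b by auto
  ultimately have "e = V - {a, b}" using e(1) V by (intro card_subset_eq) auto
  then show thesis using that a b ab by blast
qed

text \<open>
  The facets receive the orientation induced by the simplex \<open>V\<close> itself; it is coherent for the same
  reason for which the boundary of a boundary vanishes.
\<close>

lemma simplex_boundary_orientable:
  assumes "d \<ge> 1" "simplex_boundary n d C"
  shows "orientable d C"
proof -
  obtain V where V: "finite V" "card V = d + 1" "C = nsets V d"
    using assms(2) by (auto simp: simplex_boundary_def nsets_def)
  define ori :: "nat set \<Rightarrow> int" where "ori F = vertex_sign (the_elem (V - F)) V" for F
  have opposite: "induced_orientation ori F e = - induced_orientation ori G e"
    if e: "e \<in> SC d C" "e \<subseteq> F" "e \<subseteq> G" and F: "F \<in> C" "G \<in> C" "F \<noteq> G" for e F G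
  proof -
    have card: "card e = d - 1" using e(1) by (simp add: SC_def)
    obtain a b where ab: "a \<in> V" "b \<in> V" "a \<noteq> b" "F = V - {a}" "G = V - {b}" "e = V - {a, b}"
      by (rule two_facets_of_simplex[OF V(1,2) F[unfolded V(3)] card e(2,3) assms(1)])
    have "V - F = {a}" "V - G = {b}" "F - e = {b}" "G - e = {a}" using ab by auto
    then have "induced_orientation ori F e = vertex_sign a V * vertex_sign b (V - {a})"
      "induced_orientation ori G e = vertex_sign b V * vertex_sign a (V - {b})"
      using ab by (simp_all add: induced_orientation_vertex_sign ori_def)
    moreover have "vertex_sign x V = (if y < x then - vertex_sign x (V - {y}) else vertex_sign x (V - {y}) :: int)"
      if "y \<in> V" for x y
      using vertex_sign_insert[of "V - {y}" y x] V(1) that by (simp add: insert_absorb)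
    note this[of b a] this[of a b]
    ultimately show ?thesis using ab(1-3) by auto
  qed
  have "ori F = 1 \<or> ori F = - 1" for F
    by (cases "even (card {u \<in> V. u < the_elem (V - F)})") (auto simp: ori_def vertex_sign_def)
  then show ?thesis
    unfolding orientable_def
  proof (intro exI[of _ ori] conjI ballI impI; (elim conjE)?)
    fix e F G
    assume "e \<in> SC d C" "F \<in> C" "G \<in> C" "F \<noteq> G" "e \<subseteq> F" "e \<subseteq> G"
    then show "induced_orientation ori F e = - induced_orientation ori G e" by (intro opposite)
  qed
qed

text \<open>
  The two circuits through a ridge of the simplex on a clique \<open>V\<close> are facets of that simplex, so a
  chain of circuits starting at a facet of \<open>V\<close> cannot leave its boundary, and \<open>C\<close> would be that
  boundary.
\<close>

lemma pseudo_manifold_no_large_clique: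
  assumes d: "d \<ge> 1" and C: "uniform_clutter n d C" and pm: "pseudo_manifold d C"
    and not_simplex: "\<not> simplex_boundary n d C"
  shows "\<forall>V\<in>nsets {1..n} (d + 1). \<not> nsets V d \<subseteq> C"
proof (intro ballI notI)
  fix V assume V: "V \<in> nsets {1..n} (d + 1)" and sub: "nsets V d \<subseteq> C"
  then have finV: "finite V" and cardV: "card V = d + 1" by (auto simp: nsets_def)
  have adjacent: "H' \<in> nsets V d"
    if H: "H \<in> nsets V d" and H': "H' \<in> C" and card: "card (H \<inter> H') = d - 1" for H H'
  proof -
    let ?e = "H \<inter> H'"
    have HV: "finite H" "card H = d" "H \<subseteq> V" using H by (auto simp: nsets_def)
    obtain k where k: "k \<in> H" "?e = H - {k}"
      using remove_one_element[OF HV(1,2) d _ card] by (metis Int_lower1)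
    obtain v where v: "v \<in> V" "v \<notin> H"
      using HV finV cardV by (metis card_seteq le_add1 less_add_one not_le subsetI)
    define G where "G = insert v ?e"
    have "finite ?e" using HV by simp
    have G: "G \<in> nsets V d"
      using \<open>finite ?e\<close> card v HV d by (auto simp: G_def nsets_def)
    have "G \<noteq> H" using v by (auto simp: G_def)
    have "{F \<in> C. ?e \<subseteq> F} = {H, G}"
      by (rule pseudo_manifold_ridge[OF pm card]) (use sub H G \<open>G \<noteq> H\<close> in \<open>auto simp: G_def\<close>)
    moreover have "H' \<in> {F \<in> C. ?e \<subseteq> F}" using H' by simp
    ultimately have "H' = H \<or> H' = G" by simp
    then show ?thesis using H G by blast
  qed
  obtain F where F: "F \<in> nsets V d"
    using nsets_eq_empty_iff[of V d] finV cardV by fastforce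
  have "G \<in> nsets V d" if G: "G \<in> C" for G
  proof -
    have "F \<in> C" using F sub by blast
    obtain s and H :: "nat \<Rightarrow> nat set" where H: "H 0 = F" "H s = G" "\<forall>i\<le>s. H i \<in> C"
      "\<forall>i<s. card (H i \<inter> H (Suc i)) = d - 1"
      by (rule pseudo_manifold_chain[OF pm \<open>F \<in> C\<close> G])
    have "i \<le> s \<Longrightarrow> H i \<in> nsets V d" for i
    proof (induction i)
      case (Suc i)
      have "H i \<in> nsets V d" using Suc by simp
      moreover have "H (Suc i) \<in> C" "card (H i \<inter> H (Suc i)) = d - 1"
        using H(3,4) Suc.prems by simp_all
      ultimately show ?case by (rule adjacent)
    qed (simp add: H(1) F)
    from this[of s] show ?thesis by (simp add: H(2))
  qed
  then have "C = nsets V d" using sub by blast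
  then show False using not_simplex V by (auto simp: simplex_boundary_def)
qed

lemma complex_dim_clique_complex:
  assumes C: "C \<subseteq> nsets {1..n} d" "C \<noteq> {}"
    and noclique: "\<forall>V\<in>nsets {1..n} (d + 1). \<not> nsets V d \<subseteq> C"
  shows "complex_dim (clique_complex n d C) = int d - 1"
proof -
  have "finite (clique_complex n d C)"
    by (rule finite_subset[of _ "Pow {1..n}"]) (auto simp: clique_complex_def)
  moreover have "card V \<le> d" if V: "V \<in> clique_complex n d C" for V
  proof (rule ccontr)
    assume "\<not> card V \<le> d"
    then have "d + 1 \<le> card V" by simp
    then obtain U where U: "U \<subseteq> V" "card U = d + 1" "finite U" by (rule obtain_subset_with_card_n)
    have "V \<subseteq> {1..n}" "nsets V d \<subseteq> C" using V by (auto simp: clique_complex_def)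
    moreover from this(1) have "U \<in> nsets {1..n} (d + 1)" using U by (auto simp: nsets_def)
    moreover note nsets_mono[OF U(1), of d]
    ultimately have "U \<in> nsets {1..n} (d + 1)" "nsets U d \<subseteq> C" by blast+
    then show False using noclique by blast
  qed
  moreover have "d \<in> card ` clique_complex n d C"
  proof -
    obtain F where F: "F \<in> C" using C(2) by blast
    then have F': "F \<subseteq> {1..n}" "card F = d" "finite F" using C(1) by (auto simp: nsets_def)
    have "nsets F d = {F}" using F' card_subset_eq by (auto simp: nsets_def)
    then have "F \<in> clique_complex n d C" using F F' by (simp add: clique_complex_def)
    then show ?thesis using F'(2) by blast
  qed
  ultimately have "Max (card ` clique_complex n d C) = d" by (intro Max_eqI) auto
  then show ?thesis by (simp add: complex_dim_def)
qed

text \<open>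
  A ridge lies in two distinct circuits, while there is at most one \<open>d\<close>-subset if \<open>n \<le> d\<close>.
\<close>

lemma pseudo_manifold_vertex_bound:
  assumes d: "d \<ge> 1" and C: "uniform_clutter n d C" and pm: "pseudo_manifold d C"
  shows "d < n"
proof (rule ccontr)
  assume "\<not> d < n"
  have circuit: "F = {1..n}" if "F \<in> C" for F
  proof -
    have "F \<subseteq> {1..n}" "card F = d" using that C by (auto simp: uniform_clutter_def nsets_def)
    then show ?thesis using \<open>\<not> d < n\<close> by (intro card_seteq) auto
  qed
  obtain F where F: "F \<in> C" using pm by (auto simp: pseudo_manifold_def)
  then have "d - 1 \<le> card F" using C by (auto simp: uniform_clutter_def nsets_def)
  then obtain e where "e \<subseteq> F" "card e = d - 1" by (rule obtain_subset_with_card_n)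
  then have "e \<in> SC d C" using F by (auto simp: SC_def)
  then obtain G H where "G \<in> C" "H \<in> C" "G \<noteq> H" using ridge_two_circuits[OF pm] by metis
  then show False using circuit by blast
qed

lemma minimal_iff_cycle:
  assumes d: "d \<ge> 1" and C: "uniform_clutter n d C" and pm: "pseudo_manifold d C"
    and not_simplex: "\<not> simplex_boundary n d C"
  shows "minimal_to_linearity TYPE('k::field) n d C \<longleftrightarrow>
    (\<exists>z :: nat set \<Rightarrow> 'k. clutter_cycle d C z \<and> (\<exists>F\<in>C. z F \<noteq> 0))"
proof -
  note noclique = pseudo_manifold_no_large_clique[OF assms]
  note n = pseudo_manifold_vertex_bound[OF d C pm]
  have C_sub: "C \<subseteq> nsets {1..n} d" using C by (simp add: uniform_clutter_def)
  have finC: "finite C" using C_sub finite_imp_finite_nsets[of "{1..n}"] finite_subset by blast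
  have "has_linear_resolution n d (circuit_ideal n (complement_clutter n d C') :: 'k mpoly set)"
    if sub: "C' \<subset> C" for C'
  proof -
    have "C' \<subseteq> nsets {1..n} d" using C_sub sub by blast
    moreover have "\<forall>V\<in>nsets {1..n} (d + 1). \<not> nsets V d \<subseteq> C'" using noclique sub by blast
    ultimately show ?thesis
      using linear_resolution_iff_acyclic[OF d _ n, of C', where 'k = 'k]
        proper_subclutter_acyclic[OF pm finC sub, where 'k = 'k] by blast
  qed
  moreover have "C \<noteq> {}" using pm by (simp add: pseudo_manifold_def)
  ultimately show ?thesis
    unfolding minimal_to_linearity_def linear_resolution_iff_acyclic[OF d C_sub n noclique]
    using complex_dim_clique_complex[OF C_sub _ noclique] by blast
qed

theorem proposition6p5:
  fixes n d :: nat and C :: "nat set set"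
  assumes "d \<ge> 1"
    and "uniform_clutter n d C"
  shows "(pseudo_manifold d C \<and> orientable d C \<and> \<not> simplex_boundary n d C \<longrightarrow>
            minimal_to_linearity TYPE('k::field) n d C) \<and>
         (pseudo_manifold d C \<and> \<not> orientable d C \<longrightarrow>
            (minimal_to_linearity TYPE('k::field) n d C \<longleftrightarrow> CHAR('k) = 2))"
proof (intro conjI impI; elim conjE)
  assume "pseudo_manifold d C" "orientable d C" "\<not> simplex_boundary n d C"
  then show "minimal_to_linearity TYPE('k) n d C"
    using minimal_iff_cycle[OF assms] orientable_imp_cycle by blast
next
  assume pm: "pseudo_manifold d C" and not_or: "\<not> orientable d C"
  have "\<not> simplex_boundary n d C" using simplex_boundary_orientable[OF assms(1)] not_or by blast
  note minimal = minimal_iff_cycle[OF assms pm this, where 'k = 'k]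
  show "minimal_to_linearity TYPE('k) n d C \<longleftrightarrow> CHAR('k) = 2"
    unfolding minimal using CHAR_2_imp_cycle[OF pm] cycle_imp_orientable[OF pm] not_or by blast
qed

end
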